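(* As formal power series in $q$ (equivalently, for $|q|<1$), $$\begin{aligned}\sum_{n=0}^\infty \overline{\mathrm{spt}}_\omega(10n+5)q^n&=18E_1^2E_{10}+720q\frac{E_2E_{10}^4}{E_1E_5}+7625q^2\frac{E_2^2E_{10}^{7}}{E_1^{4}E_5^2}+32500q^3\frac{E_{2}^{3}E_{10}^{10}}{E_1^{7}E_5^3}+50000q^4\frac{E_{2}^{4}E_{10}^{13}}{E_1^{10}E_5^4}\end{aligned}$$ and $$\begin{aligned}\sum_{n=0}^\infty \overline{\mathrm{spt}}_\omega(50n+25)q^n &=8327 E_2E_5^{2}+28312350q\frac{E_2^{2}E_5E_{10}^{3}}{E_1^{3}}+7557865625q^2\frac{E_2^{3}E_{10}^{6}}{E_1^{6}}\\ &\quad+678027312500q^3\frac{E_2^{4}E_{10}^{9}}{E_1^{9}E_5}+3072484775\times10^4q^4\frac{E_2^{5}E_{10}^{12}}{E_1^{12}E_5^{2}}\\ &\quad+84314744\times10^7q^5\frac{E_2^{6}E_{10}^{15}}{E_1^{15}E_5^{3}}+154486601\times10^8q^6\frac{E_2^{7}E_{10}^{18}}{E_1^{18}E_5^{4}}\\ &\quad+20019467\times10^{10}q^7\frac{E_2^{8}E_{10}^{21}}{E_1^{21}E_5^{5}}+18998414\times10^{11}q^8\frac{E_2^{9}E_{10}^{24}}{E_1^{24}E_5^{6}}\\ &\quad+134691824\times10^{11}q^9\frac{E_2^{10}E_{10}^{27}}{E_1^{27}E_5^{7}}+71952464\times10^{12}q^{10}\frac{E_2^{11}E_{10}^{30}}{E_1^{30}E_5^{8}}\\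 &\quad+28911776\times10^{13}q^{11}\frac{E_2^{12}E_{10}^{33}}{E_1^{33}E_5^{9}}+862432\times10^{15}q^{12}\frac{E_2^{13}E_{10}^{36}}{E_1^{36}E_5^{10}}\\ &\quad+1856\times10^{18}q^{13}\frac{E_2^{14}E_{10}^{39}}{E_1^{39}E_5^{11}}+272896\times10^{16}q^{14}\frac{E_2^{15}E_{10}^{42}}{E_1^{42}E_5^{12}}\\ &\quad+24576\times10^{17}q^{15}\frac{E_2^{16}E_{10}^{45}}{E_1^{45}E_5^{13}}+1024\times10^{18}q^{16}\frac{E_2^{17}E_{10}^{48}}{E_1^{48}E_5^{14}}.\end{aligned}$$
   Context: For a positive integer $j$, $E_j:=(q^j;q^j)_\infty=\prod_{k\ge1}(1-q^{jk})$. An overpartition of $n$ is a partition of $n$ (into positive parts) in which the first occurrence of each distinct part size may or may not be overlined. $\overline{\mathrm{spt}}_\omega(n)$ denotes the total number of appearances of the smallest part (counted with multiplicity, overlined and non-overlined copies together), summed over all overpartitions of $n$ in which the smallest part is always overlined (i.e. its first occurrence is overlined) and all odd parts are less than twice the smallest part. For example, $\overline{\mathrm{spt}}_\omega(1)=1$ and $\overline{\mathrm{spt}}_\omega(3)=6$. *)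

theory Defs
  imports "HOL-Library.Multiset" "HOL-Computational_Algebra.Formal_Power_Series"
    "HOL-Analysis.Infinite_Products"
begin

text \<open>\<open>E j = (q\<^sup>j; q\<^sup>j)\<^sub>\<infinity>\<close> for \<open>j > 0\<close>, with \<open>fps_X\<close> as \<open>q\<close>; the infinite
  product is taken with respect to the \<open>fps_X\<close>-adic metric on formal power series.\<close>

definition E :: "nat \<Rightarrow> rat fps" where
  "E j = (\<Prod>k. 1 - fps_X ^ (j * (k + 1)))"

text \<open>An overpartition is a pair of the multiset of its parts (overlined and non-overlined copies
  together) and the set of those part sizes whose first occurrence is overlined.\<close>

definition overpartitions :: "nat \<Rightarrow> (nat multiset \<times> nat set) set" where
  "overpartitions n = {(P, U). \<Sum>\<^sub># P = n \<and> 0 \<notin># P \<and> U \<subseteq> set_mset P}"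

definition smallest_part :: "nat multiset \<Rightarrow> nat" where
  "smallest_part P = Min (set_mset P)"

text \<open>The condition \<open>smallest_part P \<in> U\<close> excludes the empty overpartition of 0, because there
  \<open>U = {}\<close>.\<close>

definition spt_omega_overpartitions :: "nat \<Rightarrow> (nat multiset \<times> nat set) set" where
  "spt_omega_overpartitions n =
     {(P, U) \<in> overpartitions n.
        smallest_part P \<in> U \<and> (\<forall>k\<in>#P. odd k \<longrightarrow> k < 2 * smallest_part P)}"

definition spt_omega_bar :: "nat \<Rightarrow> nat" where
  "spt_omega_bar n = (\<Sum>(P, U)\<in>spt_omega_overpartitions n. count P (smallest_part P))"

lemma finite_overpartitions: "finite (overpartitions n)"
proof -
  let ?M = "mset ` {xs. set xs \<subseteq> {..n} \<and> length xs \<le> n}"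
  have "overpartitions n \<subseteq> ?M \<times> Pow {..n}"
  proof
    fix x
    assume "x \<in> overpartitions n"
    then obtain P U where x: "x = (P, U)" and n: "\<Sum>\<^sub># P = n" and P: "0 \<notin># P"
      and U: "U \<subseteq> set_mset P"
      by (auto simp: overpartitions_def)
    have le: "k \<le> n" if k: "k \<in># P" for k
    proof -
      obtain Q where "P = add_mset k Q"
        using multi_member_split[OF k] by blast
      thus ?thesis
        using n by simp
    qed
    have size: "size Q \<le> \<Sum>\<^sub># Q" if "0 \<notin># Q" for Q :: "nat multiset"
      using that by (induction Q) auto
    obtain xs where xs: "mset xs = P"
      using ex_mset by blast
    have "set xs \<subseteq> {..n}"
      using le xs by auto
    moreover have "length xs \<le> n"
      using size[OF P] n by (simp flip: xs)
    ultimately have "P \<in> ?M"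
      using xs by blast
    moreover have "U \<in> Pow {..n}"
      using U le by auto
    ultimately show "x \<in> ?M \<times> Pow {..n}"
      unfolding x by (rule SigmaI)
  qed
  moreover have "finite (?M \<times> Pow {..n})"
    by (intro finite_cartesian_product finite_imageI finite_lists_length_le) auto
  ultimately show ?thesis
    by (rule finite_subset)
qed

lemma finite_spt_omega_overpartitions: "finite (spt_omega_overpartitions n)"
  by (rule finite_subset[OF _ finite_overpartitions]) (auto simp: spt_omega_overpartitions_def)

lemma E_has_prod:
  assumes "j > 0"
  shows "(\<lambda>k. 1 - fps_X ^ (j * (k + 1))) has_prod E j"
proof -
  define f :: "nat \<Rightarrow> rat fps" where "f = (\<lambda>k. 1 - fps_X ^ (j * (k + 1)))"
  define g where "g = (\<lambda>n. \<Prod>k\<le>n. f k)"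
  have step: "fps_nth (g (Suc n)) m = fps_nth (g n) m" if "m \<le> n" for m n
  proof -
    have "g (Suc n) = g n - fps_X ^ (j * (Suc n + 1)) * g n"
      by (simp add: g_def f_def algebra_simps)
    moreover have "m < j * (Suc n + 1)"
      using assms that by (cases j) auto
    ultimately show ?thesis
      by (simp add: fps_X_power_mult_nth)
  qed
  have stable: "fps_nth (g (m + d)) m = fps_nth (g m) m" for m d
    by (induction d) (auto simp: step)
  define L where "L = Abs_fps (\<lambda>m. fps_nth (g m) m)"
  have "g \<longlonglongrightarrow> L"
  proof (rule tendsto_fpsI)
    fix m
    show "eventually (\<lambda>n. fps_nth (g n) m = fps_nth L m) sequentially"
      unfolding eventually_sequentially L_def
      by (intro exI[of _ m]) (auto simp: stable le_iff_add)
  qed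
  moreover have "fps_nth L 0 = 1"
    using assms by (simp add: L_def g_def f_def)
  hence "L \<noteq> 0"
    by auto
  ultimately have L: "f has_prod L"
    by (simp add: has_prod_def raw_has_prod_def g_def)
  hence "L = E j"
    unfolding E_def f_def[symmetric] by (rule has_prod_unique)
  thus ?thesis
    using L by (simp only: f_def)
qed

end

theory Submission
  imports Defs "HOL-Computational_Algebra.Formal_Laurent_Series" "HOL-Computational_Algebra.Primes"
begin

text \<open>
  Summing over the smallest part gives \<open>E\<^sub>4 / E\<^sub>2\<^sup>2\<close> times a Bailey-type sum. Expanding
  \<open>(-q; q\<^sup>2)\<^sub>n\<close> by the finite triple product and telescoping, all contributions except
  \<open>\<Sum> q\<^sup>n / (1 - q\<^sup>n)\<^sup>2\<close> are even functions of \<open>q\<close>. The odd part of this Lambert series is the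
  logarithmic derivative of \<open>\<phi>(q) / \<phi>(-q)\<close>, and the Wronskian of \<open>\<phi>(q)\<close> and \<open>\<phi>(-q)\<close> is a square by
  Jacobi's identity for \<open>E\<^sub>1\<^sup>3\<close>; hence the values at odd arguments have generating function
  \<open>E\<^sub>2\<^sup>9 / E\<^sub>1\<^sup>6\<close>.

  It remains to extract twice the exponents congruent to \<open>2\<close> modulo \<open>5\<close>. Comparing the
  \<open>5\<close>-dissections of both sides of \<open>E\<^sub>1\<^sup>2 = \<phi>(-q) E\<^sub>2\<close> and \<open>E\<^sub>2\<^sup>2 = \<psi>(q) E\<^sub>1\<close> shows that \<open>E\<^sub>1\<close> and \<open>E\<^sub>2\<close> generate
  an extension of degree \<open>5\<close> of the field \<open>\<rat>(t)\<close> of functions of \<open>q\<^sup>5\<close>, with basis \<open>1\<close>, \<open>E\<^sub>1\<close>, \<open>E\<^sub>2\<close>,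
  \<open>\<phi>(-q)\<close>, \<open>\<psi>(q)\<close> after normalisation. The parameter \<open>t\<close> is related to eta quotients by the triple
  product and by the action of the Hecke operator at \<open>5\<close> on \<open>\<phi>\<^sup>2\<close> and \<open>\<psi>\<^sup>2\<close>. The required section is
  then a trace from this extension to \<open>\<rat>(t)\<close>, a finite computation.
\<close>

section \<open>Formal power series modulo a power of the variable\<close>

text \<open>All series are formal, so there is no free variable \<open>z\<close> and no root of
  unity. Triple products are therefore proved only at the special values that occur, from a
  three-term recurrence for the coefficients, and conjugation over the functions of q^5 is replaced
  by the grading of Laurent series by the exponent modulo 5. The outer terms of the 5-dissection of
  \<open>E 1\<close> are never written as products. Their product alone is forced by the grade 0
  part of one equation. After normalisation, \<open>r\<close> is the Rogers-Ramanujan continued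
  fraction at q^5 and \<open>s\<close> the one at q^10, and the classical relation between the two
  drops out of the same comparison. The coefficients of the theorem arise as follows. Each trace is
  a rational function of \<open>tt\<close> whose denominator has only the factors
  \<open>tt - 4\<close> and \<open>tt + 1\<close>. The Hecke relation for phi makes
  \<open>tt - 4\<close> an eta quotient, the reciprocal of the Hauptmodul at q^5, and the one for
  psi does the same for \<open>tt + 1\<close>. Expanding numerators in powers of
  \<open>tt - 4\<close> gives polynomials in the Hauptmodul.\<close>

definition eqN :: "nat \<Rightarrow> rat fps \<Rightarrow> rat fps \<Rightarrow> bool" where
  "eqN N f g \<longleftrightarrow> (\<forall>i<N. fps_nth f i = fps_nth g i)"

lemma eqN_refl [simp, intro]: "eqN N f f"
  by (simp add: eqN_def)

lemma eqN_sym: "eqN N f g \<Longrightarrow> eqN N g f"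
  by (simp add: eqN_def)

lemma eqN_trans [trans]: "eqN N f g \<Longrightarrow> eqN N g h \<Longrightarrow> eqN N f h"
  by (simp add: eqN_def)

lemma eqN_mono: "eqN N f g \<Longrightarrow> M \<le> N \<Longrightarrow> eqN M f g"
  by (simp add: eqN_def)

lemma eqN_mult: "eqN N f g \<Longrightarrow> eqN N f' g' \<Longrightarrow> eqN N (f * f') (g * g')"
  by (auto simp: eqN_def fps_mult_nth intro!: sum.cong)

lemma eqN_sum: "(\<And>x. x \<in> A \<Longrightarrow> eqN N (f x) (g x)) \<Longrightarrow> eqN N (\<Sum>x\<in>A. f x) (\<Sum>x\<in>A. g x)"
  by (auto simp: eqN_def fps_sum_nth intro!: sum.cong)

lemma eqN_cancel:
  assumes "eqN N (f * u) (g * u)" "fps_nth u 0 \<noteq> 0"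
  shows "eqN N f g"
proof -
  have "eqN N (f * u * inverse u) (g * u * inverse u)"
    using assms(1) by (rule eqN_mult) simp
  moreover have "u * inverse u = 1"
    using assms(2) by (simp add: inverse_mult_eq_1')
  ultimately show ?thesis
    by (simp add: mult.assoc)
qed

text \<open>A factor of order \<open>M\<close> raises the precision by \<open>M\<close>. This is
  what makes a weak approximation sufficient for the far terms of a theta series.\<close>

lemma eqN_mult_low:
  assumes "eqN N f g" "\<And>i. i < M \<Longrightarrow> fps_nth h i = 0"
  shows "eqN (N + M) (h * f) (h * g)"
  unfolding eqN_def
proof (intro allI impI)
  fix i assume i: "i < N + M"
  show "fps_nth (h * f) i = fps_nth (h * g) i"
    unfolding fps_mult_nth
  proof (rule sum.cong)
    fix j assume "j \<in> {0..i}"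
    then show "fps_nth h j * fps_nth f (i - j) = fps_nth h j * fps_nth g (i - j)"
      using assms i by (cases "j < M") (auto simp: eqN_def)
  qed simp
qed

lemma eqN_eqI: "(\<And>N. eqN N f g) \<Longrightarrow> f = g"
  by (rule fps_ext) (auto simp: eqN_def)

lemma tendsto_eqN_iff: "F \<longlonglongrightarrow> L \<longleftrightarrow> (\<forall>N. \<forall>\<^sub>F n in sequentially. eqN N (F n) L)"
proof
  assume L: "F \<longlonglongrightarrow> L"
  show "\<forall>N. \<forall>\<^sub>F n in sequentially. eqN N (F n) L"
  proof
    fix N
    have "\<forall>\<^sub>F n in sequentially. \<forall>i\<in>{..<N}. fps_nth (F n) i = fps_nth L i"
      by (subst eventually_ball_finite_distrib) (use L in \<open>auto simp: tendsto_fps_iff\<close>)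
    then show "\<forall>\<^sub>F n in sequentially. eqN N (F n) L"
      by eventually_elim (auto simp: eqN_def)
  qed
next
  assume *: "\<forall>N. \<forall>\<^sub>F n in sequentially. eqN N (F n) L"
  show "F \<longlonglongrightarrow> L"
  proof (rule tendsto_fpsI)
    fix i
    from *[rule_format, of "Suc i"] show "\<forall>\<^sub>F n in sequentially. fps_nth (F n) i = fps_nth L i"
      by eventually_elim (auto simp: eqN_def)
  qed
qed

lemma tendsto_eqN_diagI: "(\<And>n. eqN n (F n) L) \<Longrightarrow> F \<longlonglongrightarrow> L"
  unfolding tendsto_eqN_iff eventually_sequentially by (meson eqN_mono)

lemma tendsto_mult_fps:
  fixes F G :: "nat \<Rightarrow> rat fps"
  assumes "F \<longlonglongrightarrow> a" "G \<longlonglongrightarrow> b"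
  shows "(\<lambda>n. F n * G n) \<longlonglongrightarrow> a * b"
  unfolding tendsto_eqN_iff
proof
  fix N
  from assms have "\<forall>\<^sub>F n in sequentially. eqN N (F n) a" "\<forall>\<^sub>F n in sequentially. eqN N (G n) b"
    by (auto simp: tendsto_eqN_iff)
  then show "\<forall>\<^sub>F n in sequentially. eqN N (F n * G n) (a * b)"
    by eventually_elim (rule eqN_mult)
qed

lemma tendsto_power_fps:
  fixes F :: "nat \<Rightarrow> rat fps"
  shows "F \<longlonglongrightarrow> a \<Longrightarrow> (\<lambda>n. F n ^ k) \<longlonglongrightarrow> a ^ k"
  by (induction k) (auto intro: tendsto_mult_fps)

lemma tendsto_reparam:
  fixes F :: "nat \<Rightarrow> rat fps"
  assumes "F \<longlonglongrightarrow> a" "k > 0"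
  shows "(\<lambda>n. F (k * n)) \<longlonglongrightarrow> a"
proof -
  have "strict_mono (\<lambda>n. k * n)"
    using assms(2) by (intro strict_monoI) auto
  from LIMSEQ_subseq_LIMSEQ[OF assms(1) this] show ?thesis
    by (simp add: o_def)
qed

section \<open>Finite products\<close>

text \<open>The q-Pochhammer symbol \<open>(q^a; q^m)_n\<close>; its companion \<open>qm\<close> is
  \<open>(-q^a; q^m)_n\<close>.\<close>

definition qp :: "nat \<Rightarrow> nat \<Rightarrow> nat \<Rightarrow> rat fps" where
  "qp a m n = (\<Prod>i<n. 1 - fps_X ^ (m * i + a))"

definition qm :: "nat \<Rightarrow> nat \<Rightarrow> nat \<Rightarrow> rat fps" where
  "qm a m n = (\<Prod>i<n. 1 + fps_X ^ (m * i + a))"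

lemma qp_0 [simp]: "qp a m 0 = 1"
  and qp_Suc: "qp a m (Suc n) = qp a m n * (1 - fps_X ^ (m * n + a))"
  by (simp_all add: qp_def)

lemma qm_0 [simp]: "qm a m 0 = 1"
  and qm_Suc: "qm a m (Suc n) = qm a m n * (1 + fps_X ^ (m * n + a))"
  by (simp_all add: qm_def)

lemma qp_nth_0 [simp]: "a > 0 \<Longrightarrow> fps_nth (qp a m n) 0 = 1"
  by (induction n) (auto simp: qp_Suc)

lemma qp_tendsto:
  assumes "m > 0"
  shows "(\<lambda>n. qp m m n) \<longlonglongrightarrow> E m"
proof -
  have "(\<lambda>n. \<Prod>k<n. 1 - fps_X ^ (m * (k + 1))) \<longlonglongrightarrow> E m"
    using has_prod_imp_tendsto'[OF E_has_prod[OF assms]] .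
  then show ?thesis
    by (simp add: qp_def algebra_simps)
qed

lemma eqN_one_minus: "N \<le> k \<Longrightarrow> eqN N (1 - fps_X ^ k) 1"
  by (auto simp: eqN_def)

lemma qp_eqN_E:
  assumes "m > 0" "N \<le> Suc n"
  shows "eqN N (qp m m n) (E m)"
proof -
  have *: "eqN N (qp m m n) (qp m m (n + d))" for d
  proof (induction d)
    case (Suc d)
    have "Suc n \<le> m * (n + d) + m"
      using assms(1) by (cases m) auto
    then have "eqN N (1 - fps_X ^ (m * (n + d) + m)) 1"
      using assms(2) by (intro eqN_one_minus) auto
    then have "eqN N (qp m m (n + d) * (1 - fps_X ^ (m * (n + d) + m))) (qp m m (n + d) * 1)"
      by (intro eqN_mult) auto
    with Suc show ?case
      by (auto simp: qp_Suc intro: eqN_trans eqN_sym)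
  qed simp
  have "\<forall>\<^sub>F k in sequentially. eqN N (qp m m k) (E m)"
    using qp_tendsto[OF assms(1)] by (auto simp: tendsto_eqN_iff)
  then obtain K where K: "\<And>k. k \<ge> K \<Longrightarrow> eqN N (qp m m k) (E m)"
    by (auto simp: eventually_sequentially)
  show ?thesis
    using *[of K] K[of "n + K"] by (auto intro: eqN_trans)
qed

lemma E_nth_0 [simp]: "m > 0 \<Longrightarrow> fps_nth (E m) 0 = 1"
  using qp_eqN_E[of m 1 0] by (simp add: eqN_def)

lemma E_nz [simp]: "m > 0 \<Longrightarrow> E m \<noteq> 0"
  using E_nth_0[of m] by (metis fps_zero_nth zero_neq_one)

section \<open>Gaussian binomial coefficients and finite theta sums\<close>

text \<open>The q-Pascal rule serves as definition, so no division occurs and identities follow by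
  induction on the row; the quotient form is recovered in \<open>qbin_qp\<close>.\<close>

fun qbin :: "rat fps \<Rightarrow> nat \<Rightarrow> nat \<Rightarrow> rat fps" where
  "qbin Q n 0 = 1"
| "qbin Q 0 (Suc k) = 0"
| "qbin Q (Suc n) (Suc k) = qbin Q n k + Q ^ Suc k * qbin Q n (Suc k)"

lemma qbin_eq_0 [simp]: "k > n \<Longrightarrow> qbin Q n k = 0"
  by (induction Q n k rule: qbin.induct) auto

lemma qbin_self [simp]: "qbin Q n n = 1"
  by (induction n) auto

lemma qbin_Suc_Suc':
  "k \<le> n \<Longrightarrow> qbin Q (Suc n) (Suc k) = Q ^ (n - k) * qbin Q n k + qbin Q n (Suc k)"
proof (induction Q n k rule: qbin.induct)
  case (1 Q n)
  then show ?case
  proof (induction n)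
    case (Suc n)
    then show ?case by (simp add: algebra_simps)
  qed simp
next
  case (3 Q n k)
  show ?case
  proof (cases "Suc k \<le> n")
    case True
    then have e: "Suc n - Suc k = n - k" "n - k = Suc (n - Suc k)" by auto
    have "qbin Q (Suc (Suc n)) (Suc (Suc k)) = qbin Q (Suc n) (Suc k) + Q ^ Suc (Suc k) * qbin Q (Suc n) (Suc (Suc k))"
      by simp
    also have "\<dots> = Q ^ (n - k) * qbin Q n k + qbin Q n (Suc k)
       + Q ^ Suc (Suc k) * (Q ^ (n - Suc k) * qbin Q n (Suc k) + qbin Q n (Suc (Suc k)))"
      using 3 True by simp
    also have "Q ^ Suc (Suc k) * Q ^ (n - Suc k) = Q ^ (n - k) * Q ^ Suc k"
    proof -
      obtain d where "n = Suc k + d" using True le_Suc_ex by blast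
      then show ?thesis by (simp add: power_add)
    qed
    then have "Q ^ (n - k) * qbin Q n k + qbin Q n (Suc k)
       + Q ^ Suc (Suc k) * (Q ^ (n - Suc k) * qbin Q n (Suc k) + qbin Q n (Suc (Suc k)))
      = Q ^ (n - k) * (qbin Q n k + Q ^ Suc k * qbin Q n (Suc k))
        + (qbin Q n (Suc k) + Q ^ Suc (Suc k) * qbin Q n (Suc (Suc k)))"
      by (simp only: distrib_left mult.assoc[symmetric]) (simp only: ac_simps)
    finally show ?thesis by simp
  next
    case False
    with 3 have "k = n" by auto
    then show ?thesis by simp
  qed
qed auto

text \<open>One use of each q-Pascal rule. Going up two rows at once moves the centre of a symmetric
  sum by exactly one.\<close>

lemma qbin_Suc2:
  assumes "k \<le> Suc M"
  shows "qbin Q (M + 2) (Suc k) = Q ^ Suc k * qbin Q M (Suc k) + (1 + Q ^ Suc M) * qbin Q M k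
    + (if k = 0 then 0 else Q ^ (Suc M - k) * qbin Q M (k - 1))"
proof (cases k)
  case 0
  have "qbin Q (Suc M) (Suc 0) = Q ^ M + qbin Q M (Suc 0)"
    using qbin_Suc_Suc'[of 0 M Q] by simp
  with 0 show ?thesis
    by (simp add: algebra_simps)
next
  case (Suc k')
  show ?thesis
  proof (cases "k \<le> M")
    case True
    have 1: "Q ^ Suc k * Q ^ (M - k) = Q ^ Suc M"
      using True by (simp flip: power_add)
    have 2: "qbin Q (Suc M) (Suc k) = Q ^ (M - k) * qbin Q M k + qbin Q M (Suc k)"
      by (rule qbin_Suc_Suc') fact
    have 3: "qbin Q (Suc M) k = Q ^ (M - k') * qbin Q M k' + qbin Q M k"
      unfolding Suc by (rule qbin_Suc_Suc') (use True Suc in auto)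
    have "qbin Q (M + 2) (Suc k) = qbin Q (Suc M) k + Q ^ Suc k * qbin Q (Suc M) (Suc k)"
      by (metis add_2_eq_Suc' qbin.simps(3))
    also have "\<dots> = Q ^ (M - k') * qbin Q M k' + qbin Q M k
        + (Q ^ Suc k * Q ^ (M - k)) * qbin Q M k + Q ^ Suc k * qbin Q M (Suc k)"
      unfolding 2 3 by (simp only: distrib_left add.assoc mult.assoc)
    finally show ?thesis
      using Suc unfolding 1 by (simp add: distrib_right)
  next
    case False
    with assms have "k = Suc M" by auto
    then show ?thesis by simp
  qed
qed

text \<open>After \<open>qbin_Suc2\<close> and a shift of the index, each binomial of row
  \<open>M\<close> multiplies the three neighbours \<open>c (j - 1)\<close>, \<open>c j\<close>,
  \<open>c (j + 1)\<close>, and the hypothesis collapses them to a multiple of \<open>c j\<close>.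
  The recurrence takes the place of the variable of the finite triple product; it is used for the
  triple product itself, for Jacobi's cube, and with \<open>u = 0\<close> for
  \<open>alpha\<close>.\<close>

lemma finite_theta_step:
  fixes c :: "int \<Rightarrow> rat fps"
  assumes "\<And>k. k \<le> M \<Longrightarrow> Q ^ k * c (int k - n - 1) + Q ^ (M - k) * c (int k - n + 1) = u * c (int k - n)"
  shows "(\<Sum>k\<le>M+2. qbin Q (M+2) k * c (int k - (n + 1)))
       = (1 + Q ^ Suc M + u) * (\<Sum>k\<le>M. qbin Q M k * c (int k - n))"
proof -
  have "(\<Sum>k\<le>M+2. qbin Q (M+2) k * c (int k - (n + 1)))
    = c (- n - 1) + (\<Sum>k\<le>Suc M. qbin Q (M+2) (Suc k) * c (int k - n))"
    by (simp add: sum.atMost_Suc_shift del: sum.atMost_Suc qbin.simps(3))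
  also have "(\<Sum>k\<le>Suc M. qbin Q (M+2) (Suc k) * c (int k - n)) =
     (\<Sum>k\<le>Suc M. Q ^ Suc k * qbin Q M (Suc k) * c (int k - n))
     + (1 + Q ^ Suc M) * (\<Sum>k\<le>Suc M. qbin Q M k * c (int k - n))
     + (\<Sum>k\<le>Suc M. (if k = 0 then 0 else Q ^ (Suc M - k) * qbin Q M (k - 1)) * c (int k - n))"
    (is "_ = ?A + ?B + ?C")
    unfolding sum_distrib_left sum.distrib[symmetric]
    by (intro sum.cong refl, subst qbin_Suc2) (simp_all add: algebra_simps)
  also have "?C = (\<Sum>k\<le>M. Q ^ (M - k) * qbin Q M k * c (int k - n + 1))"
    by (subst sum.atMost_Suc_shift) (simp add: algebra_simps)
  also have "?B = (1 + Q ^ Suc M) * (\<Sum>k\<le>M. qbin Q M k * c (int k - n))"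
    by simp
  also have "?A = (\<Sum>k\<le>M. Q ^ Suc k * qbin Q M (Suc k) * c (int k - n))"
    by simp
  also have "c (- n - 1) + ((\<Sum>k\<le>M. Q ^ Suc k * qbin Q M (Suc k) * c (int k - n)) + b + d)
     = (\<Sum>k\<le>Suc M. Q ^ k * qbin Q M k * c (int k - n - 1)) + b + d" for b d
    by (subst sum.atMost_Suc_shift) (simp add: add.assoc)
  also have "(\<Sum>k\<le>Suc M. Q ^ k * qbin Q M k * c (int k - n - 1)) = (\<Sum>k\<le>M. Q ^ k * qbin Q M k * c (int k - n - 1))"
    by simp
  also have "(\<Sum>k\<le>M. Q ^ k * qbin Q M k * c (int k - n - 1)) + b
        + (\<Sum>k\<le>M. Q ^ (M - k) * qbin Q M k * c (int k - n + 1))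
      = b + u * (\<Sum>k\<le>M. qbin Q M k * c (int k - n))" for b
  proof -
    have "(\<Sum>k\<le>M. Q ^ k * qbin Q M k * c (int k - n - 1))
        + (\<Sum>k\<le>M. Q ^ (M - k) * qbin Q M k * c (int k - n + 1))
      = (\<Sum>k\<le>M. qbin Q M k * (Q ^ k * c (int k - n - 1) + Q ^ (M - k) * c (int k - n + 1)))"
      unfolding sum.distrib[symmetric] by (intro sum.cong) (auto simp: algebra_simps)
    also have "\<dots> = (\<Sum>k\<le>M. qbin Q M k * (u * c (int k - n)))"
      using assms by (intro sum.cong) auto
    also have "\<dots> = u * (\<Sum>k\<le>M. qbin Q M k * c (int k - n))"
      by (simp add: sum_distrib_left algebra_simps)
    finally show ?thesis by (simp add: algebra_simps)
  qed
  finally show ?thesis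
    by (simp add: algebra_simps)
qed

lemma qbin_qp:
  "k \<le> n \<Longrightarrow> qbin (fps_X ^ m) n k * qp m m k * qp m m (n - k) = qp m m n"
proof (induction "fps_X ^ m :: rat fps" n k rule: qbin.induct)
  case (3 n k)
  let ?Q = "fps_X ^ m :: rat fps"
  have f: "qp m m (Suc j) = qp m m j * (1 - ?Q ^ Suc j)" for j
    by (simp add: qp_Suc power_add flip: power_mult)
  show ?case
  proof (cases "k = n")
    case False
    with 3 have k: "k \<le> n" "Suc k \<le> n" by auto
    then obtain d where d: "n = Suc k + d" using le_Suc_ex by blast
    have a: "qbin ?Q n k * qp m m k * qp m m (Suc d) = qp m m n"
      using 3(1)[OF k(1)] d by simp
    have b: "qbin ?Q n (Suc k) * qp m m (Suc k) * qp m m d = qp m m n"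
      using 3(2)[OF k(2)] d by simp
    have "qbin ?Q (Suc n) (Suc k) * qp m m (Suc k) * qp m m (Suc d)
      = (qbin ?Q n k * qp m m k * qp m m (Suc d)) * (1 - ?Q ^ Suc k)
        + ?Q ^ Suc k * (qbin ?Q n (Suc k) * qp m m (Suc k) * qp m m d) * (1 - ?Q ^ Suc d)"
      unfolding f by (simp only: qbin.simps) (simp only: algebra_simps)
    also have "\<dots> = qp m m n * (1 - ?Q ^ Suc k * ?Q ^ Suc d)"
      unfolding a b by (simp add: ring_distribs)
    also have "?Q ^ Suc k * ?Q ^ Suc d = ?Q ^ Suc n"
      using d by (simp flip: power_add)
    finally show ?thesis
      using d f[of n] by simp
  qed simp
qed auto

lemma qbin_eqN:
  assumes "m > 0" "k \<le> n" "N \<le> Suc k" "N \<le> Suc (n - k)"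
  shows "eqN N (E m * qbin (fps_X ^ m) n k) 1"
proof (rule eqN_cancel)
  have "eqN N (E m) (qp m m k)" "eqN N (E m) (qp m m (n - k))"
    using assms by (auto intro!: eqN_sym[OF qp_eqN_E])
  then have "eqN N (E m * qbin (fps_X ^ m) n k * (E m * E m))
          (E m * qbin (fps_X ^ m) n k * (qp m m k * qp m m (n - k)))"
    by (metis eqN_mult eqN_refl)
  also have "E m * qbin (fps_X ^ m) n k * (qp m m k * qp m m (n - k)) = E m * qp m m n"
    using qbin_qp[OF assms(2), of m] by (simp add: mult.assoc)
  also have "eqN N (E m * qp m m n) (1 * (E m * E m))"
    unfolding mult_1 by (rule eqN_mult[OF eqN_refl qp_eqN_E]) (use assms in auto)
  finally show "eqN N (E m * qbin (fps_X ^ m) n k * (E m * E m)) (1 * (E m * E m))" .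
qed (use assms in auto)

text \<open>Precision count: the term with index \<open>j\<close> has order at least
  \<open>|j| - 1\<close>, and \<open>E m\<close> times its binomial is 1 below order
  \<open>n + 1 - |j|\<close>. Together these reach \<open>n\<close> for every
  \<open>j\<close>.\<close>

lemma finite_theta_eqN:
  assumes "m > 0" "M = 2 * n + d" "\<And>j i. i + 1 < nat \<bar>j\<bar> \<Longrightarrow> fps_nth (c j) i = 0"
  shows "eqN n (E m * (\<Sum>k\<le>M. qbin (fps_X ^ m) M k * c (int k - int n))) (\<Sum>k\<le>M. c (int k - int n))"
  unfolding sum_distrib_left
proof (rule eqN_sum)
  fix k assume k: "k \<in> {..M}"
  let ?j = "nat \<bar>int k - int n\<bar>"
  define N where "N = n + 1 - ?j"
  have "eqN (N + (?j - 1)) (c (int k - int n) * (E m * qbin (fps_X ^ m) M k)) (c (int k - int n) * 1)"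
  proof (rule eqN_mult_low)
    show "eqN N (E m * qbin (fps_X ^ m) M k) 1"
      by (rule qbin_eqN) (use k assms(1,2) in \<open>auto simp: N_def\<close>)
    show "fps_nth (c (int k - int n)) i = 0" if "i < ?j - 1" for i
      by (rule assms(3)) (use that in linarith)
  qed
  then show "eqN n (E m * (qbin (fps_X ^ m) M k * c (int k - int n))) (c (int k - int n))"
    by (simp add: mult_ac) (erule eqN_mono, simp add: N_def)
qed

section \<open>Generating functions of weighted exponents\<close>

text \<open>Meaningful only if the fibres of \<open>e\<close> on \<open>A\<close> are finite: sums over infinite sets are \<open>0\<close>.\<close>

definition gf :: "'a set \<Rightarrow> ('a \<Rightarrow> rat) \<Rightarrow> ('a \<Rightarrow> nat) \<Rightarrow> rat fps" where
  "gf A w e = Abs_fps (\<lambda>n. \<Sum>x\<in>{x\<in>A. e x = n}. w x)"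

definition ffib :: "'a set \<Rightarrow> ('a \<Rightarrow> nat) \<Rightarrow> bool" where
  "ffib A e \<longleftrightarrow> (\<forall>n. finite {x\<in>A. e x = n})"

lemma gf_nth: "fps_nth (gf A w e) n = (\<Sum>x\<in>{x\<in>A. e x = n}. w x)"
  by (simp add: gf_def)

lemma ffib_subset: "ffib A e \<Longrightarrow> B \<subseteq> A \<Longrightarrow> ffib B e"
proof -
  assume *: "ffib A e" "B \<subseteq> A"
  have "finite {x\<in>B. e x = n}" for n
    by (rule finite_subset[of _ "{x\<in>A. e x = n}"]) (use * in \<open>auto simp: ffib_def\<close>)
  then show ?thesis by (simp add: ffib_def)
qed

lemma gf_cong:
  "(\<And>x. x \<in> A \<Longrightarrow> w x = w' x) \<Longrightarrow> (\<And>x. x \<in> A \<Longrightarrow> e x = e' x) \<Longrightarrow> gf A w e = gf A w' e'"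
  by (rule fps_ext) (auto simp: gf_nth intro!: sum.cong)

lemma gf_reindex:
  assumes "bij_betw h B A"
  shows "gf A w e = gf B (\<lambda>x. w (h x)) (\<lambda>x. e (h x))"
proof (rule fps_ext)
  fix n
  have "bij_betw h {x\<in>B. e (h x) = n} {x\<in>A. e x = n}"
    using assms by (auto simp: bij_betw_def inj_on_def)
  from sum.reindex_bij_betw[OF this, of w]
  show "fps_nth (gf A w e) n = fps_nth (gf B (\<lambda>x. w (h x)) (\<lambda>x. e (h x))) n"
    by (simp add: gf_nth)
qed

lemma gf_Un:
  assumes "ffib A e" "ffib B e" "A \<inter> B = {}"
  shows "gf (A \<union> B) w e = gf A w e + gf B w e"
proof (rule fps_ext)
  fix n
  have "{x \<in> A \<union> B. e x = n} = {x\<in>A. e x = n} \<union> {x\<in>B. e x = n}" by auto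
  then show "fps_nth (gf (A \<union> B) w e) n = fps_nth (gf A w e + gf B w e) n"
    using assms by (simp add: gf_nth) (subst sum.union_disjoint, auto simp: ffib_def)
qed

lemma gf_add: "gf A (\<lambda>x. w x + w' x) e = gf A w e + gf A w' e"
  by (rule fps_ext) (simp add: gf_nth sum.distrib)

lemma gf_scale: "gf A (\<lambda>x. c * w x) e = fps_const c * gf A w e"
  by (rule fps_ext) (simp add: gf_nth sum_distrib_left)

lemma gf_shift: "gf A w (\<lambda>x. e x + c) = fps_X ^ c * gf A w e"
  by (rule fps_ext) (auto simp: gf_nth fps_X_power_mult_nth intro!: sum.cong sum.neutral)

lemma gf_mult:
  assumes "ffib A e" "ffib B f"
  shows "gf A w e * gf B v f = gf (A \<times> B) (\<lambda>(x, y). w x * v y) (\<lambda>(x, y). e x + f y)"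
proof (rule fps_ext)
  fix n
  have "fps_nth (gf A w e * gf B v f) n
    = (\<Sum>i\<in>{0..n}. \<Sum>p\<in>{x\<in>A. e x = i} \<times> {y\<in>B. f y = n - i}. w (fst p) * v (snd p))"
    by (simp add: fps_mult_nth gf_nth sum_product sum.cartesian_product case_prod_unfold)
  also have "\<dots> = (\<Sum>(i, p)\<in>(SIGMA i:{0..n}. {x\<in>A. e x = i} \<times> {y\<in>B. f y = n - i}). w (fst p) * v (snd p))"
    using assms by (subst sum.Sigma) (auto simp: ffib_def)
  also have "\<dots> = (\<Sum>p\<in>{p\<in>A \<times> B. e (fst p) + f (snd p) = n}. w (fst p) * v (snd p))"
    by (rule sum.reindex_bij_witness[where j = snd and i = "\<lambda>p. (e (fst p), p)"]) auto
  also have "\<dots> = fps_nth (gf (A \<times> B) (\<lambda>(x, y). w x * v y) (\<lambda>(x, y). e x + f y)) n"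
    by (simp add: gf_nth case_prod_unfold)
  finally show "fps_nth (gf A w e * gf B v f) n
    = fps_nth (gf (A \<times> B) (\<lambda>(x, y). w x * v y) (\<lambda>(x, y). e x + f y)) n" .
qed

lemma ffib_prod:
  assumes "ffib A e" "ffib B f"
  shows "ffib (A \<times> B) (\<lambda>(x, y). e x + f y)"
  unfolding ffib_def
proof
  fix n
  have "{p \<in> A \<times> B. (case p of (x, y) \<Rightarrow> e x + f y) = n}
    \<subseteq> (\<Union>i\<in>{..n}. {x\<in>A. e x = i}) \<times> (\<Union>i\<in>{..n}. {x\<in>B. f x = i})" by auto
  moreover have "finite \<dots>"
    using assms by (auto simp: ffib_def)
  ultimately show "finite {p \<in> A \<times> B. (case p of (x, y) \<Rightarrow> e x + f y) = n}"
    by (rule finite_subset)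
qed

lemma ffib_int_growth:
  fixes e :: "int \<Rightarrow> nat"
  assumes "\<And>j. nat \<bar>j\<bar> \<le> e j + 1"
  shows "ffib A e"
  unfolding ffib_def
proof
  fix n
  have "{x \<in> A. e x = n} \<subseteq> {- int (n + 1)..int (n + 1)}"
  proof
    fix x assume "x \<in> {x \<in> A. e x = n}"
    with assms[of x] show "x \<in> {- int (n + 1)..int (n + 1)}" by auto
  qed
  then show "finite {x \<in> A. e x = n}"
    by (rule finite_subset) simp
qed

lemma sum_eqN_gf:
  assumes "\<And>j. nat \<bar>j\<bar> \<le> e j + 1" "M = 2 * n + d"
  shows "eqN n (\<Sum>k\<le>M. fps_const (w (int k - int n)) * fps_X ^ e (int k - int n)) (gf UNIV w e)"
  unfolding eqN_def
proof (intro allI impI)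
  fix i assume i: "i < n"
  have sub: "\<And>j. e j = i \<Longrightarrow> nat \<bar>j\<bar> \<le> n"
    using assms(1) i by (metis Suc_eq_plus1 Suc_leI le_trans)
  have bnd: "0 \<le> j + int n" "nat (j + int n) \<le> 2 * n + d" if "e j = i" for j
    using sub[OF that] by auto
  have "fps_nth (\<Sum>k\<le>M. fps_const (w (int k - int n)) * fps_X ^ e (int k - int n)) i
     = (\<Sum>k\<le>M. if e (int k - int n) = i then w (int k - int n) else 0)"
    by (auto simp: fps_sum_nth fps_X_power_mult_nth intro!: sum.cong)
  also have "\<dots> = (\<Sum>k\<in>{k\<in>{..M}. e (int k - int n) = i}. w (int k - int n))"
    by (rule sum.inter_filter[symmetric]) simp
  also have "\<dots> = (\<Sum>j\<in>{j\<in>UNIV. e j = i}. w j)"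
    by (rule sum.reindex_bij_witness[where j = "\<lambda>k. int k - int n" and i = "\<lambda>j. nat (j + int n)"])
       (use assms(2) bnd in auto)
  finally show "fps_nth (\<Sum>k\<le>M. fps_const (w (int k - int n)) * fps_X ^ e (int k - int n)) i
     = fps_nth (gf UNIV w e) i"
    by (simp add: gf_nth)
qed

section \<open>Dilation\<close>

definition dil :: "nat \<Rightarrow> rat fps \<Rightarrow> rat fps" where
  "dil k F = F oo fps_X ^ k"

lemma dil_nth: "fps_nth (dil k F) n = (if k dvd n then fps_nth F (n div k) else 0)"
  by (simp add: dil_def fps_nth_compose_X_power)

lemma dil_add [simp]: "dil k (F + G) = dil k F + dil k G"
  by (simp add: dil_def fps_compose_add_distrib)

lemma dil_diff [simp]: "dil k (F - G) = dil k F - dil k G"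
  by (simp add: dil_def fps_compose_sub_distrib)

lemma dil_uminus [simp]: "dil k (- F) = - dil k F"
  by (simp add: dil_def fps_compose_uminus)

lemma dil_mult: "k > 0 \<Longrightarrow> dil k (F * G) = dil k F * dil k G"
  by (simp add: dil_def fps_compose_mult_distrib)

lemma dil_1 [simp]: "dil k 1 = 1"
  by (simp add: dil_def)

lemma dil_numeral [simp]: "dil k (numeral n) = numeral n"
  by (simp add: dil_def numeral_fps_const)

lemma dil_power: "k > 0 \<Longrightarrow> dil k (F ^ n) = dil k F ^ n"
  by (induction n) (auto simp: dil_mult)

lemma dil_X: "k > 0 \<Longrightarrow> dil k fps_X = fps_X ^ k"
  by (simp add: dil_def)

lemma dil_prod: "k > 0 \<Longrightarrow> dil k (\<Prod>i\<in>A. f i) = (\<Prod>i\<in>A. dil k (f i))"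
  by (induction A rule: infinite_finite_induct) (auto simp: dil_mult)

lemma dil_eqN: "k > 0 \<Longrightarrow> eqN N F G \<Longrightarrow> eqN N (dil k F) (dil k G)"
  by (auto simp: eqN_def dil_nth) (metis div_le_dividend le_less_trans)

lemma dil_qp: "k > 0 \<Longrightarrow> dil k (qp a m n) = qp (k * a) (k * m) n"
  by (simp add: qp_def dil_prod dil_power dil_X flip: power_mult) (simp add: algebra_simps)

lemma dil_E: "k > 0 \<Longrightarrow> m > 0 \<Longrightarrow> dil k (E m) = E (k * m)"
proof (rule eqN_eqI)
  fix N assume k: "k > 0" "m > 0"
  have "eqN N (dil k (E m)) (dil k (qp m m N))"
    by (intro dil_eqN eqN_sym[OF qp_eqN_E] k) auto
  also have "dil k (qp m m N) = qp (k * m) (k * m) N"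
    using k by (simp add: dil_qp)
  also have "eqN N \<dots> (E (k * m))"
    by (rule qp_eqN_E) (use k in auto)
  finally show "eqN N (dil k (E m)) (E (k * m))" .
qed

lemma dil_gf: "k > 0 \<Longrightarrow> dil k (gf A w e) = gf A w (\<lambda>x. k * e x)"
  by (rule fps_ext) (auto simp: dil_nth gf_nth intro!: sum.cong sum.neutral)

section \<open>The Jacobi triple product and Jacobi's identity\<close>

text \<open>For \<open>s = 1\<close> or \<open>s = - 1\<close> this is the power
  \<open>s ^ j\<close>, negative \<open>j\<close> included.\<close>

definition sg :: "rat \<Rightarrow> int \<Rightarrow> rat" where
  "sg s j = (if even j then 1 else s)"

text \<open>Exponent of the \<open>j\<close>-th term of the triple product in base q^m at z = q^a.
  The bound \<open>a \<le> m\<close>, assumed wherever it is used, keeps the integer under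
  \<open>nat\<close> nonnegative for all \<open>j\<close>.\<close>

definition tri :: "nat \<Rightarrow> nat \<Rightarrow> int \<Rightarrow> nat" where
  "tri m a j = nat (int m * (j * (j - 1) div 2) + int a * j)"

lemma tri_int_aux:
  assumes "a \<le> m" "m > 0"
  shows "\<bar>j\<bar> - 1 \<le> int m * (j * (j - 1) div 2) + int a * j" "0 \<le> int m * (j * (j - 1) div 2) + int a * j"
proof -
  define t where "t = j * (j - 1) div 2"
  have t: "2 * t = j * (j - 1)"
    by (simp add: t_def)
  have "\<bar>j\<bar> - 1 \<le> int m * t + int a * j \<and> 0 \<le> int m * t + int a * j"
  proof (cases "j \<ge> 0")
    case True
    have "0 \<le> (j - 1) * (j - 2)"
      by (cases "j \<ge> 2") (auto simp: mult_nonpos_nonpos)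
    then have "j - 1 \<le> t" using t by (simp add: algebra_simps)
    moreover have "0 \<le> t"
      using True unfolding t_def by (cases "j = 0") auto
    then have "t \<le> int m * t"
      using assms(2) by (simp add: mult_le_cancel_right1)
    ultimately show ?thesis
      using True \<open>0 \<le> t\<close> by (smt (verit) mult_nonneg_nonneg of_nat_0_le_iff)
  next
    case False
    \<comment> \<open>Reflection: \<open>t - i\<close> equals \<open>i * (i - 1) div 2\<close>, so
      the exponent at \<open>- i\<close> is the one at \<open>i\<close> with \<open>a\<close>
      replaced by \<open>m - a\<close>.\<close>
    define i where "i = - j"
    have i: "i \<ge> 1" "j = - i" using False by (auto simp: i_def)
    have "0 \<le> (i - 1) * (i - 2)"
      by (cases "i \<ge> 2") (use i in \<open>auto simp: mult_nonpos_nonpos\<close>)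
    moreover have "2 * t = i * i + i" using t i by (simp add: algebra_simps)
    ultimately have 1: "t - i \<ge> i - 1" "t - i \<ge> 0"
      using i by (auto simp: algebra_simps)
    have "int m * t + int a * j = int m * (t - i) + (int m - int a) * i"
      using i by (simp add: algebra_simps)
    moreover have "(int m - int a) * i \<ge> 0" using assms i by auto
    moreover have "int m * (t - i) \<ge> t - i"
      using assms(2) 1(2) by (simp add: mult_le_cancel_right1)
    ultimately show ?thesis using 1 i by linarith
  qed
  then show "\<bar>j\<bar> - 1 \<le> int m * (j * (j - 1) div 2) + int a * j" "0 \<le> int m * (j * (j - 1) div 2) + int a * j"
    by (auto simp: t_def)
qed

lemma int_tri: "a \<le> m \<Longrightarrow> m > 0 \<Longrightarrow> 2 * int (tri m a j) = int m * (j * (j - 1)) + 2 * int a * j"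
  using tri_int_aux(2)[of a m j] by (simp add: tri_def algebra_simps)

lemma tri_growth: "a \<le> m \<Longrightarrow> m > 0 \<Longrightarrow> nat \<bar>j\<bar> \<le> tri m a j + 1"
  using tri_int_aux[of a m j] by (simp add: tri_def nat_le_iff)

lemma tri_shift_up:
  assumes "a \<le> m" "m > 0" "k \<le> 2 * n + d"
  shows "m * (2 * n + d - k) + tri m a (int k - int n + 1) = m * (n + d) + a + tri m a (int k - int n)"
proof -
  have "2 * int (m * (2 * n + d - k) + tri m a (int k - int n + 1))
      = 2 * int (m * (n + d) + a + tri m a (int k - int n))"
    using assms by (simp add: int_tri of_nat_diff distrib_left) (simp add: algebra_simps)
  then show ?thesis by (metis mult_left_cancel of_nat_eq_iff zero_neq_numeral)
qed

lemma tri_shift_down: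
  assumes "a \<le> m" "m > 0"
  shows "m * k + tri m a (int k - int n - 1) = m * n + (m - a) + tri m a (int k - int n)"
proof -
  have "2 * int (m * k + tri m a (int k - int n - 1)) = 2 * int (m * n + (m - a) + tri m a (int k - int n))"
    using assms by (simp add: int_tri of_nat_diff distrib_left) (simp add: algebra_simps)
  then show ?thesis by (metis mult_left_cancel of_nat_eq_iff zero_neq_numeral)
qed

lemma sg_shift: "s\<^sup>2 = 1 \<Longrightarrow> sg s (j + 1) = s * sg s j" "s\<^sup>2 = 1 \<Longrightarrow> sg s (j - 1) = s * sg s j"
  by (auto simp: sg_def power2_eq_square)

text \<open>Here the neighbours of a term are its multiples by two monomials, whose sum is
  \<open>u\<close>. As \<open>s\<close> squares to 1, the step factor
  \<open>1 + Q ^ Suc (2 * n) + u\<close> splits into the two new factors of the product.\<close>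

lemma finite_jtp:
  assumes "a \<le> m" "m > 0" "s\<^sup>2 = 1"
  shows "(\<Sum>k\<le>2*n. qbin (fps_X ^ m) (2*n) k * (fps_const (sg s (int k - int n)) * fps_X ^ tri m a (int k - int n)))
     = (\<Prod>i<n. (1 + fps_const s * fps_X ^ (m * i + a)) * (1 + fps_const s * fps_X ^ (m * i + (m - a))))"
proof (induction n)
  case 0
  then show ?case by (simp add: sg_def tri_def)
next
  case (Suc n)
  let ?c = "\<lambda>j. fps_const (sg s j) * fps_X ^ tri m a j"
  let ?Q = "fps_X ^ m :: rat fps"
  let ?u = "fps_const s * fps_X ^ (m * n + (m - a)) + fps_const s * fps_X ^ (m * n + a)"
  have "(\<Sum>k\<le>2*n+2. qbin ?Q (2*n+2) k * ?c (int k - (int n + 1)))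
      = (1 + ?Q ^ Suc (2*n) + ?u) * (\<Sum>k\<le>2*n. qbin ?Q (2*n) k * ?c (int k - int n))"
  proof (rule finite_theta_step)
    fix k assume k: "k \<le> 2 * n"
    let ?j = "int k - int n"
    have u: "m * (2 * n + 0 - k) + tri m a (?j + 1) = m * (n + 0) + a + tri m a ?j"
      by (rule tri_shift_up) (use k assms in auto)
    have d: "m * k + tri m a (?j - 1) = m * n + (m - a) + tri m a ?j"
      by (rule tri_shift_down) (use assms in auto)
    have "?Q ^ k * ?c (?j - 1) = fps_const (s * sg s ?j) * fps_X ^ (m * k + tri m a (?j - 1))"
      by (simp only: sg_shift[OF assms(3)] power_add power_mult mult.assoc mult.left_commute[of "?Q ^ k"])
    moreover have "?Q ^ (2 * n - k) * ?c (?j + 1)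
        = fps_const (s * sg s ?j) * fps_X ^ (m * (2 * n + 0 - k) + tri m a (?j + 1))"
      by (simp only: sg_shift[OF assms(3)] power_add power_mult mult.assoc mult.left_commute[of "?Q ^ (2 * n - k)"] add_0_right)
    ultimately show "?Q ^ k * ?c (?j - 1) + ?Q ^ (2 * n - k) * ?c (?j + 1) = ?u * ?c ?j"
      unfolding u d by (simp only: fps_const_mult[symmetric] power_add[of _ _ "tri m a ?j"] ring_distribs mult_ac add_0_right)
  qed
  also have "1 + ?Q ^ Suc (2*n) + ?u =
     (1 + fps_const s * fps_X ^ (m * n + a)) * (1 + fps_const s * fps_X ^ (m * n + (m - a)))"
  proof -
    have "m * n + a + (m * n + (m - a)) = m * Suc (2 * n)"
      using assms(1) by (simp add: algebra_simps)
    then have "?Q ^ Suc (2*n) = fps_const (s * s) * (fps_X ^ (m * n + a) * fps_X ^ (m * n + (m - a)))"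
      using assms(3) by (simp only: power_add[symmetric] power_mult[symmetric]) (simp add: power2_eq_square)
    then show ?thesis
      by (simp only: ring_distribs fps_const_mult[symmetric]) (simp add: mult_ac add_ac)
  qed
  finally show ?case
    using Suc by (simp add: algebra_simps del: qbin.simps)
qed

lemma jtp_tendsto:
  assumes "a \<le> m" "m > 0" "s\<^sup>2 = 1"
  shows "(\<lambda>n. E m * (\<Prod>i<n. (1 + fps_const s * fps_X ^ (m * i + a)) * (1 + fps_const s * fps_X ^ (m * i + (m - a)))))
     \<longlonglongrightarrow> gf UNIV (sg s) (tri m a)"
proof (rule tendsto_eqN_diagI)
  fix n
  let ?c = "\<lambda>j. fps_const (sg s j) * fps_X ^ tri m a j"
  have "eqN n (E m * (\<Sum>k\<le>2*n+0. qbin (fps_X ^ m) (2*n+0) k * ?c (int k - int n))) (\<Sum>k\<le>2*n+0. ?c (int k - int n))"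
  proof (rule finite_theta_eqN[where d = 0])
    fix j i assume "i + 1 < nat \<bar>j\<bar>"
    then have "i < tri m a j"
      using tri_growth[OF assms(1,2), of j] by auto
    then show "fps_nth (?c j) i = 0"
      by (auto simp: fps_X_power_mult_nth)
  qed (use assms in auto)
  also have "eqN n (\<Sum>k\<le>2*n+0. ?c (int k - int n)) (gf UNIV (sg s) (tri m a))"
    by (rule sum_eqN_gf[where d = 0]) (use assms tri_growth in auto)
  finally show "eqN n (E m * (\<Prod>i<n. (1 + fps_const s * fps_X ^ (m * i + a)) * (1 + fps_const s * fps_X ^ (m * i + (m - a)))))
     (gf UNIV (sg s) (tri m a))"
    using finite_jtp[OF assms, of n] by simp
qed

lemma jtp_minus: "a \<le> m \<Longrightarrow> m > 0 \<Longrightarrow>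
  (\<lambda>n. E m * (qp a m n * qp (m - a) m n)) \<longlonglongrightarrow> gf UNIV (sg (- 1)) (tri m a)"
  using jtp_tendsto[of a m "- 1"] by (simp add: qp_def prod.distrib flip: fps_const_neg)

lemma jtp_plus: "a \<le> m \<Longrightarrow> m > 0 \<Longrightarrow>
  (\<lambda>n. E m * (qm a m n * qm (m - a) m n)) \<longlonglongrightarrow> gf UNIV (sg 1) (tri m a)"
  using jtp_tendsto[of a m 1] by (simp add: qm_def prod.distrib)

text \<open>The derivative at z = 1 of a finite triple product of odd length, which vanishes there
  because of a factor 1 - z. The weight \<open>j\<close> still satisfies a three-term recurrence,
  since \<open>(j - 1) + (j + 1) = 2 * j\<close>, and the step factor becomes the square of
  \<open>1 - fps_X ^ (n + 1)\<close>.\<close>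

lemma finite_jacobi_cube:
  "(\<Sum>k\<le>2*n+1. qbin (fps_X ^ 1) (2*n+1) k *
      (fps_const (- sg (- 1) (int k - int n) * of_int (int k - int n)) * fps_X ^ tri 1 0 (int k - int n)))
     = qp 1 1 n ^ 2"
proof (induction n)
  case 0
  then show ?case by (simp add: sg_def tri_def)
next
  case (Suc n)
  let ?c = "\<lambda>j. fps_const (- sg (- 1) j * of_int j) * fps_X ^ tri 1 0 j :: rat fps"
  let ?Q = "fps_X ^ 1 :: rat fps"
  let ?u = "- 2 * fps_X ^ (n + 1) :: rat fps"
  have "(\<Sum>k\<le>2*n+1+2. qbin ?Q (2*n+1+2) k * ?c (int k - (int n + 1)))
      = (1 + ?Q ^ Suc (2*n+1) + ?u) * (\<Sum>k\<le>2*n+1. qbin ?Q (2*n+1) k * ?c (int k - int n))"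
  proof (rule finite_theta_step)
    fix k assume k: "k \<le> 2 * n + 1"
    let ?j = "int k - int n"
    have u: "1 * (2 * n + 1 - k) + tri 1 0 (?j + 1) = 1 * (n + 1) + 0 + tri 1 0 ?j"
      by (rule tri_shift_up) (use k in auto)
    have d: "1 * k + tri 1 0 (?j - 1) = 1 * n + (1 - 0) + tri 1 0 ?j"
      by (rule tri_shift_down) auto
    have "?Q ^ k * ?c (?j - 1) = fps_const (- sg (-1) (?j - 1) * of_int (?j - 1)) * fps_X ^ (1 * k + tri 1 0 (?j - 1))"
      by (simp add: power_add)
    moreover have "?Q ^ (2 * n + 1 - k) * ?c (?j + 1)
        = fps_const (- sg (-1) (?j + 1) * of_int (?j + 1)) * fps_X ^ (1 * (2 * n + 1 - k) + tri 1 0 (?j + 1))"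
      by (simp add: power_add)
    ultimately have "?Q ^ k * ?c (?j - 1) + ?Q ^ (2 * n + 1 - k) * ?c (?j + 1)
      = fps_const (- sg (-1) (?j - 1) * of_int (?j - 1) + - sg (-1) (?j + 1) * of_int (?j + 1)) * fps_X ^ (n + 1 + tri 1 0 ?j)"
      unfolding u d by (simp only: fps_const_add[symmetric] distrib_right) simp
    also have "- sg (-1) (?j - 1) * of_int (?j - 1) + - sg (-1) (?j + 1) * of_int (?j + 1)
       = - 2 * (- sg (-1) ?j * of_int ?j)"
    proof -
      have "sg (-1) (?j - 1) = - sg (-1) ?j" "sg (-1) (?j + 1) = - sg (-1) ?j"
        by (simp_all add: sg_def)
      then show ?thesis by (simp only: of_int_add of_int_diff of_int_1) (simp add: algebra_simps)
    qed
    also have "fps_const \<dots> * fps_X ^ (n + 1 + tri 1 0 ?j) = ?u * ?c ?j"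
      by (simp add: power_add mult_ac numeral_fps_const flip: fps_const_mult fps_const_neg)
    finally show "?Q ^ k * ?c (?j - 1) + ?Q ^ (2 * n + 1 - k) * ?c (?j + 1) = ?u * ?c ?j" .
  qed
  also have "1 + ?Q ^ Suc (2*n+1) + ?u = (1 - fps_X ^ (n + 1))\<^sup>2"
  proof -
    have "?Q ^ Suc (2*n+1) = fps_X ^ (n + 1) * fps_X ^ (n + 1)"
      by (simp only: power_add[symmetric] power_one_right) (simp add: mult_2)
    then show ?thesis
      by (simp only: power2_eq_square) (simp add: ring_distribs)
  qed
  also have "(1 - fps_X ^ (n + 1))\<^sup>2 * (\<Sum>k\<le>2*n+1. qbin ?Q (2*n+1) k * ?c (int k - int n)) = qp 1 1 (Suc n) ^ 2"
    unfolding Suc qp_Suc power_mult_distrib by (simp add: mult.commute)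
  finally show ?case
    by (simp only: mult_Suc_right of_nat_Suc add.commute[of "int n" 1] add.commute[of 2 "2*n"] add.assoc add.commute[of 1 2])
qed

theorem jacobi_cube: "gf UNIV (\<lambda>j. - sg (- 1) j * of_int j) (tri 1 0) = E 1 ^ 3"
proof (rule LIMSEQ_unique)
  show "(\<lambda>n. E 1 * qp 1 1 n ^ 2) \<longlonglongrightarrow> gf UNIV (\<lambda>j. - sg (- 1) j * of_int j) (tri 1 0)"
  proof (rule tendsto_eqN_diagI)
    fix n
    let ?c = "\<lambda>j. fps_const (- sg (- 1) j * of_int j) * fps_X ^ tri 1 0 j :: rat fps"
    have "eqN n (E 1 * (\<Sum>k\<le>2*n+1. qbin (fps_X ^ 1) (2*n+1) k * ?c (int k - int n))) (\<Sum>k\<le>2*n+1. ?c (int k - int n))"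
    proof (rule finite_theta_eqN[where d = 1])
      fix j i assume "i + 1 < nat \<bar>j\<bar>"
      then have "i < tri 1 0 j"
        using tri_growth[of 0 1 j] by auto
      then show "fps_nth (?c j) i = 0"
        by (auto simp: fps_X_power_mult_nth)
    qed auto
    also have "eqN n (\<Sum>k\<le>2*n+1. ?c (int k - int n)) (gf UNIV (\<lambda>j. - sg (- 1) j * of_int j) (tri 1 0))"
      by (rule sum_eqN_gf[where d = 1]) (use tri_growth in auto)
    finally show "eqN n (E 1 * qp 1 1 n ^ 2) (gf UNIV (\<lambda>j. - sg (- 1) j * of_int j) (tri 1 0))"
      using finite_jacobi_cube[of n] by simp
  qed
  have "(\<lambda>n. E 1 * qp 1 1 n ^ 2) \<longlonglongrightarrow> E 1 * E 1 ^ 2"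
    by (intro tendsto_mult_fps tendsto_const tendsto_power_fps qp_tendsto) auto
  then show "(\<lambda>n. E 1 * qp 1 1 n ^ 2) \<longlonglongrightarrow> E 1 ^ 3"
    by (simp add: power_numeral_reduce)
qed

lemma ffib_tri: "a \<le> m \<Longrightarrow> m > 0 \<Longrightarrow> ffib A (tri m a)"
  by (rule ffib_int_growth) (rule tri_growth)

section \<open>Product expansions of theta series\<close>

lemma qp_add: "qp a m (k + r) = qp a m k * (\<Prod>j<r. 1 - fps_X ^ (m * (k + j) + a))"
  by (induction r) (simp_all add: qp_Suc mult.assoc)

lemma qm_add: "qm a m (k + r) = qm a m k * (\<Prod>j<r. 1 + fps_X ^ (m * (k + j) + a))"
  by (induction r) (simp_all add: qm_Suc mult.assoc)

lemma qp_split: "(\<Prod>j<r. qp (a + j * m) (r * m) n) = qp a m (r * n)"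
proof (induction n)
  case (Suc n)
  have "(\<Prod>j<r. qp (a + j * m) (r * m) (Suc n))
      = qp a m (r * n) * (\<Prod>j<r. 1 - fps_X ^ (r * m * n + (a + j * m)))"
    by (simp only: qp_Suc prod.distrib Suc)
  also have "(\<Prod>j<r. 1 - fps_X ^ (r * m * n + (a + j * m)))
      = (\<Prod>j<r. 1 - fps_X ^ (m * (r * n + j) + a) :: rat fps)"
    by (intro prod.cong refl) (simp add: algebra_simps)
  finally show ?case
    by (simp only: mult_Suc_right add.commute[of r] qp_add)
qed simp

lemma qm_split: "(\<Prod>j<r. qm (a + j * m) (r * m) n) = qm a m (r * n)"
proof (induction n)
  case (Suc n)
  have "(\<Prod>j<r. qm (a + j * m) (r * m) (Suc n))
      = qm a m (r * n) * (\<Prod>j<r. 1 + fps_X ^ (r * m * n + (a + j * m)))"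
    by (simp only: qm_Suc prod.distrib Suc)
  also have "(\<Prod>j<r. 1 + fps_X ^ (r * m * n + (a + j * m)))
      = (\<Prod>j<r. 1 + fps_X ^ (m * (r * n + j) + a) :: rat fps)"
    by (intro prod.cong refl) (simp add: algebra_simps)
  finally show ?case
    by (simp only: mult_Suc_right add.commute[of r] qm_add)
qed simp

lemma qp_split2: "qp a (2 * m) n * qp (a + m) (2 * m) n = qp a m (2 * n)"
  using qp_split[where r = 2 and a = a and m = m and n = n]
  by (simp only: numeral_eq_Suc lessThan_Suc) (simp add: mult.commute)

lemma qm_split2: "qm a (2 * m) n * qm (a + m) (2 * m) n = qm a m (2 * n)"
  using qm_split[where r = 2 and a = a and m = m and n = n]
  by (simp only: numeral_eq_Suc lessThan_Suc) (simp add: mult.commute)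

lemma qp_split3: "qp a (3 * m) n * qp (a + m) (3 * m) n * qp (a + 2 * m) (3 * m) n = qp a m (3 * n)"
  using qp_split[where r = 3 and a = a and m = m and n = n]
  by (simp add: numeral_eq_Suc lessThan_Suc mult_ac)

lemma qp_split5:
  "qp a (5 * m) n * qp (a + m) (5 * m) n * qp (a + 2 * m) (5 * m) n * qp (a + 3 * m) (5 * m) n * qp (a + 4 * m) (5 * m) n
    = qp a m (5 * n)"
  using qp_split[where r = 5 and a = a and m = m and n = n]
  by (simp add: numeral_eq_Suc lessThan_Suc mult_ac)

lemma qm_qp: "qm a m n * qp a m n = qp (2 * a) (2 * m) n"
proof (induction n)
  case (Suc n)
  have "1 - fps_X ^ (2 * m * n + 2 * a) = (1 + fps_X ^ (m * n + a)) * (1 - fps_X ^ (m * n + a) :: rat fps)"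
    by (simp add: ring_distribs flip: power_add)
  then show ?case
    by (simp only: qp_Suc qm_Suc Suc[symmetric]) (metis (no_types, lifting) mult.assoc mult.left_commute)
qed simp

lemma qp_odd_tendsto: "(\<lambda>n. qp m (2 * m) n) \<longlonglongrightarrow> E m * inverse (E (2 * m))" if "m > 0"
proof -
  have "(\<lambda>n. qp m m (2 * n) * inverse (qp (2 * m) (2 * m) n)) \<longlonglongrightarrow> E m * inverse (E (2 * m))"
    by (intro tendsto_mult_fps tendsto_reparam tendsto_inverse_fps qp_tendsto) (use that in auto)
  moreover have "qp m m (2 * n) * inverse (qp (2 * m) (2 * m) n) = qp m (2 * m) n" for n
  proof -
    have "qp m m (2 * n) = qp m (2 * m) n * qp (2 * m) (2 * m) n"
      using qp_split2[of m m n] by (simp add: mult_2)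
    then show ?thesis
      using that by (simp add: mult.assoc inverse_mult_eq_1')
  qed
  ultimately show ?thesis by simp
qed

lemma qm_odd_tendsto: "(\<lambda>n. qm m (2 * m) n) \<longlonglongrightarrow> E (2 * m) ^ 2 * inverse (E m * E (4 * m))" if "m > 0"
proof -
  have "(\<lambda>n. qp (2 * m) (2 * (2 * m)) n * inverse (qp m (2 * m) n))
     \<longlonglongrightarrow> (E (2 * m) * inverse (E (2 * (2 * m)))) * inverse (E m * inverse (E (2 * m)))"
    by (intro tendsto_mult_fps tendsto_inverse_fps qp_odd_tendsto) (use that in auto)
  moreover have "qp (2 * m) (2 * (2 * m)) n * inverse (qp m (2 * m) n) = qm m (2 * m) n" for n
    using that unfolding qm_qp[symmetric] by (simp add: mult.assoc inverse_mult_eq_1')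
  moreover have "inverse (E m * inverse (E (2 * m))) = E (2 * m) * inverse (E m)"
    using that by (simp add: fps_inverse_mult)
  ultimately show ?thesis
    using that by (simp add: fps_inverse_mult power2_eq_square mult_ac)
qed

abbreviation theta :: "nat \<Rightarrow> nat \<Rightarrow> rat fps" where
  "theta m a \<equiv> gf UNIV (sg (- 1)) (tri m a)"

text \<open>The triple product supplies the factors with exponents 1 and 2 modulo 3, and its
  prefactor \<open>E 3\<close> the multiples of 3.\<close>

theorem pentagonal: "theta 3 1 = E 1"
proof (rule LIMSEQ_unique)
  have 1: "(\<lambda>n. qp 1 3 n * qp 2 3 n) \<longlonglongrightarrow> E 1 * inverse (E 3)"
  proof -
    have "(\<lambda>n. qp 1 1 (3 * n) * inverse (qp 3 3 n)) \<longlonglongrightarrow> E 1 * inverse (E 3)"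
      by (intro tendsto_mult_fps tendsto_reparam tendsto_inverse_fps qp_tendsto) auto
    moreover have "qp 1 1 (3 * n) * inverse (qp 3 3 n) = qp 1 3 n * qp 2 3 n" for n
      using qp_split3[of 1 1 n, symmetric] by (simp add: mult.assoc inverse_mult_eq_1' del: One_nat_def)
    ultimately show ?thesis by simp
  qed
  show "(\<lambda>n. E 3 * (qp 1 3 n * qp 2 3 n)) \<longlonglongrightarrow> theta 3 1"
    using jtp_minus[of 1 3] by simp
  show "(\<lambda>n. E 3 * (qp 1 3 n * qp 2 3 n)) \<longlonglongrightarrow> E 1"
    using tendsto_mult_fps[OF tendsto_const 1, of "E 3"] by (simp add: mult.left_commute inverse_mult_eq_1')
qed

text \<open>In Ramanujan's notation \<open>phi\<close> is phi(-q) and \<open>psi\<close> is psi(q):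
  the exponents \<open>2 * j^2 - j\<close> for integers \<open>j\<close> run once through the
  triangular numbers.\<close>

definition phi :: "rat fps" where "phi = theta 2 1"
definition psi :: "rat fps" where "psi = gf UNIV (sg 1) (tri 4 1)"

lemma phi_prod: "phi * E 2 = E 1 ^ 2"
proof -
  have "phi = E 2 * (E 1 * inverse (E 2)) ^ 2"
    unfolding phi_def
  proof (rule LIMSEQ_unique)
    show "(\<lambda>n. E 2 * (qp 1 2 n * qp 1 2 n)) \<longlonglongrightarrow> theta 2 1"
      using jtp_minus[of 1 2] by simp
    show "(\<lambda>n. E 2 * (qp 1 2 n * qp 1 2 n)) \<longlonglongrightarrow> E 2 * (E 1 * inverse (E 2)) ^ 2"
      unfolding power2_eq_square
      by (intro tendsto_mult_fps tendsto_const) (use qp_odd_tendsto[of 1] in simp_all)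
  qed
  then have "phi * E 2 = E 1 ^ 2 * (E 2 * inverse (E 2)) ^ 2"
    by (simp add: power2_eq_square mult_ac)
  then show ?thesis
    by (simp add: inverse_mult_eq_1')
qed

lemma phi_plus_prod: "gf UNIV (sg 1) (tri 2 1) * (E 1 ^ 2 * E 4 ^ 2) = E 2 ^ 5"
proof -
  have "gf UNIV (sg 1) (tri 2 1) = E 2 * (E 2 ^ 2 * inverse (E 1 * E 4)) ^ 2"
  proof (rule LIMSEQ_unique)
    show "(\<lambda>n. E 2 * (qm 1 2 n * qm 1 2 n)) \<longlonglongrightarrow> gf UNIV (sg 1) (tri 2 1)"
      using jtp_plus[of 1 2] by simp
    show "(\<lambda>n. E 2 * (qm 1 2 n * qm 1 2 n)) \<longlonglongrightarrow> E 2 * (E 2 ^ 2 * inverse (E 1 * E 4)) ^ 2"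
      unfolding power2_eq_square[of "_ * inverse _"]
      by (intro tendsto_mult_fps tendsto_const) (use qm_odd_tendsto[of 1] in simp_all)
  qed
  then have "gf UNIV (sg 1) (tri 2 1) * (E 1 ^ 2 * E 4 ^ 2) = E 2 ^ 5 * ((E 1 * E 4) * inverse (E 1 * E 4)) ^ 2"
    by (simp add: power_numeral_reduce mult_ac)
  then show ?thesis
    by (simp add: inverse_mult_eq_1')
qed

lemma psi_prod: "psi * E 1 = E 2 ^ 2"
proof -
  have "psi = E 4 * (E 2 ^ 2 * inverse (E 1 * E 4))"
    unfolding psi_def
  proof (rule LIMSEQ_unique)
    show "(\<lambda>n. E 4 * qm 1 2 (2 * n)) \<longlonglongrightarrow> gf UNIV (sg 1) (tri 4 1)"
      using jtp_plus[of 1 4] qm_split2[of 1 2] by (simp del: One_nat_def)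
    show "(\<lambda>n. E 4 * qm 1 2 (2 * n)) \<longlonglongrightarrow> E 4 * (E 2 ^ 2 * inverse (E 1 * E 4))"
      by (intro tendsto_mult_fps tendsto_const tendsto_reparam) (use qm_odd_tendsto[of 1] in simp_all)
  qed
  then have "psi * E 1 = E 2 ^ 2 * ((E 1 * E 4) * inverse (E 1 * E 4))"
    by (simp add: mult_ac)
  then show ?thesis
    by (simp add: inverse_mult_eq_1')
qed

text \<open>The residues 1, 9, 3, 7 modulo 10 are those of the odd numbers prime to 5, so the
  product is \<open>(q; q^2)\<close> divided by \<open>(q^5; q^10)\<close>, up to the
  prefactors.\<close>

lemma theta10_prod:
  "theta 10 1 * theta 10 3 * (E 5 * E 2) = E 10 ^ 3 * E 1"
proof -
  have 1: "(\<lambda>n. (E 10 * (qp 1 10 n * qp 9 10 n)) * (E 10 * (qp 3 10 n * qp 7 10 n)))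
      \<longlonglongrightarrow> theta 10 1 * theta 10 3"
    using jtp_minus[of 1 10] jtp_minus[of 3 10] by (intro tendsto_mult_fps) simp_all
  have eq: "qp 1 10 n * qp 9 10 n * (qp 3 10 n * qp 7 10 n) = qp 1 2 (5 * n) * inverse (qp 5 10 n)" for n
    using qp_split5[of 1 2 n, symmetric] by (simp add: mult_ac inverse_mult_eq_1' del: One_nat_def)
  have "(\<lambda>n. E 10 ^ 2 * (qp 1 2 (5 * n) * inverse (qp 5 10 n)))
      \<longlonglongrightarrow> E 10 ^ 2 * ((E 1 * inverse (E 2)) * inverse (E 5 * inverse (E 10)))"
    by (intro tendsto_mult_fps tendsto_const tendsto_reparam tendsto_inverse_fps)
       (use qp_odd_tendsto[of 1] qp_odd_tendsto[of 5] in simp_all)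
  moreover have "(\<lambda>n. E 10 ^ 2 * (qp 1 2 (5 * n) * inverse (qp 5 10 n)))
     = (\<lambda>n. (E 10 * (qp 1 10 n * qp 9 10 n)) * (E 10 * (qp 3 10 n * qp 7 10 n)))"
    unfolding eq[symmetric] by (simp add: power2_eq_square mult_ac)
  ultimately have "theta 10 1 * theta 10 3
     = E 10 ^ 2 * ((E 1 * inverse (E 2)) * inverse (E 5 * inverse (E 10)))"
    by (intro LIMSEQ_unique[OF 1]) simp
  also have "inverse (E 5 * inverse (E 10)) = E 10 * inverse (E 5)"
    by (simp add: fps_inverse_mult)
  finally have "theta 10 1 * theta 10 3 * (E 5 * E 2)
    = E 10 ^ 3 * E 1 * (E 5 * inverse (E 5)) * (E 2 * inverse (E 2))"
    by (simp add: power_numeral_reduce mult_ac)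
  then show ?thesis
    by (simp add: inverse_mult_eq_1')
qed

text \<open>The even-indexed terms of the finite triple product at \<open>z = \<i> q\<^sup>1\<^sup>/\<^sup>2\<close>; the odd-indexed ones cancel.\<close>

definition alpha :: "int \<Rightarrow> rat fps" where
  "alpha j = (if even j then fps_const (sg (- 1) (j div 2)) * fps_X ^ nat (j\<^sup>2 div 2) else 0)"

lemma alpha_double: "alpha (2 * r) = fps_const (sg (- 1) r) * fps_X ^ nat (2 * r\<^sup>2)"
  by (simp add: alpha_def power_mult_distrib)

text \<open>The recurrence of \<open>finite_theta_step\<close> holds with \<open>u = 0\<close>: both
  neighbours vanish at an even index and cancel at an odd one. Only the factor
  \<open>1 + q^(2 n + 1)\<close> is left at each step.\<close>

lemma finite_alpha_sum: "(\<Sum>k\<le>2*n. qbin fps_X (2*n) k * alpha (int k - int n)) = qm 1 2 n"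
proof (induction n)
  case 0
  then show ?case by (simp add: alpha_def sg_def)
next
  case (Suc n)
  have "(\<Sum>k\<le>2*n+2. qbin fps_X (2*n+2) k * alpha (int k - (int n + 1)))
      = (1 + fps_X ^ Suc (2*n) + 0) * (\<Sum>k\<le>2*n. qbin fps_X (2*n) k * alpha (int k - int n))"
  proof (rule finite_theta_step)
    fix k assume k: "k \<le> 2 * n"
    show "fps_X ^ k * alpha (int k - int n - 1) + fps_X ^ (2 * n - k) * alpha (int k - int n + 1)
       = 0 * alpha (int k - int n)"
    proof (cases "even (int k - int n)")
      case True
      then show ?thesis by (simp add: alpha_def)
    next
      case False
      then obtain r where r: "int k - int n = 2 * r + 1" by (rule oddE)
      then have 1: "int k - int n - 1 = 2 * r" "int k - int n + 1 = 2 * (r + 1)" by auto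
      have "int k = 2 * r + 1 + int n" using r by simp
      then have "int (k + nat (2 * r\<^sup>2)) = int (2 * n - k + nat (2 * (r + 1)\<^sup>2))"
        using k unfolding of_nat_add by (simp add: of_nat_diff) (simp add: power2_eq_square algebra_simps)
      then have 2: "k + nat (2 * r\<^sup>2) = 2 * n - k + nat (2 * (r + 1)\<^sup>2)"
        by (simp only: of_nat_eq_iff)
      have "fps_X ^ k * alpha (2 * r) = fps_const (sg (- 1) r) * fps_X ^ (k + nat (2 * r\<^sup>2))"
        unfolding alpha_double power_add by (simp only: mult.left_commute)
      moreover have "fps_X ^ (2 * n - k) * alpha (2 * (r + 1)) = fps_const (sg (- 1) (r + 1)) * fps_X ^ (2 * n - k + nat (2 * (r + 1)\<^sup>2))"
        unfolding alpha_double power_add by (simp only: mult.left_commute)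
      moreover have "sg (- 1) (r + 1) = - sg (- 1) r"
        by (simp add: sg_def)
      ultimately show ?thesis
        unfolding 1 2 by (simp flip: fps_const_neg)
    qed
  qed
  also have "(1 + fps_X ^ Suc (2*n) + 0) * (\<Sum>k\<le>2*n. qbin fps_X (2*n) k * alpha (int k - int n))
     = qm 1 2 (Suc n)"
    unfolding Suc by (simp add: qm_Suc mult.commute)
  finally show ?case
    by (simp add: algebra_simps del: qbin.simps)
qed

section \<open>Odd divisor sums\<close>

definition sigma_odd :: "rat fps" where
  "sigma_odd = Abs_fps (\<lambda>n. if odd n then of_nat (\<Sum>d | d dvd n. d) else 0)"

abbreviation lambert_square :: "nat \<Rightarrow> rat fps" where
  "lambert_square n \<equiv> fps_X ^ n * inverse ((1 - fps_X ^ n) ^ 2)"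

lemma lambert_square_nth:
  assumes "n > 0"
  shows "fps_nth (lambert_square n) N = (if n dvd N then rat_of_nat (N div n) else 0)"
proof -
  define G :: "rat fps" where "G = Abs_fps of_nat"
  have "G * (1 - fps_X) ^ 2 = fps_X"
  proof (rule fps_ext)
    fix k
    have "G * (1 - fps_X) ^ 2 = G - 2 * (fps_X * G) + fps_X * (fps_X * G)"
      by (simp add: power2_eq_square algebra_simps)
    then show "fps_nth (G * (1 - fps_X) ^ 2) k = fps_nth fps_X k"
      by (cases k; cases "k - 1") (auto simp: G_def numeral_fps_const)
  qed
  then have "dil n G * (1 - fps_X ^ n) ^ 2 = fps_X ^ n"
    using assms by (metis dil_1 dil_X dil_diff dil_mult dil_power)
  then have "lambert_square n = dil n G * ((1 - fps_X ^ n) ^ 2 * inverse ((1 - fps_X ^ n) ^ 2))"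
    by (simp add: mult.assoc)
  also have "(1 - fps_X ^ n) ^ 2 * inverse ((1 - fps_X ^ n) ^ 2) = (1 :: rat fps)"
    using assms by (intro inverse_mult_eq_1') simp
  finally show ?thesis
    by (simp add: dil_nth G_def)
qed

lemma lambert_odd_nth:
  assumes "n > 0"
  shows "fps_nth (fps_X ^ n * inverse (1 - fps_X ^ (2 * n))) N = (if n dvd N \<and> odd (N div n) then 1 else 0 :: rat)"
proof -
  define G :: "rat fps" where "G = Abs_fps (\<lambda>k. if odd k then 1 else 0)"
  have "G * (1 - fps_X ^ 2) = fps_X"
  proof (rule fps_ext)
    fix k
    have "G * (1 - fps_X ^ 2) = G - fps_X * (fps_X * G)"
      by (simp add: power2_eq_square algebra_simps)
    then show "fps_nth (G * (1 - fps_X ^ 2)) k = fps_nth fps_X k"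
      by (cases k; cases "k - 1") (auto simp: G_def)
  qed
  then have "dil n G * (1 - (fps_X ^ n) ^ 2) = fps_X ^ n"
    using assms by (metis dil_1 dil_X dil_diff dil_mult dil_power)
  then have "dil n G * (1 - fps_X ^ (2 * n)) = fps_X ^ n"
    by (simp add: mult.commute flip: power_mult)
  then have "fps_X ^ n * inverse (1 - fps_X ^ (2 * n)) = dil n G * ((1 - fps_X ^ (2 * n)) * inverse (1 - fps_X ^ (2 * n)))"
    by (metis mult.assoc)
  also have "(1 - fps_X ^ (2 * n)) * inverse (1 - fps_X ^ (2 * n)) = (1 :: rat fps)"
    using assms by (intro inverse_mult_eq_1') simp
  finally show ?thesis
    by (auto simp: dil_nth G_def)
qed

text \<open>An odd \<open>N\<close> has only odd divisors with odd cofactors, so all of them are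
  counted; for even \<open>N\<close> an odd divisor has an even cofactor and nothing is
  counted.\<close>

lemma lambert_sum_tendsto:
  "(\<lambda>n. \<Sum>i<n. of_nat (2 * i + 1) * (fps_X ^ (2 * i + 1) * inverse (1 - fps_X ^ (2 * (2 * i + 1))))) \<longlonglongrightarrow> sigma_odd"
proof (rule tendsto_eqN_diagI)
  fix n
  show "eqN n (\<Sum>i<n. of_nat (2 * i + 1) * (fps_X ^ (2 * i + 1) * inverse (1 - fps_X ^ (2 * (2 * i + 1))))) sigma_odd"
    unfolding eqN_def
  proof (intro allI impI)
    fix N assume N: "N < n"
    have "fps_nth (\<Sum>i<n. of_nat (2 * i + 1) * (fps_X ^ (2 * i + 1) * inverse (1 - fps_X ^ (2 * (2 * i + 1))))) N
       = (\<Sum>i<n. rat_of_nat (2 * i + 1) * fps_nth (fps_X ^ (2 * i + 1) * inverse (1 - fps_X ^ (2 * (2 * i + 1)))) N)"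
      unfolding fps_sum_nth fps_of_nat[symmetric] by (simp only: fps_mult_left_const_nth)
    also have "\<dots> = (\<Sum>i<n. rat_of_nat (2 * i + 1) * (if (2 * i + 1) dvd N \<and> odd (N div (2 * i + 1)) then 1 else 0))"
      by (subst lambert_odd_nth) simp_all
    also have "\<dots> = (\<Sum>i\<in>{i\<in>{..<n}. (2 * i + 1) dvd N \<and> odd (N div (2 * i + 1))}. rat_of_nat (2 * i + 1))"
      by (subst sum.inter_filter) (auto intro!: sum.cong)
    also have "\<dots> = fps_nth sigma_odd N"
    proof (cases "odd N")
      case True
      then have N0: "N > 0" by (auto intro: Nat.gr0I)
      have "(\<Sum>i\<in>{i\<in>{..<n}. (2 * i + 1) dvd N \<and> odd (N div (2 * i + 1))}. rat_of_nat (2 * i + 1))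
        = (\<Sum>d | d dvd N. rat_of_nat d)"
      proof (rule sum.reindex_bij_witness[where j = "\<lambda>i. 2 * i + 1" and i = "\<lambda>d. d div 2"])
        fix d assume d: "d \<in> {d. d dvd N}"
        then have "odd d" using True by auto
        then show "2 * (d div 2) + 1 = d" by simp
        moreover have "d \<le> N" using d N0 by (auto dest: dvd_imp_le)
        moreover have "odd (N div d)" using d True by (metis dvd_mult_div_cancel even_mult_iff mem_Collect_eq)
        ultimately show "d div 2 \<in> {i\<in>{..<n}. (2 * i + 1) dvd N \<and> odd (N div (2 * i + 1))}"
          using d N by auto
      qed auto
      with True show ?thesis by (simp add: sigma_odd_def)
    next
      case False
      have "even (N div (2 * i + 1))" if "(2 * i + 1) dvd N" for i
      proof -
        have "even ((2 * i + 1) * (N div (2 * i + 1)))"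
          using False that by (metis dvd_mult_div_cancel)
        then show ?thesis by simp
      qed
      then have "{i\<in>{..<n}. (2 * i + 1) dvd N \<and> odd (N div (2 * i + 1))} = {}"
        by blast
      with False show ?thesis by (simp only: sigma_odd_def fps_nth_Abs_fps) simp
    qed
    finally show "fps_nth (\<Sum>i<n. of_nat (2 * i + 1) * (fps_X ^ (2 * i + 1) * inverse (1 - fps_X ^ (2 * (2 * i + 1))))) N
       = fps_nth sigma_odd N" .
  qed
qed

section \<open>The logarithmic derivative of phi(q) / phi(-q) as a Lambert series\<close>

lemma X_deriv_one_pm:
  assumes "k > 0"
  shows "fps_X * fps_deriv (1 + fps_X ^ k) = (of_nat k * fps_X ^ k :: rat fps)"
    and "fps_X * fps_deriv (1 - fps_X ^ k) = (- of_nat k * fps_X ^ k :: rat fps)"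
  using assms by (auto intro!: fps_ext simp: fps_mult_fps_X_deriv_shift fps_of_nat[symmetric] simp flip: fps_const_neg)

text \<open>With \<open>x = q^k\<close>, the quotient \<open>(1 + x) / (1 - x)\<close> has
  logarithmic derivative \<open>2 * k * x / (1 - x^2)\<close> under the operator q d/dq; the sum
  over odd \<open>k\<close> is stated after cross-multiplication.\<close>

lemma wronskian_products:
  "fps_X * (fps_deriv (qm 1 2 n) * qp 1 2 n - qm 1 2 n * fps_deriv (qp 1 2 n))
    = 2 * (qm 1 2 n * qp 1 2 n) *
      (\<Sum>i<n. of_nat (2 * i + 1) * (fps_X ^ (2 * i + 1) * inverse (1 - fps_X ^ (2 * (2 * i + 1)))))"
proof (induction n)
  case (Suc n)
  define k where "k = 2 * n + 1"
  have k: "k > 0" by (simp add: k_def)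
  define f g where "f = qm 1 2 n" and "g = qp 1 2 n"
  define L where "L = (\<Sum>i<n. of_nat (2 * i + 1) * (fps_X ^ (2 * i + 1) * inverse (1 - fps_X ^ (2 * (2 * i + 1)))) :: rat fps)"
  define x :: "rat fps" where "x = fps_X ^ k"
  have IH: "fps_X * (fps_deriv f * g - f * fps_deriv g) = 2 * (f * g) * L"
    using Suc unfolding f_def g_def L_def .
  have p: "fps_X * fps_deriv (1 + x) = of_nat k * x" and m: "fps_X * fps_deriv (1 - x) = - of_nat k * x"
    using X_deriv_one_pm[OF k] unfolding x_def by auto
  have "fps_X ^ (2 * k) = x ^ 2"
    unfolding x_def by (metis mult.commute power_mult)
  moreover have "fps_nth ((1 + x) * (1 - x)) 0 \<noteq> 0"
    using k by (simp add: x_def)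
  ultimately have inv: "(1 + x) * (1 - x) * inverse (1 - fps_X ^ (2 * k)) = 1"
    by (subst inverse_mult_eq_1'[of "(1 + x) * (1 - x)", symmetric]) (simp_all add: algebra_simps power2_eq_square)
  have "fps_X * (fps_deriv (f * (1 + x)) * (g * (1 - x)) - f * (1 + x) * fps_deriv (g * (1 - x)))
    = (fps_X * (fps_deriv f * g - f * fps_deriv g)) * ((1 + x) * (1 - x))
      + f * g * ((fps_X * fps_deriv (1 + x)) * (1 - x) - (1 + x) * (fps_X * fps_deriv (1 - x)))"
    unfolding fps_deriv_mult by (simp only: ring_distribs mult_ac add_ac) (simp add: algebra_simps)
  also have "\<dots> = 2 * (f * g) * L * ((1 + x) * (1 - x)) + f * g * (2 * of_nat k * x)"
    unfolding IH p m by (simp add: algebra_simps)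
  also have "f * g * (2 * of_nat k * x) = f * g * (2 * of_nat k * x) * ((1 + x) * (1 - x) * inverse (1 - fps_X ^ (2 * k)))"
    unfolding inv by simp
  also have "2 * (f * g) * L * ((1 + x) * (1 - x)) + \<dots>
     = 2 * (f * (1 + x) * (g * (1 - x))) * (L + of_nat k * (x * inverse (1 - fps_X ^ (2 * k))))"
    by (simp only: ring_distribs) (simp add: mult_ac)
  finally show ?case
    unfolding qp_Suc qm_Suc sum.lessThan_Suc k_def[symmetric] x_def[symmetric] f_def[symmetric] g_def[symmetric] L_def[symmetric] .
qed simp

lemma tendsto_fps_deriv:
  fixes F :: "nat \<Rightarrow> rat fps"
  shows "F \<longlonglongrightarrow> a \<Longrightarrow> (\<lambda>n. fps_deriv (F n)) \<longlonglongrightarrow> fps_deriv a"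
  unfolding tendsto_fps_iff by (auto elim!: eventually_mono)

lemma tendsto_diff_fps:
  fixes F G :: "nat \<Rightarrow> rat fps"
  assumes "F \<longlonglongrightarrow> a" "G \<longlonglongrightarrow> b"
  shows "(\<lambda>n. F n - G n) \<longlonglongrightarrow> a - b"
  unfolding tendsto_fps_iff
proof
  fix N
  from assms have "\<forall>\<^sub>F n in sequentially. fps_nth (F n) N = fps_nth a N" "\<forall>\<^sub>F n in sequentially. fps_nth (G n) N = fps_nth b N"
    by (auto simp: tendsto_fps_iff)
  then show "\<forall>\<^sub>F n in sequentially. fps_nth (F n - G n) N = fps_nth (a - b) N"
    by eventually_elim simp
qed

definition phi_plus :: "rat fps" where "phi_plus = gf UNIV (sg 1) (tri 2 1)"

text \<open>Both theta series are \<open>E 2\<close> times the square of a product. The common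
  factor \<open>E 2\<close> leaves the logarithmic derivative of the quotient unchanged, and
  squaring turns the factor 2 into 4.\<close>

lemma wronskian_theta:
  "fps_X * (fps_deriv phi_plus * phi - phi_plus * fps_deriv phi) = 4 * (phi_plus * phi) * sigma_odd"
proof -
  define Fp Fm where "Fp = (\<lambda>n. E 2 * (qm 1 2 n * qm 1 2 n))" and "Fm = (\<lambda>n. E 2 * (qp 1 2 n * qp 1 2 n))"
  define L where "L = (\<lambda>n. \<Sum>i<n. of_nat (2 * i + 1) * (fps_X ^ (2 * i + 1) * inverse (1 - fps_X ^ (2 * (2 * i + 1)))) :: rat fps)"
  have Fp: "Fp \<longlonglongrightarrow> phi_plus"
    unfolding Fp_def phi_plus_def using jtp_plus[of 1 2] by simp
  have Fm: "Fm \<longlonglongrightarrow> phi"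
    unfolding Fm_def phi_def using jtp_minus[of 1 2] by simp
  have eq: "fps_X * (fps_deriv (Fp n) * Fm n - Fp n * fps_deriv (Fm n)) = 4 * (Fp n * Fm n) * L n" for n
  proof -
    define f g where "f = qm 1 2 n" and "g = qp 1 2 n"
    have w: "fps_X * (fps_deriv f * g - f * fps_deriv g) = 2 * (f * g) * L n"
      unfolding f_def g_def L_def by (rule wronskian_products)
    have "fps_X * (fps_deriv (Fp n) * Fm n - Fp n * fps_deriv (Fm n))
      = 2 * E 2 ^ 2 * (f * g) * (fps_X * (fps_deriv f * g - f * fps_deriv g))"
      unfolding Fp_def Fm_def f_def[symmetric] g_def[symmetric] fps_deriv_mult
      by (simp add: power2_eq_square algebra_simps)
    also have "\<dots> = 4 * (Fp n * Fm n) * L n"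
      unfolding w Fp_def Fm_def f_def[symmetric] g_def[symmetric] by (simp add: power2_eq_square mult_ac)
    finally show ?thesis .
  qed
  have "(\<lambda>n. fps_X * (fps_deriv (Fp n) * Fm n - Fp n * fps_deriv (Fm n)))
      \<longlonglongrightarrow> fps_X * (fps_deriv phi_plus * phi - phi_plus * fps_deriv phi)"
    by (intro tendsto_mult_fps tendsto_diff_fps tendsto_fps_deriv tendsto_const Fp Fm)
  moreover have "(\<lambda>n. 4 * (Fp n * Fm n) * L n) \<longlonglongrightarrow> 4 * (phi_plus * phi) * sigma_odd"
    unfolding L_def by (intro tendsto_mult_fps tendsto_const Fp Fm lambert_sum_tendsto)
  ultimately show ?thesis
    unfolding eq by (rule LIMSEQ_unique)
qed

lemma X_deriv_gf: "fps_X * fps_deriv (gf A w e) = gf A (\<lambda>x. of_nat (e x) * w x) e"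
proof (rule fps_ext)
  fix n
  show "fps_nth (fps_X * fps_deriv (gf A w e)) n = fps_nth (gf A (\<lambda>x. of_nat (e x) * w x) e) n"
    by (simp add: fps_mult_fps_X_deriv_shift gf_nth sum_distrib_left)
qed

lemma int_tri_2_1: "int (tri 2 1 j) = j\<^sup>2"
  using int_tri[of 1 2 j] by (simp add: power2_eq_square algebra_simps)

text \<open>The indices \<open>m + 1\<close> and \<open>- m\<close> in \<open>jacobi_cube\<close>
  have the same exponent. Adding the two reindexed copies produces the weight
  \<open>2 * m + 1\<close> and the factor 2.\<close>

lemma jacobi_cube_sym: "gf UNIV (\<lambda>m. sg (- 1) m * of_int (2 * m + 1)) (\<lambda>m. nat (2 * m\<^sup>2 + 2 * m)) = 2 * E 4 ^ 3"
proof -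
  have t: "4 * tri 1 0 (m + 1) = nat (2 * m\<^sup>2 + 2 * m)" "4 * tri 1 0 (- m) = nat (2 * m\<^sup>2 + 2 * m)" for m
    using int_tri[of 0 1 "m + 1"] int_tri[of 0 1 "- m"] by (simp_all add: power2_eq_square algebra_simps)
  have "E 4 ^ 3 = dil 4 (E 1 ^ 3)"
    by (simp add: dil_power dil_E)
  also have "\<dots> = gf UNIV (\<lambda>j. - sg (- 1) j * of_int j) (\<lambda>j. 4 * tri 1 0 j)"
    unfolding jacobi_cube[symmetric] by (rule dil_gf) simp
  finally have E: "E 4 ^ 3 = gf UNIV (\<lambda>j. - sg (- 1) j * of_int j) (\<lambda>j. 4 * tri 1 0 j)" .
  have "E 4 ^ 3 = gf UNIV (\<lambda>m. sg (- 1) m * of_int (m + 1)) (\<lambda>m. nat (2 * m\<^sup>2 + 2 * m))"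
    unfolding E by (subst gf_reindex[where h = "\<lambda>m. m + 1" and B = UNIV])
      (auto simp: t[simplified] sg_def intro!: gf_cong bij_betwI[where g = "\<lambda>m. m - 1"])
  moreover have "E 4 ^ 3 = gf UNIV (\<lambda>m. sg (- 1) m * of_int m) (\<lambda>m. nat (2 * m\<^sup>2 + 2 * m))"
    unfolding E by (subst gf_reindex[where h = "\<lambda>m. - m" and B = UNIV])
      (auto simp: t[simplified] sg_def intro!: gf_cong bij_betwI[where g = "\<lambda>m. - m"])
  ultimately have "E 4 ^ 3 + E 4 ^ 3 = gf UNIV (\<lambda>m. sg (- 1) m * of_int (m + 1) + sg (- 1) m * of_int m) (\<lambda>m. nat (2 * m\<^sup>2 + 2 * m))"
    by (simp only: gf_add)
  also have "\<dots> = gf UNIV (\<lambda>m. sg (- 1) m * of_int (2 * m + 1)) (\<lambda>m. nat (2 * m\<^sup>2 + 2 * m))"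
    by (intro gf_cong) (auto simp: algebra_simps)
  finally show ?thesis by simp
qed

lemma sg_minus_mult: "sg (- 1) i * sg (- 1) j = sg (- 1) (i + j)" "sg (- 1) (i - j) = sg (- 1) i * sg (- 1) j"
  by (auto simp: sg_def)

text \<open>The substitution \<open>x = m + n + 1\<close>, \<open>y = m - n\<close> turns \<open>x\<^sup>2 - y\<^sup>2\<close> into \<open>(2 m + 1) (2 n + 1)\<close>
  and separates the variables of \<open>x\<^sup>2 + y\<^sup>2\<close>; the pairs with \<open>x + y\<close> even cancel under \<open>(x, y) \<mapsto> (y, x)\<close>.\<close>

lemma wronskian_eq_cube:
  "fps_X * (fps_deriv phi_plus * phi - phi_plus * fps_deriv phi) = 4 * fps_X * E 4 ^ 6"
proof -
  let ?w = "\<lambda>(x, y). rat_of_int (x\<^sup>2 - y\<^sup>2) * sg (- 1) y"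
  let ?e = "\<lambda>(x, y). tri 2 1 x + tri 2 1 y"
  have of_tri: "rat_of_nat (tri 2 1 x) = rat_of_int (x\<^sup>2)" for x
    by (metis int_tri_2_1 of_int_of_nat_eq)
  have ff: "ffib UNIV (tri 2 1)" by (rule ffib_tri) auto
  have fe: "ffib A ?e" for A
    by (rule ffib_subset[OF ffib_prod[OF ff ff]]) auto
  have "fps_X * (fps_deriv phi_plus * phi - phi_plus * fps_deriv phi)
     = (fps_X * fps_deriv phi_plus) * phi - phi_plus * (fps_X * fps_deriv phi)"
    by (simp add: algebra_simps)
  also have "\<dots> = gf (UNIV \<times> UNIV) (\<lambda>(x, y). (of_nat (tri 2 1 x) * sg 1 x) * sg (- 1) y) ?e
     + fps_const (- 1) * gf (UNIV \<times> UNIV) (\<lambda>(x, y). sg 1 x * (of_nat (tri 2 1 y) * sg (- 1) y)) ?e"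
    unfolding phi_plus_def phi_def X_deriv_gf gf_mult[OF ff ff]
    by (simp flip: fps_const_neg del: UNIV_Times_UNIV)
  also have "\<dots> = gf (UNIV \<times> UNIV) ?w ?e"
    unfolding gf_scale[symmetric] gf_add[symmetric] of_tri
    by (intro gf_cong) (auto simp: sg_def algebra_simps)
  also have "UNIV \<times> UNIV = {(x :: int, y). odd (x + y)} \<union> {(x, y). even (x + y)}"
    by auto
  also have "gf \<dots> ?w ?e = gf {(x, y). odd (x + y)} ?w ?e + gf {(x, y). even (x + y)} ?w ?e"
    by (rule gf_Un[OF fe fe]) auto
  also have "gf {(x, y). even (x + y)} ?w ?e = 0"
  proof -
    have "gf {(x, y). even (x + y)} ?w ?e = gf {(x, y). even (x + y)} (\<lambda>p. ?w (prod.swap p)) (\<lambda>p. ?e (prod.swap p))"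
      by (rule gf_reindex) (auto intro!: bij_betwI[where g = prod.swap])
    also have "\<dots> = gf {(x, y). even (x + y)} (\<lambda>p. (- 1) * ?w p) ?e"
      by (rule gf_cong) (auto simp: sg_def algebra_simps)
    also have "\<dots> = - gf {(x, y). even (x + y)} ?w ?e"
      unfolding gf_scale by (simp flip: fps_const_neg)
    finally show ?thesis by simp
  qed
  also have "gf {(x, y). odd (x + y)} ?w ?e = gf (UNIV \<times> UNIV) (\<lambda>(m, n). ?w (m + n + 1, m - n)) (\<lambda>(m, n). ?e (m + n + 1, m - n))"
  proof -
    have "bij_betw (\<lambda>(m, n). (m + n + 1, m - n)) (UNIV \<times> UNIV) {(x :: int, y). odd (x + y)}"
    proof (rule bij_betwI[where g = "\<lambda>(x, y). ((x + y) div 2, (x - y) div 2)"])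
      fix p :: "int \<times> int" assume "p \<in> {(x, y). odd (x + y)}"
      then obtain x y where p: "p = (x, y)" "odd (x + y)" by auto
      have "(x + y) div 2 + (x - y) div 2 + 1 = x" "(x + y) div 2 - (x - y) div 2 = y"
        using p(2) by presburger+
      then show "(case case p of (x, y) \<Rightarrow> ((x + y) div 2, (x - y) div 2) of (m, n) \<Rightarrow> (m + n + 1, m - n)) = p"
        using p by simp
    qed auto
    from gf_reindex[OF this] show ?thesis
      by (simp only: case_prod_unfold)
  qed
  also have "\<dots> = gf (UNIV \<times> UNIV)
      (\<lambda>(m, n). (sg (- 1) m * of_int (2 * m + 1)) * (sg (- 1) n * of_int (2 * n + 1)))
      (\<lambda>p. (case p of (m, n) \<Rightarrow> nat (2 * m\<^sup>2 + 2 * m) + nat (2 * n\<^sup>2 + 2 * n)) + 1)"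
  proof (rule gf_cong)
    fix p :: "int \<times> int"
    obtain m n where p: "p = (m, n)" by force
    have nn: "2 * k\<^sup>2 + 2 * k \<ge> 0" for k :: int
    proof -
      have "2 * k\<^sup>2 + 2 * k = 2 * (k * (k + 1))" by (simp add: power2_eq_square algebra_simps)
      moreover have "k * (k + 1) \<ge> 0"
        by (cases "k \<ge> 0") (auto simp: mult_nonpos_nonpos)
      ultimately show ?thesis by linarith
    qed
    show "(case p of (m, n) \<Rightarrow> ?w (m + n + 1, m - n)) = (case p of (m, n) \<Rightarrow> (sg (- 1) m * of_int (2 * m + 1)) * (sg (- 1) n * of_int (2 * n + 1)))"
      unfolding p by (simp add: sg_minus_mult power2_eq_square algebra_simps)
    have "int (tri 2 1 (m + n + 1) + tri 2 1 (m - n)) = int (nat (2 * m\<^sup>2 + 2 * m) + nat (2 * n\<^sup>2 + 2 * n) + 1)"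
      using nn[of m] nn[of n] unfolding of_nat_add int_tri_2_1 by (simp add: power2_eq_square algebra_simps)
    then show "(case p of (m, n) \<Rightarrow> ?e (m + n + 1, m - n)) = (case p of (m, n) \<Rightarrow> nat (2 * m\<^sup>2 + 2 * m) + nat (2 * n\<^sup>2 + 2 * n)) + 1"
      unfolding p by (simp only: of_nat_eq_iff prod.case)
  qed
  also have "\<dots> = fps_X ^ 1 * (gf UNIV (\<lambda>m. sg (- 1) m * of_int (2 * m + 1)) (\<lambda>m. nat (2 * m\<^sup>2 + 2 * m))
      * gf UNIV (\<lambda>m. sg (- 1) m * of_int (2 * m + 1)) (\<lambda>m. nat (2 * m\<^sup>2 + 2 * m)))"
  proof -
    have "nat \<bar>m\<bar> \<le> nat (2 * m\<^sup>2 + 2 * m) + 1" for m :: int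
    proof -
      have "0 \<le> (m + 1) * (2 * m - 1) \<or> m = 0"
        by (cases "m \<ge> 1") (auto simp: mult_nonpos_nonpos)
      moreover have "0 \<le> (m + 1) * (2 * m + 1)"
        by (cases "m \<ge> 0") (auto simp: mult_nonpos_nonpos)
      ultimately have "\<bar>m\<bar> \<le> 2 * m\<^sup>2 + 2 * m + 1"
        by (auto simp: power2_eq_square algebra_simps)
      then show ?thesis by linarith
    qed
    then have "ffib UNIV (\<lambda>m :: int. nat (2 * m\<^sup>2 + 2 * m))"
      by (rule ffib_int_growth)
    then show ?thesis unfolding gf_shift by (subst gf_mult) auto
  qed
  also have "\<dots> + 0 = 4 * fps_X * E 4 ^ 6"
    unfolding jacobi_cube_sym by (simp add: power_numeral_reduce mult_ac)
  finally show ?thesis .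
qed

text \<open>The two evaluations of the Wronskian are equated. In
  \<open>phi_plus * phi = E 2 ^ 4 / E 4 ^ 2\<close>, which is phi(-q^2)^2, the series
  \<open>E 1\<close> cancels.\<close>

theorem sigma_odd_prod: "sigma_odd * E 2 ^ 4 = fps_X * E 4 ^ 8"
proof -
  have "phi_plus * phi * E 4 ^ 2 * (E 1 ^ 2 * E 2) = (phi_plus * (E 1 ^ 2 * E 4 ^ 2)) * (phi * E 2)"
    by (simp only: mult_ac)
  also have "\<dots> = E 2 ^ 4 * (E 1 ^ 2 * E 2)"
    unfolding phi_plus_def phi_plus_prod phi_prod by (simp add: power_numeral_reduce mult_ac)
  finally have "phi_plus * phi * E 4 ^ 2 = E 2 ^ 4"
    by simp
  then have "4 * (sigma_odd * E 2 ^ 4) = (4 * (phi_plus * phi) * sigma_odd) * E 4 ^ 2"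
    by (simp add: mult_ac)
  also have "\<dots> = 4 * (fps_X * E 4 ^ 8)"
    unfolding wronskian_theta[symmetric] wronskian_eq_cube by (simp add: power_numeral_reduce mult_ac)
  finally show ?thesis by simp
qed

section \<open>The generating function of the overpartition statistic\<close>

text \<open>The size is left free and measured by \<open>wt\<close>, so that adjoining a new part
  size multiplies generating functions.\<close>

definition ovp :: "nat set \<Rightarrow> (nat multiset \<times> nat set) set" where
  "ovp A = {(P, U). set_mset P \<subseteq> A \<and> U \<subseteq> set_mset P}"

definition wt :: "nat multiset \<times> nat set \<Rightarrow> nat" where
  "wt p = \<Sum>\<^sub># (fst p)"

definition ovp_gf :: "nat set \<Rightarrow> rat fps" where
  "ovp_gf A = gf (ovp A) (\<lambda>_. 1) wt"

lemma ffib_wt: "0 \<notin> A \<Longrightarrow> ffib (ovp A) wt"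
  unfolding ffib_def
proof
  fix n assume "0 \<notin> A"
  then have "{p \<in> ovp A. wt p = n} \<subseteq> overpartitions n"
    by (auto simp: ovp_def overpartitions_def wt_def)
  then show "finite {p \<in> ovp A. wt p = n}"
    using finite_overpartitions finite_subset by blast
qed

lemma filter_neq_id: "k \<notin># P \<Longrightarrow> filter_mset (\<lambda>x. x \<noteq> k) P = P"
  by (intro filter_mset_eq_conv[THEN iffD2]) auto

lemma ovp_insert_bij:
  assumes "k \<notin> A"
  shows "bij_betw (\<lambda>((P, U), (m, b)). (P + replicate_mset m k, if b then insert k U else U))
     (ovp A \<times> {(m, b). b \<longrightarrow> m > 0}) (ovp (insert k A))"
proof (rule bij_betwI[where g = "\<lambda>(P, U). ((filter_mset (\<lambda>x. x \<noteq> k) P, U - {k}), (count P k, k \<in> U))"], goal_cases)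
  case 1
  then show ?case
    by (auto simp: ovp_def split: if_splits)
next
  case 2
  then show ?case
    by (auto simp: ovp_def)
next
  case (3 x)
  then obtain P U m b where x: "x = ((P, U), (m, b))" by (metis prod.exhaust)
  have "k \<notin># P" "k \<notin> U"
    using 3 assms by (auto simp: x ovp_def)
  then show ?case
    by (auto simp: x filter_neq_id count_eq_zero_iff)
next
  case (4 y)
  have "filter_mset (\<lambda>x. x \<noteq> k) P + replicate_mset (count P k) k = P" for P
    by (rule multiset_eqI) auto
  then show ?case
    by (auto simp: split: prod.splits)
qed

text \<open>Multiplicity 0 occurs in one way and each positive multiplicity in two, which gives
  \<open>1 + 2 * q^k / (1 - q^k)\<close>.\<close>

lemma gf_overlined_part:
  assumes "k > 0"
  shows "gf {(m :: nat, b). b \<longrightarrow> m > 0} (\<lambda>_. 1) (\<lambda>(m, b). k * m) * (1 - fps_X ^ k) = 1 + fps_X ^ k"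
proof -
  have "fps_nth (gf {(m :: nat, b). b \<longrightarrow> m > 0} (\<lambda>_. 1) fst) n = (if n = 0 then 1 else 2)" for n
  proof -
    have "{x \<in> {(m :: nat, b). b \<longrightarrow> m > 0}. fst x = n} = (if n = 0 then {(n, False)} else {(n, False), (n, True)})"
      by auto
    then show ?thesis by (simp add: gf_nth)
  qed
  then have "gf {(m :: nat, b). b \<longrightarrow> m > 0} (\<lambda>_. 1) fst * (1 - fps_X) = 1 + fps_X"
    by (intro fps_ext) (auto simp: algebra_simps fps_X_mult_nth)
  then have "dil k (gf {(m :: nat, b). b \<longrightarrow> m > 0} (\<lambda>_. 1) fst) * (1 - fps_X ^ k) = 1 + fps_X ^ k"
    using assms by (metis dil_1 dil_X dil_add dil_diff dil_mult)
  then show ?thesis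
    using assms by (simp add: dil_gf case_prod_unfold)
qed

lemma ovp_gf_insert:
  assumes "k \<notin> A" "k > 0" "0 \<notin> A"
  shows "ovp_gf (insert k A) * (1 - fps_X ^ k) = ovp_gf A * (1 + fps_X ^ k)"
proof -
  have "ovp_gf (insert k A) = gf (ovp A \<times> {(m, b). b \<longrightarrow> m > 0}) (\<lambda>(p, c). 1 * 1) (\<lambda>(p, (m, b)). wt p + k * m)"
    unfolding ovp_gf_def by (subst gf_reindex[OF ovp_insert_bij[OF assms(1)]]) (auto simp: wt_def intro!: gf_cong)
  also have "\<dots> = ovp_gf A * gf {(m :: nat, b). b \<longrightarrow> m > 0} (\<lambda>_. 1) (\<lambda>(m, b). k * m)"
  proof -
    have "ffib {(m :: nat, b). b \<longrightarrow> m > 0} (\<lambda>(m, b). k * m)"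
      unfolding ffib_def
    proof
      fix n
      have "{x \<in> {(m :: nat, b). b \<longrightarrow> m > 0}. (case x of (m, b) \<Rightarrow> k * m) = n} \<subseteq> {..n} \<times> UNIV"
        using assms(2) by auto
      then show "finite {x \<in> {(m :: nat, b). b \<longrightarrow> m > 0}. (case x of (m, b) \<Rightarrow> k * m) = n}"
        by (rule finite_subset) auto
    qed
    from gf_mult[OF ffib_wt[OF assms(3)] this] show ?thesis
      unfolding ovp_gf_def by (simp add: case_prod_unfold)
  qed
  finally show ?thesis
    by (simp add: mult.assoc gf_overlined_part[OF assms(2)])
qed

lemma gf_singleton: "gf {a} w e = fps_const (w a) * fps_X ^ e a"
proof (rule fps_ext)
  fix n
  have "{x \<in> {a}. e x = n} = (if e a = n then {a} else {})" by auto
  then show "fps_nth (gf {a} w e) n = fps_nth (fps_const (w a) * fps_X ^ e a) n"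
    unfolding gf_nth by simp
qed

lemma ovp_gf_finite:
  assumes "finite A" "0 \<notin> A"
  shows "ovp_gf A * (\<Prod>k\<in>A. 1 - fps_X ^ k) = (\<Prod>k\<in>A. 1 + fps_X ^ k)"
  using assms
proof (induction A rule: finite_induct)
  case empty
  have "ovp {} = {({#}, {})}" by (auto simp: ovp_def)
  then have "ovp_gf {} = 1"
    unfolding ovp_gf_def by (simp only: gf_singleton) (simp add: wt_def)
  then show ?case by simp
next
  case (insert k A)
  then have "ovp_gf (insert k A) * (1 - fps_X ^ k) = ovp_gf A * (1 + fps_X ^ k)"
    by (intro ovp_gf_insert) auto
  with insert have "ovp_gf (insert k A) * ((1 - fps_X ^ k) * (\<Prod>k\<in>A. 1 - fps_X ^ k))
     = (1 + fps_X ^ k) * (ovp_gf A * (\<Prod>k\<in>A. 1 - fps_X ^ k))"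
    by (simp only: mult.assoc[symmetric]) (simp only: mult_ac)
  with insert show ?case
    by simp
qed

lemma ovp_gf_trunc: "eqN (Suc M) (ovp_gf A) (ovp_gf (A \<inter> {..M}))"
  unfolding eqN_def
proof (intro allI impI)
  fix i assume "i < Suc M"
  have le: "x \<le> \<Sum>\<^sub># P" if "x \<in># P" for x and P :: "nat multiset"
    using multi_member_split[OF that] by auto
  then have "{p \<in> ovp A. wt p = i} = {p \<in> ovp (A \<inter> {..M}). wt p = i}"
    using \<open>i < Suc M\<close> by (fastforce simp: ovp_def wt_def)
  then show "fps_nth (ovp_gf A) i = fps_nth (ovp_gf (A \<inter> {..M})) i"
    by (simp add: ovp_gf_def gf_nth)
qed

definition larger_parts :: "nat \<Rightarrow> nat set" where
  "larger_parts n = {k. n < k \<and> (odd k \<longrightarrow> k < 2 * n)}"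

text \<open>The admissible parts are \<open>n + 1\<close>, ..., \<open>2 * n\<close> and then the
  even numbers above \<open>2 * n\<close>. Truncated at \<open>2 * K\<close>, both products over
  them are quotients of Pochhammer symbols, and \<open>K\<close> tends to infinity. The factors
  \<open>(-q; q)_n\<close> and \<open>(-q^2; q^2)_n\<close> cancel at the end.\<close>

lemma larger_parts_gf:
  assumes "n > 0"
  shows "ovp_gf (larger_parts n) * (E 2 ^ 2 * qp 1 1 (2 * n)) = E 4 * (qm 1 2 n * qp 1 1 n ^ 2)"
proof -
  have qp_set: "qp 1 1 m = (\<Prod>k\<in>{0<..m}. 1 - fps_X ^ k)" "qm 1 1 m = (\<Prod>k\<in>{0<..m}. 1 + fps_X ^ k)" for m
    unfolding qp_def qm_def by (rule prod.reindex_bij_witness[where i = "\<lambda>k. k - 1" and j = Suc], auto)+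
  have qp_set2: "qp 2 2 m = (\<Prod>k\<in>(\<lambda>k. 2 * k) ` {0<..m}. 1 - fps_X ^ k)" "qm 2 2 m = (\<Prod>k\<in>(\<lambda>k. 2 * k) ` {0<..m}. 1 + fps_X ^ k)" for m
    unfolding qp_def qm_def
    by (rule prod.reindex_bij_witness[where i = "\<lambda>k. k div 2 - 1" and j = "\<lambda>k. 2 * (k + 1)"],
        force, force, force, force, simp)+
  have fin: "ovp_gf (larger_parts n \<inter> {..2 * K}) * (qp 1 1 (2 * n) * qp 2 2 K * (qm 1 1 n * qm 2 2 n))
     = qm 1 1 (2 * n) * qm 2 2 K * (qp 1 1 n * qp 2 2 n)" if "K \<ge> n" for K
  proof -
    define A where "A = larger_parts n \<inter> {..2 * K}"
    define B where "B = (\<lambda>k. 2 * k) ` {n<..K}"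
    have A: "A = {n<..2*n} \<union> B"
    proof -
      have "x \<in> A \<longleftrightarrow> n < x \<and> x \<le> 2 * n \<or> (\<exists>k. x = 2 * k \<and> n < k \<and> k \<le> K)" for x
        using that unfolding A_def larger_parts_def by simp presburger
      then show ?thesis
        unfolding B_def by auto
    qed
    have disj: "{n<..2*n} \<inter> B = {}" by (auto simp: B_def)
    have s1: "{0<..2*n} = {0<..n} \<union> {n<..2*n}" "{0<..n} \<inter> {n<..2*n} = {}" by auto
    have s2: "(\<lambda>k. 2 * k) ` {0<..K} = (\<lambda>k. 2 * k) ` {0<..n} \<union> B" "(\<lambda>k. 2 * k) ` {0<..n} \<inter> B = {}"
    proof -
      have "{0<..K} = {0<..n} \<union> {n<..K}" using that by auto
      then show "(\<lambda>k. 2 * k) ` {0<..K} = (\<lambda>k. 2 * k) ` {0<..n} \<union> B"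
        unfolding B_def by (metis image_Un)
    qed (auto simp: B_def)
    have fB: "finite B" by (simp add: B_def)
    have sp: "qp 1 1 (2 * n) * qp 2 2 K = qp 1 1 n * qp 2 2 n * (\<Prod>k\<in>A. 1 - fps_X ^ k)"
      "qm 1 1 (2 * n) * qm 2 2 K = qm 1 1 n * qm 2 2 n * (\<Prod>k\<in>A. 1 + fps_X ^ k)"
      unfolding qp_set qp_set2 A s1(1) s2(1)
      using disj s1(2) s2(2) fB by (simp_all add: prod.union_disjoint mult_ac)
    have "ovp_gf A * (\<Prod>k\<in>A. 1 - fps_X ^ k) = (\<Prod>k\<in>A. 1 + fps_X ^ k)"
      by (rule ovp_gf_finite) (auto simp: A B_def)
    moreover have "G * (x * y * D * (u * v)) = u * v * N * (x * y)" if "G * D = N" for G x y D u v N :: "rat fps"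
      unfolding that[symmetric] by (simp only: mult_ac)
    ultimately show ?thesis
      unfolding sp A_def[symmetric] by blast
  qed
  have l1: "(\<lambda>K. ovp_gf (larger_parts n \<inter> {..2 * K})) \<longlonglongrightarrow> ovp_gf (larger_parts n)"
    by (rule tendsto_eqN_diagI, rule eqN_sym, rule eqN_mono[OF ovp_gf_trunc]) auto
  have l2: "(\<lambda>K. qm 2 2 K) \<longlonglongrightarrow> E 4 * inverse (E 2)"
  proof -
    have "(\<lambda>K. qp 4 4 K * inverse (qp 2 2 K)) \<longlonglongrightarrow> E 4 * inverse (E 2)"
      by (intro tendsto_mult_fps tendsto_inverse_fps qp_tendsto) auto
    moreover have "qp 4 4 K * inverse (qp 2 2 K) = qm 2 2 K" for K
      using qm_qp[of 2 2 K, symmetric] by (simp add: mult.assoc inverse_mult_eq_1')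
    ultimately show ?thesis by simp
  qed
  have "(\<lambda>K. ovp_gf (larger_parts n \<inter> {..2 * K}) * (qp 1 1 (2 * n) * qp 2 2 K * (qm 1 1 n * qm 2 2 n)))
     \<longlonglongrightarrow> ovp_gf (larger_parts n) * (qp 1 1 (2 * n) * E 2 * (qm 1 1 n * qm 2 2 n))"
    by (intro tendsto_mult_fps tendsto_const l1 qp_tendsto) auto
  moreover have "(\<lambda>K. ovp_gf (larger_parts n \<inter> {..2 * K}) * (qp 1 1 (2 * n) * qp 2 2 K * (qm 1 1 n * qm 2 2 n)))
     \<longlonglongrightarrow> qm 1 1 (2 * n) * (E 4 * inverse (E 2)) * (qp 1 1 n * qp 2 2 n)"
  proof (rule Lim_transform_eventually)
    show "(\<lambda>K. qm 1 1 (2 * n) * qm 2 2 K * (qp 1 1 n * qp 2 2 n)) \<longlonglongrightarrow> qm 1 1 (2 * n) * (E 4 * inverse (E 2)) * (qp 1 1 n * qp 2 2 n)"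
      by (intro tendsto_mult_fps tendsto_const l2)
    show "\<forall>\<^sub>F K in sequentially. qm 1 1 (2 * n) * qm 2 2 K * (qp 1 1 n * qp 2 2 n)
       = ovp_gf (larger_parts n \<inter> {..2 * K}) * (qp 1 1 (2 * n) * qp 2 2 K * (qm 1 1 n * qm 2 2 n))"
      using eventually_ge_at_top[of n] by eventually_elim (rule fin[symmetric])
  qed
  ultimately have eq: "ovp_gf (larger_parts n) * (qp 1 1 (2 * n) * E 2 * (qm 1 1 n * qm 2 2 n))
     = qm 1 1 (2 * n) * (E 4 * inverse (E 2)) * (qp 1 1 n * qp 2 2 n)"
    by (rule LIMSEQ_unique)
  have q1: "qp 2 2 n = qm 1 1 n * qp 1 1 n" using qm_qp[of 1 1 n] by simp
  have q2: "qm 1 1 (2 * n) = qm 1 2 n * qm 2 2 n" using qm_split2[of 1 1 n] by (simp del: One_nat_def)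
  have nz: "qm a m n \<noteq> 0" if "a > 0" for a m
  proof -
    have "fps_nth (qm a m n) 0 = 1" using that by (induction n) (auto simp: qm_Suc)
    then show ?thesis by (metis fps_zero_nth zero_neq_one)
  qed
  have "ovp_gf (larger_parts n) * (E 2 ^ 2 * qp 1 1 (2 * n)) * (qm 1 1 n * qm 2 2 n)
    = (ovp_gf (larger_parts n) * (qp 1 1 (2 * n) * E 2 * (qm 1 1 n * qm 2 2 n))) * E 2"
    by (simp add: power2_eq_square mult_ac)
  also have "\<dots> = E 4 * (qm 1 2 n * qp 1 1 n ^ 2) * (qm 1 1 n * qm 2 2 n) * (E 2 * inverse (E 2))"
    unfolding eq q1 q2 by (simp only: power2_eq_square mult_ac)
  also have "E 2 * inverse (E 2) = 1" by (simp add: inverse_mult_eq_1')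
  finally show ?thesis
    using nz by simp
qed

section \<open>Decomposition of the statistic by the smallest part\<close>

definition spt_gf :: "rat fps" where
  "spt_gf = Abs_fps (\<lambda>n. of_nat (spt_omega_bar n))"

text \<open>Contribution of the smallest part \<open>n\<close>: \<open>lambert_square n\<close> is
  the sum of \<open>m * q^(n m)\<close>, counting each multiplicity \<open>m\<close> with weight
  \<open>m\<close>. The overline on the smallest part is forced and brings no factor 2.\<close>

definition spt_term :: "nat \<Rightarrow> rat fps" where
  "spt_term n = lambert_square n * ovp_gf (larger_parts n)"

definition spt_class :: "nat \<Rightarrow> (nat multiset \<times> nat set) set" where
  "spt_class n = {(P, U). P \<noteq> {#} \<and> smallest_part P = n \<and> n \<in> U \<and> U \<subseteq> set_mset P \<and> (\<forall>k\<in>#P. odd k \<longrightarrow> k < 2 * n)}"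

lemma spt_class_bij:
  assumes "n > 0"
  shows "bij_betw (\<lambda>(m, (P, U)). (P + replicate_mset m n, insert n U)) ({0<..} \<times> ovp (larger_parts n)) (spt_class n)"
proof (rule bij_betwI[where g = "\<lambda>(P, U). (count P n, (filter_mset (\<lambda>x. x \<noteq> n) P, U - {n}))"], goal_cases)
  case 1
  have "smallest_part (P + replicate_mset m n) = n" if "set_mset P \<subseteq> larger_parts n" "m > 0" for P m
    unfolding smallest_part_def using that by (intro Min_eqI) (auto simp: larger_parts_def)
  then show ?case
    using assms by (auto simp: spt_class_def ovp_def larger_parts_def split: if_splits)
next
  case 2
  have "n \<le> k" if "smallest_part P = n" "k \<in># P" for P k
    using that unfolding smallest_part_def by (metis Min_le finite_set_mset)
  then show ?case
    by (force simp: spt_class_def ovp_def larger_parts_def)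
next
  case (3 x)
  then obtain m P U where x: "x = (m, (P, U))" by (metis prod.exhaust)
  have "n \<notin># P" "n \<notin> U"
    using 3 by (auto simp: x ovp_def larger_parts_def)
  then show ?case
    by (auto simp: x filter_neq_id count_eq_zero_iff)
next
  case (4 y)
  have "filter_mset (\<lambda>x. x \<noteq> n) P + replicate_mset (count P n) n = P" for P
    by (rule multiset_eqI) auto
  with 4 show ?case
    by (auto simp: spt_class_def)
qed

lemma spt_term_eq_gf:
  assumes "n > 0"
  shows "spt_term n = gf (spt_class n) (\<lambda>(P, U). of_nat (count P n)) wt"
proof -
  have l: "lambert_square n = gf {0<..} of_nat (\<lambda>m. n * m)"
  proof (rule fps_ext)
    fix N
    show "fps_nth (lambert_square n) N = fps_nth (gf {0<..} rat_of_nat (\<lambda>m. n * m)) N"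
    proof (cases "n dvd N \<and> N > 0")
      case True
      then have "{x \<in> {0<..}. n * x = N} = {N div n}" using assms by auto
      with True assms show ?thesis by (simp add: lambert_square_nth gf_nth)
    next
      case False
      then have "{x \<in> {0<..}. n * x = N} = {}" using assms by auto
      moreover have "(if n dvd N then rat_of_nat (N div n) else 0) = 0" using False by auto
      ultimately show ?thesis by (simp only: gf_nth lambert_square_nth[OF assms] sum.empty)
    qed
  qed
  have "ffib {0<..} (\<lambda>m. n * m)"
    unfolding ffib_def
  proof
    fix N
    have "{x \<in> {0<..}. n * x = N} \<subseteq> {..N}" using assms by auto
    then show "finite {x \<in> {0<..}. n * x = N}" by (rule finite_subset) auto
  qed
  moreover have "ffib (ovp (larger_parts n)) wt"
    by (rule ffib_wt) (auto simp: larger_parts_def)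
  ultimately have "spt_term n = gf ({0<..} \<times> ovp (larger_parts n)) (\<lambda>(m, p). of_nat m * 1) (\<lambda>(m, p). n * m + wt p)"
    unfolding spt_term_def l ovp_gf_def by (rule gf_mult)
  also have "\<dots> = gf (spt_class n) (\<lambda>(P, U). of_nat (count P n)) wt"
    by (subst gf_reindex[OF spt_class_bij[OF assms]])
       (auto simp: wt_def ovp_def larger_parts_def not_in_iff subset_iff intro!: gf_cong)
  finally show ?thesis .
qed

lemma spt_gf_eqN: "eqN (Suc M) spt_gf (\<Sum>n\<in>{0<..M}. spt_term n)"
  unfolding eqN_def
proof (intro allI impI)
  fix N assume N: "N < Suc M"
  have "fps_nth spt_gf N = (\<Sum>p\<in>spt_omega_overpartitions N. rat_of_nat (count (fst p) (smallest_part (fst p))))"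
    by (simp add: spt_gf_def spt_omega_bar_def case_prod_unfold)
  also have "\<dots> = (\<Sum>n\<in>{0<..M}. \<Sum>p\<in>{p \<in> spt_omega_overpartitions N. smallest_part (fst p) = n}.
       rat_of_nat (count (fst p) (smallest_part (fst p))))"
  proof (rule sum.group[symmetric])
    show "(\<lambda>p. smallest_part (fst p)) ` spt_omega_overpartitions N \<subseteq> {0<..M}"
    proof
      fix n assume "n \<in> (\<lambda>p. smallest_part (fst p)) ` spt_omega_overpartitions N"
      then obtain P U where P: "(P, U) \<in> overpartitions N" "n = smallest_part P" "n \<in> U"
        by (auto simp: spt_omega_overpartitions_def)
      then have "n \<in># P" "0 \<notin># P" "\<Sum>\<^sub># P = N" by (auto simp: overpartitions_def)
      moreover from this have "n \<le> N" by (metis le_add1 multi_member_split sum_mset.add_mset)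
      ultimately show "n \<in> {0<..M}" using N by (cases n) auto
    qed
  qed (auto simp: finite_spt_omega_overpartitions)
  also have "\<dots> = (\<Sum>n\<in>{0<..M}. fps_nth (spt_term n) N)"
  proof (rule sum.cong)
    fix n assume n: "n \<in> {0<..M}"
    have "{p \<in> spt_omega_overpartitions N. smallest_part (fst p) = n} = {p \<in> spt_class n. wt p = N}"
    proof -
      have "0 \<notin># P" if "smallest_part P = n" for P
        using that n unfolding smallest_part_def by (metis Min_le finite_set_mset greaterThanAtMost_iff not_less)
      then show ?thesis
        by (auto simp: spt_omega_overpartitions_def overpartitions_def spt_class_def wt_def)
    qed
    moreover have "\<And>p. p \<in> spt_class n \<Longrightarrow> smallest_part (fst p) = n" by (auto simp: spt_class_def)
    ultimately show "(\<Sum>p\<in>{p \<in> spt_omega_overpartitions N. smallest_part (fst p) = n}.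
       rat_of_nat (count (fst p) (smallest_part (fst p)))) = fps_nth (spt_term n) N"
      using n by (simp add: spt_term_eq_gf gf_nth case_prod_unfold)
  qed simp
  finally show "fps_nth spt_gf N = fps_nth (\<Sum>n\<in>{0<..M}. spt_term n) N"
    by (simp add: fps_sum_nth)
qed

section \<open>Extraction of exponents in an arithmetic progression\<close>

definition sec :: "nat \<Rightarrow> nat \<Rightarrow> rat fps \<Rightarrow> rat fps" where
  "sec m r F = Abs_fps (\<lambda>n. fps_nth F (m * n + r))"

lemma sec_nth [simp]: "fps_nth (sec m r F) n = fps_nth F (m * n + r)"
  by (simp add: sec_def)

lemma sec_dil_mult:
  assumes "r < m"
  shows "sec m r (dil m F * G) = F * sec m r G"
proof (rule fps_ext)
  fix n
  have "fps_nth (dil m F * G) (m * n + r) = (\<Sum>i\<in>{0..m * n + r}. if m dvd i then fps_nth F (i div m) * fps_nth G (m * n + r - i) else 0)"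
    unfolding fps_mult_nth by (intro sum.cong) (auto simp: dil_nth)
  also have "\<dots> = (\<Sum>i\<in>{i\<in>{0..m * n + r}. m dvd i}. fps_nth F (i div m) * fps_nth G (m * n + r - i))"
    by (rule sum.inter_filter[symmetric]) simp
  also have "\<dots> = (\<Sum>j\<in>{0..n}. fps_nth F j * fps_nth G (m * (n - j) + r))"
  proof (rule sum.reindex_bij_witness[where i = "\<lambda>j. m * j" and j = "\<lambda>i. i div m"])
    fix i assume i: "i \<in> {i\<in>{0..m * n + r}. m dvd i}"
    then obtain j where j: "i = m * j" by auto
    have "j \<le> n"
    proof (rule ccontr)
      assume "\<not> j \<le> n"
      then have "m * (n + 1) \<le> m * j" by (intro mult_le_mono) auto
      with i j assms show False by auto
    qed
    with assms j show "m * (i div m) = i" "i div m \<in> {0..n}"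
      "fps_nth F (i div m) * fps_nth G (m * (n - i div m) + r) = fps_nth F (i div m) * fps_nth G (m * n + r - i)"
      by (auto simp: diff_mult_distrib2)
  qed (use assms in \<open>auto intro: trans_le_add1\<close>)
  finally show "fps_nth (sec m r (dil m F * G)) n = fps_nth (F * sec m r G) n"
    by (simp add: fps_mult_nth)
qed

section \<open>Telescoping of the Bailey-type sum\<close>

abbreviation qf :: "nat \<Rightarrow> rat fps" where "qf n \<equiv> qp 1 1 n"

lemma qf_Suc: "qf (Suc n) = qf n * (1 - fps_X ^ Suc n)"
  by (simp add: qp_Suc)

lemma qf_inv: "qf n * inverse (qf n) = 1"
  by (intro inverse_mult_eq_1') simp

definition tele_term :: "nat \<Rightarrow> nat \<Rightarrow> rat fps" where
  "tele_term n r = fps_X ^ n * qf (n - 1) ^ 2 * inverse (qf (n - r) * qf (n + r))"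

text \<open>The value 0 for \<open>r > n\<close> is the convention that a Pochhammer symbol of
  negative length has reciprocal 0; with it \<open>tele_step\<close> also covers the first index
  \<open>Suc n = r\<close>.\<close>

definition tele :: "nat \<Rightarrow> nat \<Rightarrow> rat fps" where
  "tele n r = (if r \<le> n then qf n ^ 2 * inverse (qf (n - r) * qf (n + r)) else 0)"

lemma mult_inverse_cancel:
  fixes f g :: "rat fps"
  assumes "f = g * u" "fps_nth u 0 \<noteq> 0"
  shows "f * inverse u = g"
  using assms by (simp add: mult.assoc inverse_mult_eq_1')

text \<open>With \<open>x = q^r\<close> and \<open>y = q^d\<close>, where
  \<open>Suc n = r + d\<close>, everything reduces to
  \<open>(1 - x * y)^2 - (1 - y) * (1 - x^2 * y) = y * (1 - x)^2\<close>.\<close>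

lemma tele_step:
  assumes "r > 0" "r \<le> Suc n"
  shows "tele_term (Suc n) r = lambert_square r * (tele (Suc n) r - tele n r)"
proof -
  obtain d where d: "Suc n = r + d" using assms(2) le_Suc_ex by blast
  define x y :: "rat fps" where "x = fps_X ^ r" and "y = fps_X ^ d"
  define D where "D = qf (Suc n - r) * qf (Suc n + r)"
  have D0: "fps_nth D 0 \<noteq> 0" by (simp add: D_def)
  have X: "fps_X ^ Suc n = x * y" by (simp add: d x_def y_def power_add)
  have t1: "tele n r * D = qf n ^ 2 * ((1 - y) * (1 - x * (x * y)))"
  proof (cases "r \<le> n")
    case True
    then obtain e where e: "d = Suc e" using d by (cases d) auto
    have "D = qf (n - r) * (1 - y) * (qf (n + r) * (1 - x * (x * y)))"
    proof -
      have 1: "Suc n - r = Suc (n - r)" and 2: "Suc (n - r) = d" using True d by auto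
      have "Suc (n + r) = r + (r + d)" using d by simp
      then have 3: "fps_X ^ Suc (n + r) = x * (x * y)" by (simp only: x_def y_def power_add)
      have 4: "fps_X ^ Suc (n - r) = y" by (simp only: 2 y_def)
      show ?thesis
        by (simp only: D_def 1 add_Suc qf_Suc 3 4)
    qed
    then have "tele n r * D = qf n ^ 2 * ((1 - y) * (1 - x * (x * y))) * ((qf (n - r) * qf (n + r)) * inverse (qf (n - r) * qf (n + r)))"
      using True by (simp only: tele_def if_True mult_ac)
    also have "(qf (n - r) * qf (n + r)) * inverse (qf (n - r) * qf (n + r)) = 1"
      by (intro inverse_mult_eq_1') simp
    finally show ?thesis by simp
  next
    case False
    with assms d have "d = 0" by auto
    with False show ?thesis by (simp add: tele_def y_def)
  qed
  have t2: "tele (Suc n) r * D = qf n ^ 2 * (1 - x * y) ^ 2"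
  proof -
    have "tele (Suc n) r * D = qf (Suc n) ^ 2 * (D * inverse D)"
      using assms by (simp add: tele_def D_def mult_ac)
    moreover have "qf (Suc n) = qf n * (1 - x * y)"
      by (simp only: qf_Suc X)
    ultimately show ?thesis
      by (simp only: inverse_mult_eq_1'[OF D0] power_mult_distrib mult_1_right)
  qed
  have "fps_X ^ r * (tele (Suc n) r - tele n r) * D = x * (tele (Suc n) r * D - tele n r * D)"
    by (simp add: x_def algebra_simps)
  also have "\<dots> = x * (qf n ^ 2 * (1 - x * y) ^ 2 - qf n ^ 2 * ((1 - y) * (1 - x * (x * y))))"
    unfolding t1 t2 ..
  also have "\<dots> = x * y * qf n ^ 2 * (1 - x) ^ 2"
    by (simp add: power2_eq_square algebra_simps)
  also have "\<dots> = tele_term (Suc n) r * (1 - x) ^ 2 * D"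
  proof -
    have "tele_term (Suc n) r * (1 - x) ^ 2 * D = x * y * qf n ^ 2 * (1 - x) ^ 2 * (D * inverse D)"
      unfolding tele_term_def X D_def[symmetric] by (simp add: mult_ac)
    then show ?thesis unfolding inverse_mult_eq_1'[OF D0] by (simp only: mult_1_right)
  qed
  finally have "fps_X ^ r * (tele (Suc n) r - tele n r) = tele_term (Suc n) r * (1 - x) ^ 2"
    using D0 by auto
  then have "fps_X ^ r * (tele (Suc n) r - tele n r) * inverse ((1 - x) ^ 2) = tele_term (Suc n) r"
    using assms(1) by (intro mult_inverse_cancel) (auto simp: x_def)
  then show ?thesis
    by (simp add: x_def mult_ac)
qed

lemma tele_eqN: "r \<le> M \<Longrightarrow> eqN (Suc (M - r)) (tele M r) 1"
proof (rule eqN_cancel[where u = "qf (M - r) * qf (M + r)"])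
  assume r: "r \<le> M"
  have "tele M r * (qf (M - r) * qf (M + r)) = qf M ^ 2 * ((qf (M - r) * qf (M + r)) * inverse (qf (M - r) * qf (M + r)))"
    using r by (simp add: tele_def mult_ac)
  also have "(qf (M - r) * qf (M + r)) * inverse (qf (M - r) * qf (M + r)) = 1"
    by (intro inverse_mult_eq_1') simp
  finally have eq: "tele M r * (qf (M - r) * qf (M + r)) = qf M * qf M"
    by (simp add: power2_eq_square)
  have "eqN (Suc (M - r)) (qf M * qf M) (E 1 * E 1)"
    by (intro eqN_mult qp_eqN_E) auto
  also have "eqN (Suc (M - r)) (E 1 * E 1) (qf (M - r) * qf (M + r))"
    by (rule eqN_sym, intro eqN_mult qp_eqN_E) auto
  finally show "eqN (Suc (M - r)) (tele M r * (qf (M - r) * qf (M + r))) (1 * (qf (M - r) * qf (M + r)))"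
    unfolding eq by simp
qed simp

lemma sum_symmetric:
  fixes g :: "nat \<Rightarrow> rat fps"
  shows "(\<Sum>k\<le>2*n. g k) = g n + (\<Sum>r\<in>{0<..n}. g (n + r) + g (n - r))"
proof -
  have "{..2*n} = {..<n} \<union> ({n} \<union> {n<..2*n})" by auto
  then have "(\<Sum>k\<le>2*n. g k) = (\<Sum>k<n. g k) + (g n + (\<Sum>k\<in>{n<..2*n}. g k))"
    by (simp only:) (subst sum.union_disjoint, auto)
  moreover have "(\<Sum>k<n. g k) = (\<Sum>r\<in>{0<..n}. g (n - r))"
    by (rule sum.reindex_bij_witness[where i = "\<lambda>r. n - r" and j = "\<lambda>k. n - k"]) auto
  moreover have "(\<Sum>k\<in>{n<..2*n}. g k) = (\<Sum>r\<in>{0<..n}. g (n + r))"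
    by (rule sum.reindex_bij_witness[where i = "\<lambda>r. n + r" and j = "\<lambda>k. k - n"]) auto
  ultimately show ?thesis
    by (simp add: sum.distrib algebra_simps)
qed

definition tau :: "nat \<Rightarrow> rat fps" where
  "tau n = fps_X ^ n * qf (n - 1) ^ 2 * qm 1 2 n * inverse (qf (2 * n))"

lemma spt_term_tau:
  assumes "n > 0"
  shows "spt_term n * E 2 ^ 2 = E 4 * tau n"
proof -
  obtain j where j: "n = Suc j" using assms by (cases n) auto
  have u: "(1 - fps_X ^ n) ^ 2 * inverse ((1 - fps_X ^ n) ^ 2) = (1 :: rat fps)"
    using assms by (intro inverse_mult_eq_1') simp
  have "spt_term n * E 2 ^ 2 * qf (2 * n)
    = lambert_square n * (ovp_gf (larger_parts n) * (E 2 ^ 2 * qf (2 * n)))"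
    by (simp only: spt_term_def mult_ac)
  also have "\<dots> = E 4 * (fps_X ^ n * qf j ^ 2 * qm 1 2 n) * ((1 - fps_X ^ n) ^ 2 * inverse ((1 - fps_X ^ n) ^ 2))"
    unfolding larger_parts_gf[OF assms] unfolding j qf_Suc by (simp only: power_mult_distrib mult_ac)
  finally have "spt_term n * E 2 ^ 2 * qf (2 * n) = E 4 * (fps_X ^ n * qf j ^ 2 * qm 1 2 n)"
    unfolding u by simp
  then have "E 4 * (fps_X ^ n * qf j ^ 2 * qm 1 2 n) * inverse (qf (2 * n)) = spt_term n * E 2 ^ 2"
    by (intro mult_inverse_cancel) auto
  then show ?thesis
    by (simp add: tau_def j mult.assoc)
qed

lemma alpha_minus: "alpha (- j) = alpha j"
proof (cases "even j")
  case True
  then obtain r where "j = 2 * r" by (rule evenE)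
  then show ?thesis
    using alpha_double[of r] alpha_double[of "- r"] by (simp add: sg_def)
qed (simp add: alpha_def)

text \<open>Division by \<open>(q; q)_(2 n)\<close> turns the binomial in the expansion of
  \<open>(-q; q^2)_n\<close> into the reciprocal of \<open>qf k * qf (2 * n - k)\<close>. The
  central term is the Lambert term, and the terms at \<open>n + r\<close> and \<open>n - r\<close>
  agree because \<open>alpha\<close> is even.\<close>

lemma tau_expand:
  assumes "n > 0"
  shows "tau n = lambert_square n + 2 * (\<Sum>r\<in>{0<..n}. alpha (int r) * tele_term n r)"
proof -
  define g where "g = (\<lambda>k. alpha (int k - int n) * (fps_X ^ n * qf (n - 1) ^ 2 * inverse (qf k * qf (2 * n - k))))"
  have "tau n = fps_X ^ n * qf (n - 1) ^ 2 * inverse (qf (2 * n)) * (\<Sum>k\<le>2*n. qbin fps_X (2*n) k * alpha (int k - int n))"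
    unfolding finite_alpha_sum tau_def by (simp only: mult_ac)
  also have "\<dots> = (\<Sum>k\<le>2*n. g k)"
    unfolding sum_distrib_left
  proof (rule sum.cong)
    fix k assume "k \<in> {..2*n}"
    then have "qbin fps_X (2*n) k * (qf k * qf (2*n-k)) = qf (2*n)"
      using qbin_qp[of k "2*n" 1] by (simp add: mult.assoc)
    then have q: "qf (2*n) * inverse (qf k * qf (2*n-k)) = qbin fps_X (2*n) k"
      by (intro mult_inverse_cancel) auto
    have "qbin fps_X (2*n) k * inverse (qf (2*n)) = inverse (qf k * qf (2*n-k)) * (qf (2*n) * inverse (qf (2*n)))"
      unfolding q[symmetric] by (simp only: mult_ac)
    then have q': "inverse (qf k * qf (2*n-k)) = qbin fps_X (2*n) k * inverse (qf (2*n))"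
      by (simp only: qf_inv mult_1_right)
    show "fps_X ^ n * qf (n - 1) ^ 2 * inverse (qf (2 * n)) * (qbin fps_X (2*n) k * alpha (int k - int n)) = g k"
      unfolding g_def q' by (simp only: mult_ac)
  qed simp
  also have "\<dots> = g n + (\<Sum>r\<in>{0<..n}. g (n + r) + g (n - r))"
    by (rule sum_symmetric)
  also have "(\<Sum>r\<in>{0<..n}. g (n + r) + g (n - r)) = 2 * (\<Sum>r\<in>{0<..n}. alpha (int r) * tele_term n r)"
    unfolding sum_distrib_left
  proof (rule sum.cong)
    fix r assume r: "r \<in> {0<..n}"
    then have "int (n - r) - int n = - int r" "2 * n - (n + r) = n - r" "2 * n - (n - r) = n + r" by auto
    then show "g (n + r) + g (n - r) = 2 * (alpha (int r) * tele_term n r)"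
      by (simp add: g_def tele_term_def alpha_minus mult_ac)
  qed simp
  also have "g n = lambert_square n"
  proof -
    obtain j where j: "n = Suc j" using assms by (cases n) auto
    have "g n = fps_X ^ n * (qf j ^ 2 * inverse (qf j ^ 2 * (1 - fps_X ^ n) ^ 2))"
    proof -
      have "qf n * qf n = qf j ^ 2 * (1 - fps_X ^ n) ^ 2"
        unfolding j qf_Suc by (simp only: power2_eq_square mult_ac)
      moreover have "g n = fps_X ^ n * (qf j ^ 2 * inverse (qf n * qf n))"
        by (simp add: g_def alpha_def sg_def j mult_ac mult_2)
      ultimately show ?thesis by simp
    qed
    also have "qf j ^ 2 * inverse (qf j ^ 2 * (1 - fps_X ^ n) ^ 2)
       = (qf j ^ 2 * inverse (qf j ^ 2)) * inverse ((1 - fps_X ^ n) ^ 2)"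
      by (simp add: fps_inverse_mult mult.assoc)
    also have "qf j ^ 2 * inverse (qf j ^ 2) = 1"
      by (intro inverse_mult_eq_1') simp
    finally show ?thesis by simp
  qed
  finally show ?thesis .
qed

lemma tau_sum:
  "(\<Sum>n\<in>{0<..M}. tau n) = (\<Sum>n\<in>{0<..M}. lambert_square n)
     + 2 * (\<Sum>r\<in>{0<..M}. alpha (int r) * lambert_square r * tele M r)"
proof (induction M)
  case (Suc M)
  define w where "w = (\<lambda>r. alpha (int r) * lambert_square r)"
  have IH: "(\<Sum>n\<in>{0<..M}. tau n) = (\<Sum>n\<in>{0<..M}. lambert_square n)
      + 2 * (\<Sum>r\<in>{0<..M}. w r * tele M r)"
    using Suc unfolding w_def .
  have ins: "{0<..Suc M} = insert (Suc M) {0<..M}" by auto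
  have "(\<Sum>r\<in>{0<..Suc M}. alpha (int r) * tele_term (Suc M) r) = (\<Sum>r\<in>{0<..Suc M}. w r * tele (Suc M) r - w r * tele M r)"
    by (intro sum.cong) (auto simp: tele_step w_def algebra_simps)
  also have "\<dots> = (\<Sum>r\<in>{0<..Suc M}. w r * tele (Suc M) r) - (\<Sum>r\<in>{0<..Suc M}. w r * tele M r)"
    by (rule sum_subtractf)
  also have "(\<Sum>r\<in>{0<..Suc M}. w r * tele M r) = (\<Sum>r\<in>{0<..M}. w r * tele M r)"
    unfolding ins by (simp add: tele_def)
  finally have *: "(\<Sum>r\<in>{0<..Suc M}. alpha (int r) * tele_term (Suc M) r)
     = (\<Sum>r\<in>{0<..Suc M}. w r * tele (Suc M) r) - (\<Sum>r\<in>{0<..M}. w r * tele M r)" .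
  have "(\<Sum>n\<in>{0<..Suc M}. tau n) = tau (Suc M) + (\<Sum>n\<in>{0<..M}. tau n)"
    unfolding ins by simp
  also have "\<dots> = lambert_square (Suc M) + (\<Sum>n\<in>{0<..M}. lambert_square n)
     + 2 * (\<Sum>r\<in>{0<..Suc M}. w r * tele (Suc M) r)"
    unfolding tau_expand[OF zero_less_Suc] * IH by (simp add: algebra_simps)
  also have "lambert_square (Suc M) + (\<Sum>n\<in>{0<..M}. lambert_square n)
     = (\<Sum>n\<in>{0<..Suc M}. lambert_square n :: rat fps)"
    unfolding ins by simp
  finally show ?case
    unfolding w_def .
qed simp

text \<open>\<open>alpha r\<close> vanishes for odd \<open>r\<close>; for \<open>r = 2 * s\<close>
  its exponent \<open>2 * s^2\<close> and all exponents of \<open>lambert_square r\<close> are even.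
  The factor \<open>tele M r\<close> need not be even, but it is 1 below order
  \<open>M - r + 1\<close> and multiplies a series of order at least \<open>r\<close>, so it has no
  effect up to q^M.\<close>

lemma tau_sum_odd_nth:
  assumes "odd N" "N \<le> M"
  shows "fps_nth (\<Sum>n\<in>{0<..M}. tau n) N = fps_nth sigma_odd N"
proof -
  have N0: "N > 0" using assms(1) by (auto intro: Nat.gr0I)
  have z: "fps_nth (alpha (int r) * lambert_square r * tele M r) N = 0" if r: "r \<in> {0<..M}" for r
  proof (cases "even r")
    case False
    then show ?thesis by (simp add: alpha_def)
  next
    case True
    then obtain s where s: "r = 2 * s" by auto
    have low: "eqN (Suc (M - r) + r) (alpha (int r) * lambert_square r * tele M r)
        (alpha (int r) * lambert_square r * 1)"
    proof (rule eqN_mult_low)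
      show "eqN (Suc (M - r)) (tele M r) 1" using r by (intro tele_eqN) auto
      show "fps_nth (alpha (int r) * lambert_square r) i = 0" if "i < r" for i
        using that unfolding mult.left_commute[of "alpha (int r)" "fps_X ^ r"] by (simp add: fps_X_power_mult_nth)
    qed
    have al: "alpha (int r) = fps_const (sg (- 1) (int s)) * fps_X ^ (2 * s\<^sup>2)"
    proof -
      have "nat (2 * (int s)\<^sup>2) = 2 * s\<^sup>2" by (simp add: nat_mult_distrib nat_power_eq)
      then show ?thesis using alpha_double[of "int s"] by (simp add: s)
    qed
    from low have "fps_nth (alpha (int r) * lambert_square r * tele M r) N
       = fps_nth (alpha (int r) * lambert_square r) N"
      using r assms(2) by (auto simp: eqN_def)
    also have "fps_nth (alpha (int r) * lambert_square r) N
       = sg (- 1) (int s) * (if N < 2 * s\<^sup>2 then 0 else fps_nth (lambert_square r) (N - 2 * s\<^sup>2))"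
      by (simp only: al mult.assoc fps_mult_left_const_nth fps_X_power_mult_nth)
    also have "\<dots> = 0"
    proof (cases "N < 2 * s\<^sup>2")
      case False
      then have "odd (N - 2 * s\<^sup>2)" using assms(1) by simp
      then have "\<not> r dvd N - 2 * s\<^sup>2" unfolding s by (metis dvd_mult_left)
      then show ?thesis using r by (simp add: lambert_square_nth)
    qed simp
    finally show ?thesis .
  qed
  have "fps_nth (\<Sum>n\<in>{0<..M}. tau n) N = (\<Sum>n\<in>{0<..M}. fps_nth (lambert_square n) N)"
    unfolding tau_sum using z by (simp add: fps_sum_nth numeral_fps_const)
  also have "\<dots> = (\<Sum>n\<in>{0<..M}. if n dvd N then rat_of_nat (N div n) else 0)"
    by (intro sum.cong) (auto simp: lambert_square_nth)
  also have "\<dots> = (\<Sum>n\<in>{n\<in>{0<..M}. n dvd N}. rat_of_nat (N div n))"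
    by (rule sum.inter_filter[symmetric]) simp
  also have "\<dots> = (\<Sum>d | d dvd N. rat_of_nat d)"
  proof (rule sum.reindex_bij_witness[where i = "\<lambda>d. N div d" and j = "\<lambda>d. N div d"])
    have *: "N div (N div d) = d" "N div d dvd N" "0 < N div d" "N div d \<le> M" if d: "d dvd N" for d
    proof -
      obtain e where e: "N = d * e" using d by (rule dvdE)
      then have "d > 0" "e > 0" "N div d = e" "N div e = d" using N0 by auto
      moreover have "e \<le> M" using e N0 assms(2) by (metis dvd_imp_le dvd_triv_right order_trans)
      ultimately show "N div (N div d) = d" "N div d dvd N" "0 < N div d" "N div d \<le> M"
        using e by auto
    qed
    then show "N div (N div d) = d" "N div d \<in> {d. d dvd N}" "rat_of_nat (N div d) = rat_of_nat (N div d)"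
      if "d \<in> {n \<in> {0<..M}. n dvd N}" for d
      using that by auto
    show "N div (N div d) = d" "N div d \<in> {n \<in> {0<..M}. n dvd N}" if "d \<in> {d. d dvd N}" for d
      using that * by auto
  qed
  also have "\<dots> = fps_nth sigma_odd N"
    using assms(1) by (simp add: sigma_odd_def)
  finally show ?thesis .
qed

theorem spt_odd_gf: "sec 2 1 spt_gf * E 1 ^ 6 = E 2 ^ 9"
proof -
  \<comment> \<open>The infinite sum of all \<open>tau n\<close>. The factor removed is a series in
    q^2, hence it passes through the section of odd exponents.\<close>
  define T where "T = spt_gf * E 2 ^ 2 * inverse (E 4)"
  have T4: "spt_gf * E 2 ^ 2 = T * E 4"
    by (simp add: T_def mult.assoc inverse_mult_eq_1)
  have T: "eqN (Suc M) T (\<Sum>n\<in>{0<..M}. tau n)" for M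
  proof (rule eqN_cancel)
    have "eqN (Suc M) (spt_gf * E 2 ^ 2) ((\<Sum>n\<in>{0<..M}. spt_term n) * E 2 ^ 2)"
      by (intro eqN_mult spt_gf_eqN) auto
    also have "(\<Sum>n\<in>{0<..M}. spt_term n) * E 2 ^ 2 = (\<Sum>n\<in>{0<..M}. tau n) * E 4"
      unfolding sum_distrib_right by (intro sum.cong) (auto simp: spt_term_tau mult.commute)
    finally show "eqN (Suc M) (T * E 4) ((\<Sum>n\<in>{0<..M}. tau n) * E 4)"
      unfolding T4 .
  qed simp
  have "fps_nth T N = fps_nth sigma_odd N" if "odd N" for N
    using T[of N] tau_sum_odd_nth[OF that order_refl] by (auto simp: eqN_def)
  then have secT: "sec 2 1 T = sec 2 1 sigma_odd"
    by (intro fps_ext) simp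
  have d: "dil 2 (E 1 ^ 2) = E 2 ^ 2" "dil 2 (E 1 ^ 4) = E 2 ^ 4" "dil 2 (E 2) = E 4" "dil 2 (E 2 ^ 8) = E 4 ^ 8"
    by (simp_all add: dil_power dil_E)
  have "sec 2 1 spt_gf * E 1 ^ 2 = sec 2 1 (dil 2 (E 1 ^ 2) * spt_gf)"
    by (subst sec_dil_mult) (auto simp: mult.commute)
  also have "\<dots> = sec 2 1 (dil 2 (E 2) * T)"
    unfolding d using T4 by (simp add: mult.commute)
  also have "\<dots> = E 2 * sec 2 1 sigma_odd"
    using sec_dil_mult[of 1 2 "E 2" T] secT by (simp del: One_nat_def)
  finally have 1: "sec 2 1 spt_gf * E 1 ^ 2 = E 2 * sec 2 1 sigma_odd" .
  have "sec 2 1 sigma_odd * E 1 ^ 4 = sec 2 1 (dil 2 (E 1 ^ 4) * sigma_odd)"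
    by (subst sec_dil_mult) (auto simp: mult.commute)
  also have "\<dots> = sec 2 1 (dil 2 (E 2 ^ 8) * fps_X)"
    unfolding d using sigma_odd_prod by (simp add: mult.commute)
  also have "\<dots> = E 2 ^ 8 * sec 2 1 fps_X"
    by (rule sec_dil_mult) simp
  also have "sec 2 1 fps_X = 1"
    by (rule fps_ext) (auto simp: fps_X_def)
  finally have 2: "sec 2 1 sigma_odd * E 1 ^ 4 = E 2 ^ 8" by simp
  have "sec 2 1 spt_gf * E 1 ^ 6 = (sec 2 1 spt_gf * E 1 ^ 2) * E 1 ^ 4"
    by (simp add: mult.assoc flip: power_add)
  also have "\<dots> = E 2 * (sec 2 1 sigma_odd * E 1 ^ 4)"
    unfolding 1 by (simp add: mult.assoc)
  also have "\<dots> = E 2 ^ 9"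
    unfolding 2 by (simp flip: power_Suc)
  finally show ?thesis .
qed

section \<open>Sections of theta series modulo 5\<close>

text \<open>The indices are written \<open>c - 5 * i\<close>, with a minus sign, because the classes
  1 and 2 that matter below then have exponents of the form \<open>tri m a i\<close> again without a
  reflection.\<close>

lemma gf_split5:
  fixes e :: "int \<Rightarrow> nat"
  assumes "ffib UNIV e"
  shows "gf UNIV w e = gf UNIV (\<lambda>i. w (- 5 * i)) (\<lambda>i. e (- 5 * i))
    + gf UNIV (\<lambda>i. w (1 - 5 * i)) (\<lambda>i. e (1 - 5 * i)) + gf UNIV (\<lambda>i. w (- 1 - 5 * i)) (\<lambda>i. e (- 1 - 5 * i))
    + gf UNIV (\<lambda>i. w (2 - 5 * i)) (\<lambda>i. e (2 - 5 * i)) + gf UNIV (\<lambda>i. w (- 2 - 5 * i)) (\<lambda>i. e (- 2 - 5 * i))"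
proof -
  define R where "R = (\<lambda>c :: int. {j. j mod 5 = c mod 5})"
  have ff: "ffib A e" for A
    by (rule ffib_subset[OF assms]) simp
  have cls: "gf (R c) w e = gf UNIV (\<lambda>i. w (c - 5 * i)) (\<lambda>i. e (c - 5 * i))" for c
  proof (rule gf_reindex, rule bij_betwI[where g = "\<lambda>j. (c - j) div 5"])
    fix j assume "j \<in> R c"
    then have "5 dvd c - j" unfolding R_def by (metis (mono_tags) mem_Collect_eq mod_eq_dvd_iff)
    then show "c - 5 * ((c - j) div 5) = j" by simp
  qed (auto simp: R_def mod_diff_eq[symmetric, of c "5 * _"])
  have U: "UNIV = R 0 \<union> (R 1 \<union> (R (- 1) \<union> (R 2 \<union> R (- 2))))"
    by (auto simp: R_def)
  have "gf UNIV w e = gf (R 0) w e + (gf (R 1) w e + (gf (R (- 1)) w e + (gf (R 2) w e + gf (R (- 2)) w e)))"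
    by (subst U, subst gf_Un[OF ff ff], force simp: R_def, subst gf_Un[OF ff ff], force simp: R_def,
        subst gf_Un[OF ff ff], force simp: R_def, subst gf_Un[OF ff ff], force simp: R_def, simp)
  then show ?thesis
    by (simp add: cls add.assoc)
qed

definition fgr :: "nat \<Rightarrow> rat fps \<Rightarrow> bool" where
  "fgr j F \<longleftrightarrow> (\<forall>n. fps_nth F n \<noteq> 0 \<longrightarrow> n mod 5 = j)"

lemma fgr_gf:
  assumes "\<And>x. x \<in> A \<Longrightarrow> e x mod 5 = j"
  shows "fgr j (gf A w e)"
  unfolding fgr_def
proof (intro allI impI, rule ccontr)
  fix n assume *: "fps_nth (gf A w e) n \<noteq> 0" "n mod 5 \<noteq> j"
  then have "{x \<in> A. e x = n} = {}" using assms by blast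
  with *(1) show False by (simp only: gf_nth sum.empty)
qed

lemma fgr_add: "fgr j F \<Longrightarrow> fgr j G \<Longrightarrow> fgr j (F + G)"
  unfolding fgr_def fps_add_nth by (metis add.right_neutral)

lemma tri_mod5:
  assumes "a \<le> m" "m > 0" "int m * (j * (j - 1)) + 2 * int a * j = 2 * int c + 5 * M" "c < 5"
  shows "tri m a j mod 5 = c"
proof -
  have "2 * int (tri m a j) = 2 * int c + 5 * M"
    using int_tri[OF assms(1,2), of j] assms(3) by simp
  moreover from this have "even (5 * M)" by (metis dvd_triv_left dvd_add_right_iff)
  then obtain N where "M = 2 * N" by auto
  ultimately have "int (tri m a j) = int c + 5 * N" by simp
  then have "int (tri m a j) mod 5 = int c" using assms(4) by simp
  then show ?thesis by (metis of_nat_eq_iff of_nat_mod of_nat_numeral)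
qed

lemma tri_eqI:
  assumes "a \<le> m" "m > 0" "int m * (j * (j - 1)) + 2 * int a * j = 2 * int n"
  shows "tri m a j = n"
  using int_tri[OF assms(1,2), of j] assms(3) by simp

text \<open>Generalised pentagonal numbers are 0, 1 or 2 modulo 5, and the class of 1 comes from the
  indices \<open>1 - 5 * i\<close> alone, where the series reproduces itself at q^25 with opposite
  sign. The outer parts are kept only through their grades.\<close>

lemma E1_dissection:
  obtains A0 A2 where "E 1 = A0 - fps_X * E 25 + A2" "fgr 0 A0" "fgr 2 A2"
proof
  let ?g = "\<lambda>c. gf UNIV (\<lambda>i. sg (- 1) (c - 5 * i)) (\<lambda>i. tri 3 1 (c - 5 * i))"
  have "?g 1 = gf UNIV (\<lambda>i. (- 1) * sg (- 1) i) (\<lambda>i. 25 * tri 3 1 i + 1)"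
  proof (rule gf_cong)
    fix i :: int
    show "tri 3 1 (1 - 5 * i) = 25 * tri 3 1 i + 1"
      using int_tri[of 1 3 i] by (intro tri_eqI) (simp_all add: algebra_simps)
  qed (auto simp: sg_def)
  also have "\<dots> = - (fps_X * dil 25 (E 1))"
    unfolding gf_scale gf_shift pentagonal[symmetric] by (simp add: dil_gf flip: fps_const_neg)
  finally have 1: "?g 1 = - (fps_X * E 25)"
    by (simp add: dil_E)
  have "E 1 = theta 3 1"
    by (rule pentagonal[symmetric])
  also have "\<dots> = ?g 0 + ?g 1 + ?g (- 1) + ?g 2 + ?g (- 2)"
    by (subst gf_split5) (simp_all add: ffib_tri)
  finally show "E 1 = (?g 0 + ?g 2) - fps_X * E 25 + (?g (- 1) + ?g (- 2))"
    unfolding 1 by simp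
  show "fgr 0 (?g 0 + ?g 2)"
  proof (intro fgr_add fgr_gf)
    fix i :: int
    show "tri 3 1 (0 - 5 * i) mod 5 = 0"
      by (rule tri_mod5[where M = "15 * i\<^sup>2 + i"]) (simp_all add: power2_eq_square algebra_simps)
    show "tri 3 1 (2 - 5 * i) mod 5 = 0"
      by (rule tri_mod5[where M = "2 + 15 * i\<^sup>2 - 11 * i"]) (simp_all add: power2_eq_square algebra_simps)
  qed
  show "fgr 2 (?g (- 1) + ?g (- 2))"
  proof (intro fgr_add fgr_gf)
    fix i :: int
    show "tri 3 1 (- 1 - 5 * i) mod 5 = 2"
      by (rule tri_mod5[where M = "15 * i\<^sup>2 + 7 * i"]) (simp_all add: power2_eq_square algebra_simps)
    show "tri 3 1 (- 2 - 5 * i) mod 5 = 2"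
      by (rule tri_mod5[where M = "2 + 15 * i\<^sup>2 + 13 * i"]) (simp_all add: power2_eq_square algebra_simps)
  qed
qed

text \<open>Squares are 0, 1 or 4 modulo 5. The classes \<open>c\<close> and \<open>- c\<close> of
  indices contribute equally, whence the factors 2.\<close>

lemma phi_dissection:
  "phi = dil 25 phi - 2 * fps_X * dil 5 (theta 10 3) + 2 * fps_X ^ 4 * dil 5 (theta 10 1)"
proof -
  let ?g = "\<lambda>c. gf UNIV (\<lambda>i. sg (- 1) (c - 5 * i)) (\<lambda>i. tri 2 1 (c - 5 * i))"
  have tri21: "tri 2 1 (- j) = tri 2 1 j" for j
    using int_tri_2_1[of j] int_tri_2_1[of "- j"] by simp
  have flip: "?g (- c) = ?g c" for c
  proof -
    have "tri 2 1 (- c - 5 * x) = tri 2 1 (c + 5 * x)" for x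
      using tri21[of "c + 5 * x"] by (simp add: algebra_simps)
    then show ?thesis
      by (subst (2) gf_reindex[where h = uminus and B = UNIV])
         (auto simp: sg_def intro!: gf_cong bij_betwI[where g = uminus])
  qed
  have "?g 0 = gf UNIV (sg (- 1)) (\<lambda>i. 25 * tri 2 1 i)"
  proof (rule gf_cong)
    fix i :: int
    show "tri 2 1 (0 - 5 * i) = 25 * tri 2 1 i"
      using int_tri[of 1 2 i] by (intro tri_eqI) (simp_all add: algebra_simps)
  qed (auto simp: sg_def)
  also have "\<dots> = dil 25 phi" by (simp add: phi_def dil_gf)
  finally have 0: "?g 0 = dil 25 phi" .
  have "?g 1 = gf UNIV (\<lambda>i. (- 1) * sg (- 1) i) (\<lambda>i. 5 * tri 10 3 i + 1)"
  proof (rule gf_cong)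
    fix i :: int
    show "tri 2 1 (1 - 5 * i) = 5 * tri 10 3 i + 1"
      using int_tri[of 3 10 i] by (intro tri_eqI) (simp_all add: algebra_simps)
  qed (auto simp: sg_def)
  also have "\<dots> = - (fps_X * dil 5 (theta 10 3))"
    unfolding gf_scale gf_shift by (simp add: dil_gf flip: fps_const_neg)
  finally have 1: "?g 1 = - (fps_X * dil 5 (theta 10 3))" .
  have "?g 2 = gf UNIV (sg (- 1)) (\<lambda>i. 5 * tri 10 1 i + 4)"
  proof (rule gf_cong)
    fix i :: int
    show "tri 2 1 (2 - 5 * i) = 5 * tri 10 1 i + 4"
      using int_tri[of 1 10 i] by (intro tri_eqI) (simp_all add: algebra_simps)
  qed (auto simp: sg_def)
  also have "\<dots> = fps_X ^ 4 * dil 5 (theta 10 1)"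
    unfolding gf_shift by (simp add: dil_gf)
  finally have 2: "?g 2 = fps_X ^ 4 * dil 5 (theta 10 1)" .
  have "phi = ?g 0 + ?g 1 + ?g (- 1) + ?g 2 + ?g (- 2)"
    unfolding phi_def by (subst gf_split5) (simp_all add: ffib_tri)
  then show ?thesis
    unfolding flip[of 1] flip[of 2] 0 1 2 by (simp add: algebra_simps)
qed

lemma psi_dissection:
  obtains C0 C1 where "psi = C0 + C1 + fps_X ^ 3 * dil 25 psi" "fgr 0 C0" "fgr 1 C1"
proof
  let ?g = "\<lambda>c. gf UNIV (\<lambda>i. sg 1 (c - 5 * i)) (\<lambda>i. tri 4 1 (c - 5 * i))"
  have "?g (- 1) = gf UNIV (sg 1) (\<lambda>i. 25 * tri 4 1 i + 3)"
  proof -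
    have "tri 4 1 (- 1 - 5 * (- i)) = 25 * tri 4 1 i + 3" for i :: int
      using int_tri[of 1 4 i] by (intro tri_eqI) (simp_all add: algebra_simps)
    then show ?thesis
      by (subst gf_reindex[where h = uminus and B = UNIV])
         (auto simp: sg_def intro!: gf_cong bij_betwI[where g = uminus])
  qed
  also have "\<dots> = fps_X ^ 3 * dil 25 psi"
    unfolding gf_shift by (simp add: psi_def dil_gf)
  finally have 3: "?g (- 1) = fps_X ^ 3 * dil 25 psi" .
  have "psi = ?g 0 + ?g 1 + ?g (- 1) + ?g 2 + ?g (- 2)"
    unfolding psi_def by (subst gf_split5) (simp_all add: ffib_tri)
  then show "psi = (?g 0 + ?g (- 2)) + (?g 1 + ?g 2) + fps_X ^ 3 * dil 25 psi"
    unfolding 3 by (rule trans) (simp only: ac_simps)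
  show "fgr 0 (?g 0 + ?g (- 2))"
  proof (intro fgr_add fgr_gf)
    fix i :: int
    show "tri 4 1 (0 - 5 * i) mod 5 = 0"
      by (rule tri_mod5[where M = "20 * i\<^sup>2 + 2 * i"]) (simp_all add: power2_eq_square algebra_simps)
    show "tri 4 1 (- 2 - 5 * i) mod 5 = 0"
      by (rule tri_mod5[where M = "4 + 20 * i\<^sup>2 + 18 * i"]) (simp_all add: power2_eq_square algebra_simps)
  qed
  show "fgr 1 (?g 1 + ?g 2)"
  proof (intro fgr_add fgr_gf)
    fix i :: int
    show "tri 4 1 (1 - 5 * i) mod 5 = 1"
      by (rule tri_mod5[where M = "20 * i\<^sup>2 - 6 * i"]) (simp_all add: power2_eq_square algebra_simps)
    show "tri 4 1 (2 - 5 * i) mod 5 = 1"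
      by (rule tri_mod5[where M = "2 + 20 * i\<^sup>2 - 14 * i"]) (simp_all add: power2_eq_square algebra_simps)
  qed
qed

section \<open>The Hecke operator at 5 on phi^2 and psi^2\<close>

lemma sec_gf:
  assumes "m > 0"
  shows "sec m r (gf A w e) = gf {x\<in>A. \<exists>n. e x = m * n + r} w (\<lambda>x. (e x - r) div m)"
proof (rule fps_ext)
  fix n
  have "{x \<in> A. e x = m * n + r} = {x \<in> {x\<in>A. \<exists>n. e x = m * n + r}. (e x - r) div m = n}"
    using assms by auto
  then show "fps_nth (sec m r (gf A w e)) n = fps_nth (gf {x\<in>A. \<exists>n. e x = m * n + r} w (\<lambda>x. (e x - r) div m)) n"
    by (simp add: gf_nth)
qed

lemma gf_Un_Int:
  assumes "ffib (A \<union> B) e"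
  shows "gf (A \<union> B) w e + gf (A \<inter> B) w e = gf A w e + gf B w e"
proof (rule fps_ext)
  fix n
  have "{x \<in> A \<union> B. e x = n} = {x\<in>A. e x = n} \<union> {x\<in>B. e x = n}"
    "{x \<in> A \<inter> B. e x = n} = {x\<in>A. e x = n} \<inter> {x\<in>B. e x = n}" by auto
  moreover have "finite {x\<in>A. e x = n}" "finite {x\<in>B. e x = n}"
    using ffib_subset[OF assms, of A] ffib_subset[OF assms, of B] by (simp_all add: ffib_def)
  ultimately show "fps_nth (gf (A \<union> B) w e + gf (A \<inter> B) w e) n = fps_nth (gf A w e + gf B w e) n"
    by (simp add: gf_nth sum.union_inter)
qed

lemma gf_two_lattices:
  fixes h0 h1 h2 :: "'b \<Rightarrow> 'a"
  assumes "ffib S e" "S = range h1 \<union> range h2" "range h1 \<inter> range h2 = range h0" "inj h1" "inj h2" "inj h0"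
  shows "gf S w e = gf UNIV (\<lambda>x. w (h1 x)) (\<lambda>x. e (h1 x)) + gf UNIV (\<lambda>x. w (h2 x)) (\<lambda>x. e (h2 x))
    - gf UNIV (\<lambda>x. w (h0 x)) (\<lambda>x. e (h0 x))"
proof -
  have *: "gf (range h) w e = gf UNIV (\<lambda>x. w (h x)) (\<lambda>x. e (h x))" if "inj h" for h :: "'b \<Rightarrow> 'a"
    by (rule gf_reindex) (use that in \<open>simp add: bij_betw_def\<close>)
  have "gf S w e + gf (range h0) w e = gf (range h1) w e + gf (range h2) w e"
    using gf_Un_Int[of "range h1" "range h2" e w] assms(1-3) by simp
  then show ?thesis
    using assms(4-6) by (simp add: * algebra_simps)
qed

lemma five_dvd_sum_squares:
  fixes x y :: int
  shows "5 dvd x\<^sup>2 + y\<^sup>2 \<longleftrightarrow> 5 dvd y - 2 * x \<or> 5 dvd y + 2 * x"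
proof -
  have "x\<^sup>2 + y\<^sup>2 = (y - 2 * x) * (y + 2 * x) + 5 * x\<^sup>2"
    by (simp add: power2_eq_square algebra_simps)
  then have "5 dvd x\<^sup>2 + y\<^sup>2 \<longleftrightarrow> 5 dvd (y - 2 * x) * (y + 2 * x)"
    by (simp only: dvd_add_left_iff dvd_triv_left)
  then show ?thesis
    using prime_dvd_mult_iff[of "5 :: int"] by simp
qed

text \<open>Inclusion and exclusion: the exponents congruent to \<open>r\<close> modulo 5 live on
  two sublattices, parametrised by \<open>h1\<close> and \<open>h2\<close>, that both reproduce the
  series, and on their intersection, parametrised by \<open>h0\<close>, it recurs at q^5 times
  q^r.\<close>

lemma hecke_gf:
  fixes h0 h1 h2 :: "'a \<Rightarrow> 'a"
  assumes "ffib UNIV e" and S: "{p. \<exists>n. e p = 5 * n + r} = range h1 \<union> range h2"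
    and I: "range h1 \<inter> range h2 = range h0" and "inj h1" "inj h2" "inj h0"
    and h: "\<And>p. e (h1 p) = 5 * e p + r" "\<And>p. e (h2 p) = 5 * e p + r" "\<And>p. e (h0 p) = 5 * (5 * e p + r) + r"
      "\<And>p. w (h1 p) = w p" "\<And>p. w (h2 p) = w p" "\<And>p. w (h0 p) = w p"
  shows "sec 5 r (gf UNIV w e) = 2 * gf UNIV w e - fps_X ^ r * dil 5 (gf UNIV w e)"
proof -
  define S where "S = {p. \<exists>n. e p = 5 * n + r}"
  have "ffib S (\<lambda>p. (e p - r) div 5)"
    unfolding ffib_def
  proof
    fix n
    have "{p \<in> S. (e p - r) div 5 = n} = {p \<in> UNIV. e p = 5 * n + r}"
      by (auto simp: S_def)
    then show "finite {p \<in> S. (e p - r) div 5 = n}"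
      using assms(1) by (simp only: ffib_def)
  qed
  then have "gf S w (\<lambda>p. (e p - r) div 5)
     = gf UNIV (\<lambda>x. w (h1 x)) (\<lambda>x. (e (h1 x) - r) div 5) + gf UNIV (\<lambda>x. w (h2 x)) (\<lambda>x. (e (h2 x) - r) div 5)
       - gf UNIV (\<lambda>x. w (h0 x)) (\<lambda>x. (e (h0 x) - r) div 5)"
    by (intro gf_two_lattices I assms(4-6)) (simp_all only: S_def S)
  then show ?thesis
    by (simp add: sec_gf S_def h dil_gf add.commute flip: gf_shift)
qed

text \<open>Multiplication by the Gaussian integers \<open>1 \<plusminus> 2\<i>\<close> parametrises the pairs with \<open>5 dvd x\<^sup>2 + y\<^sup>2\<close>.\<close>

lemma phi_hecke: "sec 5 0 (phi * phi) = 2 * (phi * phi) - dil 5 (phi * phi)"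
proof -
  let ?e = "\<lambda>(x, y). tri 2 1 x + tri 2 1 y"
  let ?w = "\<lambda>(x, y). sg (- 1) x * sg (- 1) y"
  have ff: "ffib UNIV (tri 2 1)" by (rule ffib_tri) auto
  have pp: "phi * phi = gf UNIV ?w ?e"
    unfolding phi_def by (subst gf_mult[OF ff ff]) simp
  have ie: "int (?e (x, y)) = x\<^sup>2 + y\<^sup>2" for x y
    by (simp add: int_tri_2_1[simplified])
  then have ip: "int (?e p) = (fst p)\<^sup>2 + (snd p)\<^sup>2" for p
    by (cases p) (simp only: fst_conv snd_conv)
  let ?h1 = "\<lambda>(u, v). (u - 2 * v, 2 * u + v) :: int \<times> int"
  let ?h2 = "\<lambda>(u, v). (u + 2 * v, - 2 * u + v) :: int \<times> int"
  let ?h0 = "\<lambda>(u, v). (5 * u, 5 * v) :: int \<times> int"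
  have r1: "range ?h1 = {(x, y). 5 dvd y - 2 * x}"
  proof safe
    fix x y :: int assume "5 dvd y - 2 * x"
    then obtain v where "y - 2 * x = 5 * v" by (rule dvdE)
    then have "(x, y) = ?h1 (x + 2 * v, v)" by simp
    then show "(x, y) \<in> range ?h1" by (rule range_eqI)
  qed auto
  have r2: "range ?h2 = {(x, y). 5 dvd y + 2 * x}"
  proof safe
    fix x y :: int assume "5 dvd y + 2 * x"
    then obtain v where "y + 2 * x = 5 * v" by (rule dvdE)
    then have "(x, y) = ?h2 (x - 2 * v, v)" by simp
    then show "(x, y) \<in> range ?h2" by (rule range_eqI)
  qed auto
  have r0: "range ?h0 = {(x, y). 5 dvd x \<and> 5 dvd y}"
    by (auto simp: image_def elim!: dvdE)
  have "(\<exists>n. ?e (x, y) = 5 * n + 0) \<longleftrightarrow> 5 dvd y - 2 * x \<or> 5 dvd y + 2 * x" for x y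
  proof -
    have "(\<exists>n. ?e (x, y) = 5 * n + 0) \<longleftrightarrow> 5 dvd int (?e (x, y))"
      by presburger
    then show ?thesis unfolding ie five_dvd_sum_squares .
  qed
  then have S: "{p. \<exists>n. ?e p = 5 * n + 0} = range ?h1 \<union> range ?h2"
    unfolding r1 r2 by auto
  have "5 dvd y - 2 * x \<and> 5 dvd y + 2 * x \<longleftrightarrow> 5 dvd x \<and> 5 dvd y" for x y :: int
    by presburger
  then have I: "range ?h1 \<inter> range ?h2 = range ?h0"
    unfolding r0 r1 r2 by auto
  have eI: "a = 5 * b + 0" if "int a = 5 * int b" for a b :: nat using that by presburger
  have e0I: "a = 5 * (5 * b + 0) + 0" if "int a = 25 * int b" for a b :: nat using that by presburger
  have "sec 5 0 (gf UNIV ?w ?e) = 2 * gf UNIV ?w ?e - fps_X ^ 0 * dil 5 (gf UNIV ?w ?e)"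
  proof (rule hecke_gf[OF _ S I])
    show "ffib UNIV ?e" using ffib_prod[OF ff ff] by simp
    fix p :: "int \<times> int"
    obtain u v where p: "p = (u, v)" by force
    show "?e (?h1 p) = 5 * ?e p + 0" "?e (?h2 p) = 5 * ?e p + 0"
      by (rule eI; unfold ip; simp add: p power2_eq_square algebra_simps)+
    show "?e (?h0 p) = 5 * (5 * ?e p + 0) + 0"
      by (rule e0I; unfold ip; simp add: p power2_eq_square algebra_simps)
    show "?w (?h1 p) = ?w p" "?w (?h2 p) = ?w p" "?w (?h0 p) = ?w p"
      by (simp_all add: p sg_def)
  qed (auto simp: inj_on_def)
  then show ?thesis by (simp add: pp)
qed

text \<open>Completing squares, \<open>8 * e + 2\<close> is the norm of
  \<open>(4 x - 1) + (4 y - 1) i\<close>. In these coordinates \<open>h1\<close> and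
  \<open>h2\<close> are multiplication by -(1 + 2i) and -(1 - 2i), and \<open>h0\<close> is
  multiplication by 5. The minus signs keep both coordinates congruent to -1 modulo 4.\<close>

lemma psi_hecke: "sec 5 1 (psi * psi) = 2 * (psi * psi) - fps_X * dil 5 (psi * psi)"
proof -
  let ?e = "\<lambda>(x, y). tri 4 1 x + tri 4 1 y"
  let ?w = "\<lambda>_ :: int \<times> int. 1 :: rat"
  have ff: "ffib UNIV (tri 4 1)" by (rule ffib_tri) auto
  have pp: "psi * psi = gf UNIV ?w ?e"
    unfolding psi_def by (subst gf_mult[OF ff ff]) (auto simp: sg_def intro!: gf_cong)
  have ie: "8 * int (?e (x, y)) + 2 = (4 * x - 1)\<^sup>2 + (4 * y - 1)\<^sup>2" for x y
    using int_tri[of 1 4 x] int_tri[of 1 4 y] by (simp add: power2_eq_square algebra_simps)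
  then have ip: "8 * int (?e p) + 2 = (4 * fst p - 1)\<^sup>2 + (4 * snd p - 1)\<^sup>2" for p
    by (cases p) (simp only: fst_conv snd_conv)
  let ?h1 = "\<lambda>(u, v). (2 * v - u, 1 - 2 * u - v) :: int \<times> int"
  let ?h2 = "\<lambda>(u, v). (1 - u - 2 * v, 2 * u - v) :: int \<times> int"
  let ?h0 = "\<lambda>(u, v). (5 * u - 1, 5 * v - 1) :: int \<times> int"
  have r1: "range ?h1 = {(x, y). 5 dvd (4 * y - 1) - 2 * (4 * x - 1)}"
  proof safe
    fix x y :: int assume "5 dvd (4 * y - 1) - 2 * (4 * x - 1)"
    then have "\<exists>v. y = 1 + 2 * x - 5 * v" by presburger
    then obtain v where "y = 1 + 2 * x - 5 * v" by blast
    then have "(x, y) = ?h1 (2 * v - x, v)" by simp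
    then show "(x, y) \<in> range ?h1" by (rule range_eqI)
  qed presburger
  have r2: "range ?h2 = {(x, y). 5 dvd (4 * y - 1) + 2 * (4 * x - 1)}"
  proof safe
    fix x y :: int assume "5 dvd (4 * y - 1) + 2 * (4 * x - 1)"
    then have "\<exists>v. y = 2 - 2 * x - 5 * v" by presburger
    then obtain v where "y = 2 - 2 * x - 5 * v" by blast
    then have "(x, y) = ?h2 (1 - x - 2 * v, v)" by simp
    then show "(x, y) \<in> range ?h2" by (rule range_eqI)
  qed presburger
  have r0: "range ?h0 = {(x, y). 5 dvd 4 * x - 1 \<and> 5 dvd 4 * y - 1}"
  proof safe
    fix x y :: int assume "5 dvd 4 * x - 1" "5 dvd 4 * y - 1"
    then have "\<exists>u. x = 5 * u - 1" "\<exists>v. y = 5 * v - 1" by presburger+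
    then obtain u v where "x = 5 * u - 1" "y = 5 * v - 1" by blast
    then have "(x, y) = ?h0 (u, v)" by simp
    then show "(x, y) \<in> range ?h0" by (rule range_eqI)
  qed presburger+
  have "(\<exists>n. ?e (x, y) = 5 * n + 1) \<longleftrightarrow> 5 dvd (4 * y - 1) - 2 * (4 * x - 1) \<or> 5 dvd (4 * y - 1) + 2 * (4 * x - 1)" for x y
  proof -
    have "(\<exists>n. ?e (x, y) = 5 * n + 1) \<longleftrightarrow> 5 dvd 8 * int (?e (x, y)) + 2"
      by presburger
    then show ?thesis unfolding ie five_dvd_sum_squares .
  qed
  then have S: "{p. \<exists>n. ?e p = 5 * n + 1} = range ?h1 \<union> range ?h2"
    unfolding r1 r2 by auto
  have "5 dvd (4 * y - 1) - 2 * (4 * x - 1) \<and> 5 dvd (4 * y - 1) + 2 * (4 * x - 1) \<longleftrightarrow> 5 dvd 4 * x - 1 \<and> 5 dvd 4 * y - 1"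
    for x y :: int by presburger
  then have I: "range ?h1 \<inter> range ?h2 = range ?h0"
    unfolding r0 r1 r2 by blast
  have eI: "a = 5 * b + 1" if "8 * int a + 2 = 5 * (8 * int b + 2)" for a b :: nat
    using that by presburger
  have e0I: "a = 5 * (5 * b + 1) + 1" if "8 * int a + 2 = 25 * (8 * int b + 2)" for a b :: nat
    using that by presburger
  have "sec 5 1 (gf UNIV ?w ?e) = 2 * gf UNIV ?w ?e - fps_X ^ 1 * dil 5 (gf UNIV ?w ?e)"
  proof (rule hecke_gf[OF _ S I])
    show "ffib UNIV ?e" using ffib_prod[OF ff ff] by simp
    fix p :: "int \<times> int"
    obtain u v where p: "p = (u, v)" by force
    show "?e (?h1 p) = 5 * ?e p + 1" "?e (?h2 p) = 5 * ?e p + 1"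
      by (rule eI; unfold ip; simp add: p power2_eq_square algebra_simps)+
    show "?e (?h0 p) = 5 * (5 * ?e p + 1) + 1"
      by (rule e0I; unfold ip; simp add: p power2_eq_square algebra_simps)
  qed (auto simp: inj_on_def)
  then show ?thesis by (simp add: pp)
qed

section \<open>Grading of Laurent series by the exponent modulo 5\<close>

definition graded :: "int \<Rightarrow> rat fls \<Rightarrow> bool" where
  "graded j f \<longleftrightarrow> (\<forall>n. fls_nth f n \<noteq> 0 \<longrightarrow> n mod 5 = j mod 5)"

definition proj :: "int \<Rightarrow> rat fls \<Rightarrow> rat fls" where
  "proj j f = Abs_fls (\<lambda>n. if n mod 5 = j mod 5 then fls_nth f n else 0)"

lemma proj_nth: "fls_nth (proj j f) n = (if n mod 5 = j mod 5 then fls_nth f n else 0)"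
  unfolding proj_def by (rule nth_Abs_fls_lower_bound[of "fls_subdegree f"]) simp

lemma proj_add: "proj j (f + g) = proj j f + proj j g"
  by (rule fls_eqI) (simp add: proj_nth)

lemma proj_diff: "proj j (f - g) = proj j f - proj j g"
  by (rule fls_eqI) (simp add: proj_nth)

lemma proj_same: "graded i f \<Longrightarrow> i mod 5 = j mod 5 \<Longrightarrow> proj j f = f"
  by (rule fls_eqI) (auto simp: proj_nth graded_def)

lemma proj_other: "graded i f \<Longrightarrow> i mod 5 \<noteq> j mod 5 \<Longrightarrow> proj j f = 0"
  by (rule fls_eqI) (auto simp: proj_nth graded_def)

lemma graded_proj: "graded j (proj j f)"
  by (auto simp: graded_def proj_nth)

lemma graded_cong: "graded i f \<Longrightarrow> i mod 5 = j mod 5 \<Longrightarrow> graded j f"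
  by (simp add: graded_def)

lemma graded_add: "graded j f \<Longrightarrow> graded j g \<Longrightarrow> graded j (f + g)"
  unfolding graded_def fls_plus_nth by (metis add.right_neutral)

lemma graded_uminus: "graded j f \<Longrightarrow> graded j (- f)"
  by (simp add: graded_def)

lemma graded_diff: "graded j f \<Longrightarrow> graded j g \<Longrightarrow> graded j (f - g)"
  unfolding graded_def fls_minus_nth by (metis diff_zero)

lemma graded_0 [simp]: "graded j 0"
  by (simp add: graded_def)

lemma graded_1: "graded 0 1"
  by (auto simp: graded_def)

lemma graded_numeral: "graded 0 (numeral n)"
proof -
  have "graded 0 (of_nat k)" for k
    by (induction k) (auto intro: graded_add graded_1)
  from this[of "numeral n"] show ?thesis by simp
qed

lemma graded_X: "graded 1 fls_X"
  by (auto simp: graded_def split: if_splits)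

lemma graded_mult:
  assumes "graded i f" "graded j g"
  shows "graded (i + j) (f * g)"
  unfolding graded_def
proof (intro allI impI)
  fix n assume "fls_nth (f * g) n \<noteq> 0"
  then obtain k where "fls_nth f (k - fls_subdegree g) * fls_nth g (fls_subdegree g + n - k) \<noteq> 0"
    unfolding fls_times_nth by (meson sum.not_neutral_contains_not_neutral)
  then have "(k - fls_subdegree g) mod 5 = i mod 5" "(fls_subdegree g + n - k) mod 5 = j mod 5"
    using assms by (auto simp: graded_def)
  then have "((k - fls_subdegree g) + (fls_subdegree g + n - k)) mod 5 = (i + j) mod 5"
    by (rule mod_add_cong)
  then show "n mod 5 = (i + j) mod 5"
    by simp
qed

lemma graded_power: "graded i f \<Longrightarrow> graded (int n * i) (f ^ n)"
proof (induction n)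
  case (Suc n)
  then have "graded (i + int n * i) (f * f ^ n)"
    by (intro graded_mult) auto
  then show ?case by (simp add: algebra_simps)
qed (simp add: graded_1)

lemma proj_sum5: "proj 0 f + proj 1 f + proj 2 f + proj 3 f + proj 4 f = f"
proof (rule fls_eqI)
  fix n :: int
  have "n mod 5 = 0 \<or> n mod 5 = 1 \<or> n mod 5 = 2 \<or> n mod 5 = 3 \<or> n mod 5 = 4"
    by presburger
  then show "fls_nth (proj 0 f + proj 1 f + proj 2 f + proj 3 f + proj 4 f) n = fls_nth f n"
    by (auto simp: proj_nth)
qed

lemma proj_mult:
  assumes "graded i f"
  shows "proj (i + j) (f * g) = f * proj j g"
proof -
  have *: "proj (i + j) (f * proj l g) = (if l mod 5 = j mod 5 then f * proj l g else 0)" for l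
  proof -
    have "graded (i + l) (f * proj l g)"
      by (intro graded_mult assms graded_proj)
    moreover have "(i + l) mod 5 = (i + j) mod 5 \<longleftrightarrow> l mod 5 = j mod 5"
      by (simp add: mod_eq_dvd_iff)
    ultimately show ?thesis
      by (auto intro: proj_same proj_other)
  qed
  have pj: "proj l g = proj (j mod 5) g" if "l = j mod 5" for l using that by simp
  have "f * g = f * proj 0 g + f * proj 1 g + f * proj 2 g + f * proj 3 g + f * proj 4 g"
    by (subst proj_sum5[of g, symmetric]) (simp add: distrib_left)
  then have "proj (i + j) (f * g) = proj (i + j) (f * proj 0 g) + proj (i + j) (f * proj 1 g)
     + proj (i + j) (f * proj 2 g) + proj (i + j) (f * proj 3 g) + proj (i + j) (f * proj 4 g)"
    by (simp only: proj_add)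
  moreover have "proj j g = proj (j mod 5) g"
    by (rule fls_eqI) (simp add: proj_nth)
  moreover have "j mod 5 = 0 \<or> j mod 5 = 1 \<or> j mod 5 = 2 \<or> j mod 5 = 3 \<or> j mod 5 = 4"
    by presburger
  ultimately show ?thesis
    unfolding * by auto
qed

text \<open>The component of grade \<open>- i\<close> of the inverse, multiplied by
  \<open>f\<close>, is the grade 0 part of 1, that is 1 itself; so this component is already the
  whole inverse.\<close>

lemma graded_inverse:
  assumes "graded i f"
  shows "graded (- i) (inverse f)"
proof (cases "f = 0")
  case False
  have "f * proj (- i) (inverse f) = proj (i + - i) (f * inverse f)"
    by (rule proj_mult[OF assms, symmetric])
  also have "\<dots> = 1"
    using False by (simp add: proj_same[OF graded_1])
  finally have "proj (- i) (inverse f) = inverse f"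
    using False by (metis inverse_unique)
  then show ?thesis
    by (metis graded_proj)
qed simp

lemma graded_divide: "graded i f \<Longrightarrow> graded j g \<Longrightarrow> graded (i - j) (f / g)"
  using graded_mult[OF _ graded_inverse] by (simp add: divide_inverse)

lemma graded_unique5:
  assumes "a0 + a1 + a2 + a3 + a4 = b0 + b1 + b2 + b3 + b4"
    and "graded 0 a0" "graded 1 a1" "graded 2 a2" "graded 3 a3" "graded 4 a4"
    and "graded 0 b0" "graded 1 b1" "graded 2 b2" "graded 3 b3" "graded 4 b4"
  shows "a0 = b0" "a1 = b1" "a2 = b2" "a3 = b3" "a4 = b4"
proof -
  have p: "proj j (a0 + a1 + a2 + a3 + a4) = proj j (b0 + b1 + b2 + b3 + b4)" for j
    using assms(1) by simp
  have s: "proj j f = (if i = j then f else 0)" if "graded i f" "i \<in> {0..4}" "j \<in> {0..4}" for i j f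
    using that by (auto intro: proj_same proj_other)
  show "a0 = b0" "a1 = b1" "a2 = b2" "a3 = b3" "a4 = b4"
    using p[of 0] p[of 1] p[of 2] p[of 3] p[of 4] unfolding proj_add
    by (simp_all add: s[OF assms(2)] s[OF assms(3)] s[OF assms(4)] s[OF assms(5)] s[OF assms(6)] s[OF assms(7)]
      s[OF assms(8)] s[OF assms(9)] s[OF assms(10)] s[OF assms(11)])
qed

lemma graded_fgr: "fgr j F \<Longrightarrow> graded (int j) (fps_to_fls F)"
  unfolding graded_def fgr_def
proof (intro allI impI)
  fix n assume *: "\<forall>n. fps_nth F n \<noteq> 0 \<longrightarrow> n mod 5 = j" "fls_nth (fps_to_fls F) n \<noteq> 0"
  then have "n = int (nat n)" "nat n mod 5 = j"
    by (auto split: if_splits)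
  then show "n mod 5 = int j mod 5" by (metis mod_mod_trivial of_nat_mod of_nat_numeral)
qed

lemma graded_dil: "5 dvd m \<Longrightarrow> graded 0 (fps_to_fls (dil m F))"
proof -
  assume "5 dvd m"
  then have "fgr 0 (dil m F)"
    unfolding fgr_def dil_nth by (metis dvd_trans mod_0_imp_dvd mod_eq_0_iff_dvd)
  then show ?thesis using graded_fgr[of 0 "dil m F"] by simp
qed

text \<open>The bridge from sections of power series to projections of Laurent series, where eta
  quotients can be divided freely.\<close>

lemma proj_fps:
  assumes "r < 5"
  shows "proj (int r) (fps_to_fls F) = fls_X ^ r * fps_to_fls (dil 5 (sec 5 r F))"
proof (rule fls_eqI)
  fix n :: int
  show "fls_nth (proj (int r) (fps_to_fls F)) n = fls_nth (fls_X ^ r * fps_to_fls (dil 5 (sec 5 r F))) n"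
  proof (cases "n \<ge> int r \<and> n mod 5 = int r")
    case True
    define m where "m = n div 5"
    have n: "n = 5 * m + int r" "m \<ge> 0" using True assms mult_div_mod_eq[of 5 n] unfolding m_def
      by (linarith, simp add: pos_imp_zdiv_nonneg_iff)
    then have "nat (n - int r) = 5 * nat m" "nat n = 5 * nat m + r" by auto
    with True assms show ?thesis
      by (simp add: proj_nth fls_X_power_times_conv_shift dil_nth)
  next
    case False
    have "\<not> 5 dvd nat (n - int r)" if "n - int r \<ge> 0"
    proof
      assume "5 dvd nat (n - int r)"
      then obtain k where "nat (n - int r) = 5 * k" by auto
      with that have "n = int r + 5 * int k" by linarith
      with that False assms show False by simp
    qed
    moreover have "n mod 5 \<noteq> int r" if "0 \<le> n" "n < int r"
      using that assms by auto
    ultimately show ?thesis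
      using False assms by (auto simp: proj_nth fls_X_power_times_conv_shift dil_nth)
  qed
qed

section \<open>The parametrisation of the level 10 functions\<close>

abbreviation q :: "rat fls" where "q \<equiv> fls_X"

abbreviation EL :: "nat \<Rightarrow> rat fls" where "EL n \<equiv> fps_to_fls (E n)"

lemma graded_EL: "5 dvd n \<Longrightarrow> n > 0 \<Longrightarrow> graded 0 (EL n)"
proof -
  assume "5 dvd n" "n > 0"
  then have "E n = dil n (E 1)" by (simp add: dil_E)
  with graded_dil[OF \<open>5 dvd n\<close>, of "E 1"] show ?thesis by simp
qed

text \<open>\<open>e1\<close> and \<open>e2\<close> are \<open>E\<^sub>1\<close> and \<open>E\<^sub>2\<close> divided by the middle terms of their 5-dissections, up to sign. With
  \<open>r\<close>, \<open>s\<close> as in \<open>e1_e2_dissection\<close> below and \<open>k = r s\<^sup>2\<close>, the parameter \<open>tt\<close> turns out to be \<open>1 / k - k\<close>.\<close>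

definition e1 :: "rat fls" where "e1 = EL 1 / (q * EL 25)"
definition e2 :: "rat fls" where "e2 = EL 2 / (q ^ 2 * EL 50)"
definition tt :: "rat fls" where "tt = EL 10 * EL 25 ^ 5 / (q ^ 5 * EL 5 * EL 50 ^ 5)"

lemma e_nz: "e1 \<noteq> 0" "e2 \<noteq> 0" "tt \<noteq> 0"
  by (simp_all add: e1_def e2_def tt_def)

lemma graded_tt: "graded 0 tt"
proof -
  have "graded (0 + int 5 * 0 - (int 5 * 1 + 0 + int 5 * 0)) tt"
    unfolding tt_def by (intro graded_divide graded_mult graded_power graded_X graded_EL) auto
  then show ?thesis by (rule graded_cong) simp
qed

text \<open>The relation \<open>phi * E 2 = E 1 ^ 2\<close>, divided by the self-similar term
  \<open>F0\<close> = phi(-q^25). The product \<open>a * b\<close> is evaluated twice: from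
  \<open>theta10_prod\<close>, and from the grade 0 part of phi^2, to which only
  \<open>F0 ^ 2\<close> and the cross term of grades 1 and 4 contribute.\<close>

lemma phi_normalized:
  obtains a b where "graded 1 a" "graded 4 b" "e1 ^ 2 = e2 * (1 + a + b)" "a * b = - 4 / tt"
    "1 + 2 * a * b = 2 * (EL 5 ^ 4 * EL 50 ^ 2 / (EL 10 ^ 2 * EL 25 ^ 4)) - 1"
proof -
  define F0 where "F0 = EL 25 ^ 2 / EL 50"
  define G1 G3 where "G1 = fps_to_fls (dil 5 (theta 10 1))"
    and "G3 = fps_to_fls (dil 5 (theta 10 3))"
  have F0: "F0 \<noteq> 0" "graded 0 F0"
  proof -
    have "graded (int 2 * 0 - 0) F0"
      unfolding F0_def by (intro graded_divide graded_power graded_EL) auto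
    then show "graded 0 F0" by simp
  qed (simp add: F0_def)
  have L: "fps_to_fls (dil m phi) * EL (2 * m) = EL m ^ 2" if "m > 0" for m
  proof -
    have "dil m phi * E (2 * m) = E m ^ 2"
      using arg_cong[OF phi_prod, of "dil m"] that by (simp add: dil_mult dil_power dil_E mult.commute)
    then show ?thesis
      by (metis fls_times_fps_to_fls fps_to_fls_power)
  qed
  have F25: "fps_to_fls (dil 25 phi) = F0"
    using L[of 25] by (simp add: F0_def field_simps)
  have F5: "fps_to_fls (dil 5 phi) = EL 5 ^ 2 / EL 10"
    using L[of 5] by (simp add: field_simps)
  have F1: "fps_to_fls phi * EL 2 = EL 1 ^ 2"
    using phi_prod by (metis fls_times_fps_to_fls fps_to_fls_power)
  define a' b' where "a' = - 2 * q * G3" and "b' = 2 * q ^ 4 * G1"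
  have dis: "fps_to_fls phi = F0 + a' + b'"
  proof -
    have "fps_to_fls phi = fps_to_fls (dil 25 phi - 2 * fps_X * dil 5 (theta 10 3)
        + 2 * fps_X ^ 4 * dil 5 (theta 10 1))"
      using phi_dissection by simp
    then show ?thesis
      unfolding F25[symmetric] a'_def b'_def G1_def G3_def
      by (simp add: fls_times_fps_to_fls fps_to_fls_power)
  qed
  have gG: "graded 0 G1" "graded 0 G3"
    unfolding G1_def G3_def by (simp_all add: graded_dil)
  have ga': "graded 1 a'"
  proof -
    have "graded (0 + 1 + 0) (2 * q * G3)"
      by (intro graded_mult graded_numeral graded_X gG)
    then have "graded 1 (- (2 * q * G3))" by (intro graded_uminus) simp
    then show ?thesis by (simp add: a'_def)
  qed
  have gb': "graded 4 b'"
  proof -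
    have "graded (0 + int 4 * 1 + 0) (2 * q ^ 4 * G1)"
      by (intro graded_mult graded_numeral graded_power graded_X gG)
    then show ?thesis by (simp add: b'_def)
  qed
  have GG: "G1 * G3 = EL 50 ^ 3 * EL 5 / (EL 25 * EL 10)"
  proof -
    have "dil 5 (theta 10 1) * dil 5 (theta 10 3) * (E 25 * E 10) = E 50 ^ 3 * E 5"
      using arg_cong[OF theta10_prod, of "dil 5"] by (simp add: dil_mult dil_power dil_E)
    then have "G1 * G3 * (EL 25 * EL 10) = EL 50 ^ 3 * EL 5"
      unfolding G1_def G3_def by (metis fls_times_fps_to_fls fps_to_fls_power)
    then show ?thesis by (simp add: field_simps)
  qed
  have ab: "a' * b' = - 4 * q ^ 5 * (G1 * G3)"
    by (simp add: a'_def b'_def power_numeral_reduce)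
  show ?thesis
  proof (rule that)
    have "graded (1 - 0) (a' / F0)" "graded (4 - 0) (b' / F0)"
      by (intro graded_divide ga' gb' F0)+
    then show "graded 1 (a' / F0)" "graded 4 (b' / F0)" by simp_all
    have "e1 ^ 2 = e2 * (fps_to_fls phi / F0)"
      using F1 by (simp add: e1_def e2_def F0_def field_simps power2_eq_square)
    then show "e1 ^ 2 = e2 * (1 + a' / F0 + b' / F0)"
      unfolding dis using F0(1) by (simp add: add_divide_distrib)
    have "a' / F0 * (b' / F0) = (a' * b') / F0 ^ 2"
      by (simp add: power2_eq_square)
    also have "\<dots> = - 4 / tt"
      unfolding ab GG F0_def tt_def by (simp add: field_simps power_numeral_reduce)
    finally show ab_tt: "a' / F0 * (b' / F0) = - 4 / tt" .
    have "proj 0 (fps_to_fls (phi * phi)) = F0 ^ 2 + 2 * (a' * b')"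
    proof -
      have "fps_to_fls (phi * phi) = (F0 * F0 + 2 * (a' * b')) + 2 * (F0 * a') + a' * a' + b' * b' + 2 * (F0 * b')"
        unfolding fls_times_fps_to_fls dis by (simp add: algebra_simps)
      moreover have "graded (0 + 0) (F0 * F0)" "graded (0 + (1 + 4)) (2 * (a' * b'))" "graded (0 + (0 + 1)) (2 * (F0 * a'))"
        "graded (1 + 1) (a' * a')" "graded (4 + 4) (b' * b')" "graded (0 + (0 + 4)) (2 * (F0 * b'))"
        by (intro graded_mult graded_numeral F0 ga' gb')+
      ultimately show ?thesis
        by (simp add: proj_add proj_same proj_other power2_eq_square)
    qed
    moreover have "proj 0 (fps_to_fls (phi * phi)) = 2 * (EL 5 ^ 2 / EL 10) ^ 2 - F0 ^ 2"
    proof -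
      have "proj 0 (fps_to_fls (phi * phi)) = fps_to_fls (dil 5 (sec 5 0 (phi * phi)))"
        using proj_fps[of 0 "phi * phi"] by simp
      also have "dil 5 (sec 5 0 (phi * phi)) = 2 * (dil 5 phi * dil 5 phi) - dil 25 phi * dil 25 phi"
      proof -
        have "dil 5 (dil 5 F) = dil 25 F" for F
          by (rule fps_ext) (auto simp: dil_nth div_mult2_eq[symmetric] elim!: dvdE)
        then show ?thesis
          unfolding phi_hecke by (simp add: dil_mult)
      qed
      also have "fps_to_fls \<dots> = 2 * (EL 5 ^ 2 / EL 10) ^ 2 - F0 ^ 2"
        by (simp add: fls_times_fps_to_fls F25 F5 power2_eq_square)
      finally show ?thesis .
    qed
    ultimately have "F0 ^ 2 + 2 * (a' * b') = 2 * (EL 5 ^ 2 / EL 10) ^ 2 - F0 ^ 2"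
      by simp
    then have "(F0 ^ 2 + 2 * (a' * b')) / F0 ^ 2 = (2 * (EL 5 ^ 2 / EL 10) ^ 2 - F0 ^ 2) / F0 ^ 2"
      by simp
    then have "1 + 2 * (a' * b') / F0 ^ 2 = 2 * (EL 5 ^ 2 / EL 10) ^ 2 / F0 ^ 2 - 1"
      using F0(1) by (simp add: add_divide_distrib diff_divide_distrib)
    then show "1 + 2 * (a' / F0) * (b' / F0) = 2 * (EL 5 ^ 4 * EL 50 ^ 2 / (EL 10 ^ 2 * EL 25 ^ 4)) - 1"
      by (simp add: F0_def power2_eq_square power_numeral_reduce field_simps)
  qed
qed

text \<open>Now the self-similar term \<open>P\<close> has grade 3, so the outer terms acquire
  grades 0 - 3 and 1 - 3. The section of psi^2 to compare is that of grade 1, which is both 3 + 3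
  and 0 + 1 modulo 5.\<close>

lemma psi_normalized:
  obtains c d where "graded 2 c" "graded 3 d" "e2 ^ 2 = e1 * (1 + c + d)"
    "1 + 2 * c * d = 2 * (EL 10 ^ 4 * EL 25 ^ 2 / (q ^ 5 * EL 5 ^ 2 * EL 50 ^ 4)) - 1"
proof -
  obtain C0 C1 where dis0: "psi = C0 + C1 + fps_X ^ 3 * dil 25 psi" and C: "fgr 0 C0" "fgr 1 C1"
    by (rule psi_dissection)
  define P where "P = q ^ 3 * (EL 50 ^ 2 / EL 25)"
  have P: "P \<noteq> 0" "graded 3 P"
  proof -
    have "graded (int 3 * 1 + (int 2 * 0 - 0)) P"
      unfolding P_def by (intro graded_mult graded_divide graded_power graded_X graded_EL) auto
    then show "graded 3 P" by simp
  qed (simp add: P_def)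
  have L: "fps_to_fls (dil m psi) * EL m = EL (2 * m) ^ 2" if "m > 0" for m
  proof -
    have "dil m psi * E m = E (2 * m) ^ 2"
      using arg_cong[OF psi_prod, of "dil m"] that by (simp add: dil_mult dil_power dil_E mult.commute)
    then show ?thesis
      by (metis fls_times_fps_to_fls fps_to_fls_power)
  qed
  have P25: "fps_to_fls (dil 25 psi) = EL 50 ^ 2 / EL 25"
    using L[of 25] by (simp add: field_simps)
  have P5: "fps_to_fls (dil 5 psi) = EL 10 ^ 2 / EL 5"
    using L[of 5] by (simp add: field_simps)
  have P1: "fps_to_fls psi * EL 1 = EL 2 ^ 2"
    using psi_prod by (metis fls_times_fps_to_fls fps_to_fls_power)
  define c' d' where "c' = fps_to_fls C0" and "d' = fps_to_fls C1"
  have g: "graded 0 c'" "graded 1 d'"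
    using graded_fgr[OF C(1)] graded_fgr[OF C(2)] by (simp_all add: c'_def d'_def)
  have dis: "fps_to_fls psi = c' + d' + P"
  proof -
    have "fps_to_fls psi = fps_to_fls (C0 + C1 + fps_X ^ 3 * dil 25 psi)"
      using dis0 by simp
    then show ?thesis
      unfolding P_def P25[symmetric] c'_def d'_def
      by (simp add: fls_times_fps_to_fls fps_to_fls_power)
  qed
  show ?thesis
  proof (rule that)
    have "graded (0 - 3) (c' / P)" "graded (1 - 3) (d' / P)"
      by (intro graded_divide g P)+
    then show "graded 2 (c' / P)" "graded 3 (d' / P)"
      by (auto elim: graded_cong)
    have "e2 ^ 2 = e1 * (fps_to_fls psi / P)"
      using P1 by (simp add: e1_def e2_def P_def field_simps power_numeral_reduce)
    then show "e2 ^ 2 = e1 * (1 + c' / P + d' / P)"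
      unfolding dis using P(1) by (simp add: add_divide_distrib add_ac)
    have "proj 1 (fps_to_fls (psi * psi)) = P ^ 2 + 2 * (c' * d')"
    proof -
      have "fps_to_fls (psi * psi) = c' * c' + (P * P + 2 * (c' * d')) + d' * d' + 2 * (c' * P) + 2 * (d' * P)"
        unfolding fls_times_fps_to_fls dis by (simp add: algebra_simps)
      moreover have "graded (0 + 0) (c' * c')" "graded (3 + 3) (P * P)" "graded (0 + (0 + 1)) (2 * (c' * d'))"
        "graded (1 + 1) (d' * d')" "graded (0 + (0 + 3)) (2 * (c' * P))" "graded (0 + (1 + 3)) (2 * (d' * P))"
        by (intro graded_mult graded_numeral P g)+
      ultimately show ?thesis
        by (simp add: proj_add proj_same proj_other power2_eq_square)
    qed
    moreover have "proj 1 (fps_to_fls (psi * psi)) = 2 * q * (EL 10 ^ 2 / EL 5) ^ 2 - P ^ 2"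
    proof -
      have "proj 1 (fps_to_fls (psi * psi)) = q * fps_to_fls (dil 5 (sec 5 1 (psi * psi)))"
        using proj_fps[of 1 "psi * psi"] by simp
      also have "dil 5 (sec 5 1 (psi * psi)) = 2 * (dil 5 psi * dil 5 psi) - fps_X ^ 5 * (dil 25 psi * dil 25 psi)"
      proof -
        have "dil 5 (dil 5 F) = dil 25 F" for F
          by (rule fps_ext) (auto simp: dil_nth div_mult2_eq[symmetric] elim!: dvdE)
        then show ?thesis
          unfolding psi_hecke by (simp add: dil_mult dil_X)
      qed
      also have "q * fps_to_fls \<dots> = 2 * q * (EL 10 ^ 2 / EL 5) ^ 2 - P ^ 2"
        by (simp add: fls_times_fps_to_fls fps_to_fls_power P25 P5 P_def power_numeral_reduce algebra_simps)
      finally show ?thesis .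
    qed
    ultimately have "P ^ 2 + 2 * (c' * d') = 2 * q * (EL 10 ^ 2 / EL 5) ^ 2 - P ^ 2"
      by simp
    then have "(P ^ 2 + 2 * (c' * d')) / P ^ 2 = (2 * q * (EL 10 ^ 2 / EL 5) ^ 2 - P ^ 2) / P ^ 2"
      by simp
    then have "1 + 2 * (c' * d') / P ^ 2 = 2 * q * (EL 10 ^ 2 / EL 5) ^ 2 / P ^ 2 - 1"
      using P(1) by (simp add: add_divide_distrib diff_divide_distrib)
    moreover have "2 * q * (EL 10 ^ 2 / EL 5) ^ 2 / P ^ 2 = 2 * (EL 10 ^ 4 * EL 25 ^ 2 / (q ^ 5 * EL 5 ^ 2 * EL 50 ^ 4))"
      by (simp add: P_def power_numeral_reduce field_simps)
    ultimately show "1 + 2 * (c' / P) * (d' / P) = 2 * (EL 10 ^ 4 * EL 25 ^ 2 / (q ^ 5 * EL 5 ^ 2 * EL 50 ^ 4)) - 1"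
      by (simp add: power2_eq_square mult.assoc)
  qed
qed

lemma e1_e2_dissection:
  obtains r s where "graded 1 r" "graded 2 s" "r \<noteq> 0" "s \<noteq> 0" "e1 = 1 / r - 1 - r" "e2 = 1 / s - 1 - s"
    "r * s ^ 2 \<noteq> 1" "r * s ^ 2 \<noteq> - 1"
proof -
  obtain A0 A2 where A: "E 1 = A0 - fps_X * E 25 + A2" and gA: "fgr 0 A0" "fgr 2 A2"
    by (rule E1_dissection)
  have A': "E 2 = dil 2 A0 - fps_X ^ 2 * E 50 + dil 2 A2"
    using arg_cong[OF A, of "dil 2"] by (simp add: dil_mult dil_E dil_X)
  have gA': "fgr 0 (dil 2 A0)" "fgr 4 (dil 2 A2)"
    unfolding fgr_def
  proof safe
    fix n assume "fps_nth (dil 2 A0) n \<noteq> 0"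
    then have "even n" "(n div 2) mod 5 = 0" using gA(1) by (auto simp: dil_nth fgr_def split: if_splits)
    then show "n mod 5 = 0" by presburger
  next
    fix n assume "fps_nth (dil 2 A2) n \<noteq> 0"
    then have "even n" "(n div 2) mod 5 = 2" using gA(2) by (auto simp: dil_nth fgr_def split: if_splits)
    then show "n mod 5 = 4" by presburger
  qed
  define u v where "u = q * EL 25" and "v = q ^ 2 * EL 50"
  have uv: "u \<noteq> 0" "v \<noteq> 0" by (simp_all add: u_def v_def)
  have gu: "graded 1 u"
    using graded_mult[OF graded_X graded_EL[of 25]] by (simp add: u_def)
  have gv: "graded 2 v"
    using graded_mult[OF graded_power[OF graded_X, of 2] graded_EL[of 50]] by (simp add: v_def)
  define x r y s where "x = fps_to_fls A0 / u" and "r = - fps_to_fls A2 / u"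
    and "y = fps_to_fls (dil 2 A0) / v" and "s = - fps_to_fls (dil 2 A2) / v"
  have gx: "graded 4 x"
    unfolding x_def by (rule graded_cong[OF graded_divide[OF graded_fgr[OF gA(1)] gu]]) simp
  have gr: "graded 1 r"
    unfolding r_def by (rule graded_cong[OF graded_divide[OF graded_uminus[OF graded_fgr[OF gA(2)]] gu]]) simp
  have gy: "graded 3 y"
    unfolding y_def by (rule graded_cong[OF graded_divide[OF graded_fgr[OF gA'(1)] gv]]) simp
  have gs: "graded 2 s"
    unfolding s_def by (rule graded_cong[OF graded_divide[OF graded_uminus[OF graded_fgr[OF gA'(2)]] gv]]) simp
  have e1: "e1 = x - 1 - r"
  proof -
    have "EL 1 = fps_to_fls A0 - u + fps_to_fls A2"
      using arg_cong[OF A, of fps_to_fls] by (simp add: u_def fls_times_fps_to_fls)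
    then show ?thesis
      using uv by (simp add: e1_def u_def[symmetric] x_def r_def add_divide_distrib diff_divide_distrib)
  qed
  have e2: "e2 = y - 1 - s"
  proof -
    have "EL 2 = fps_to_fls (dil 2 A0) - v + fps_to_fls (dil 2 A2)"
      using arg_cong[OF A', of fps_to_fls] by (simp add: v_def fls_times_fps_to_fls fps_to_fls_power)
    then show ?thesis
      using uv by (simp add: e2_def v_def[symmetric] y_def s_def add_divide_distrib diff_divide_distrib)
  qed
  obtain a b where ab: "graded 1 a" "graded 4 b" "e1 ^ 2 = e2 * (1 + a + b)"
    by (rule phi_normalized)
  \<comment> \<open>Grade 0 of \<open>e1 ^ 2\<close> is \<open>1 - 2 * (x * r)\<close>. In
    \<open>e2 * (1 + a + b)\<close> the grades 3, 0, 2 meet the grades 0, 1, 4 in grade 0 only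
    through the product of -1 and 1.\<close>
  have xr: "x * r = 1"
  proof -
    have "e1 ^ 2 = (1 - 2 * (x * r)) + 2 * r + r * r + x * x + - (2 * x)"
      unfolding e1 by (simp add: power2_eq_square algebra_simps)
    moreover have "graded 0 (1 - 2 * (x * r))"
      by (rule graded_diff[OF graded_1 graded_cong[OF graded_mult[OF graded_numeral graded_mult[OF gx gr]]]]) simp
    moreover have "graded (0 + 1) (2 * r)" "graded (1 + 1) (r * r)" "graded (4 + 4) (x * x)" "graded (0 + 4) (2 * x)"
      by (intro graded_mult graded_numeral gx gr)+
    moreover have "e2 * (1 + a + b) = - 1 + (- a - s * b) + (y * b - s) + (y - s * a) + (y * a - b)"
      unfolding e2 by (simp add: algebra_simps)
    moreover have "graded (2 + 4) (s * b)" "graded (3 + 4) (y * b)" "graded (2 + 1) (s * a)" "graded (3 + 1) (y * a)"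
      by (intro graded_mult gs gy ab)+
    then have "graded 1 (- a - s * b)" "graded 2 (y * b - s)" "graded 3 (y - s * a)" "graded 4 (y * a - b)"
      using ab gs gy by (auto intro!: graded_diff graded_uminus elim: graded_cong)
    ultimately have "1 - 2 * (x * r) = - 1"
      using ab(3) by (intro graded_unique5(1)[of "1 - 2 * (x * r)" "2 * r" "r * r" "x * x" "- (2 * x)"
         "- 1" "- a - s * b" "y * b - s" "y - s * a" "y * a - b"])
        (auto intro: graded_uminus graded_1 elim: graded_cong)
    then show ?thesis by simp
  qed
  \<comment> \<open>The relation is carried back to power series so that the substitution q -> q^2
    yields its analogue \<open>y * s = 1\<close>.\<close>
  then have "- (fps_to_fls A0 * fps_to_fls A2) = u * u"
    using uv by (simp add: x_def r_def field_simps)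
  then have "fps_to_fls A0 * fps_to_fls A2 = - (u * u)"
    by (metis minus_minus)
  then have "fps_to_fls (A0 * A2) = fps_to_fls (- (fps_X ^ 2 * E 25 ^ 2))"
    by (simp add: u_def fls_times_fps_to_fls fps_to_fls_power power2_eq_square algebra_simps)
  then have "A0 * A2 = - (fps_X ^ 2 * E 25 ^ 2)"
    by (simp only: fps_to_fls_eq_iff)
  then have "dil 2 (A0 * A2) = dil 2 (- (fps_X ^ 2 * E 25 ^ 2))"
    by (rule arg_cong)
  then have "fps_to_fls (dil 2 A0 * dil 2 A2) = fps_to_fls (- ((fps_X ^ 2) ^ 2 * E 50 ^ 2))"
    by (simp add: dil_mult dil_power dil_X dil_E)
  then have "fps_to_fls (dil 2 A0) * fps_to_fls (dil 2 A2) = - ((q ^ 2) ^ 2 * EL 50 ^ 2)"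
    unfolding fls_times_fps_to_fls by (simp add: fls_times_fps_to_fls fps_to_fls_power)
  then have ys: "y * s = 1"
    using uv by (simp add: y_def s_def v_def field_simps power2_eq_square)
  \<comment> \<open>\<open>A2\<close> has order at least 2, hence \<open>r * s ^ 2\<close> has order
    at least 5 and cannot be a nonzero constant.\<close>
  define H where "H = fps_shift 2 A2"
  have H: "A2 = fps_X ^ 2 * H"
  proof (rule fps_ext)
    fix n
    have "fps_nth A2 n = 0" if "n < 2"
      using gA(2) that by (cases "fps_nth A2 n = 0") (auto simp: fgr_def)
    then show "fps_nth A2 n = fps_nth (fps_X ^ 2 * H) n"
      unfolding fps_X_power_mult_nth H_def fps_shift_nth by (metis le_add_diff_inverse2 not_less)
  qed
  have k: "r * s ^ 2 * fps_to_fls (E 25 * E 50 ^ 2) = q ^ 5 * fps_to_fls (- (H * dil 2 H ^ 2))"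
    unfolding r_def s_def H u_def v_def
    by (simp add: dil_mult dil_X dil_power fls_times_fps_to_fls fps_to_fls_power field_simps power_numeral_reduce)
  have kn: "r * s ^ 2 \<noteq> z" if "z = 1 \<or> z = - 1" for z
  proof
    assume "r * s ^ 2 = z"
    then have "fls_nth (z * fps_to_fls (E 25 * E 50 ^ 2)) 0 = fls_nth (q ^ 5 * fps_to_fls (- (H * dil 2 H ^ 2))) 0"
      using k by simp
    moreover have "fls_nth (z * fps_to_fls (E 25 * E 50 ^ 2)) 0 \<noteq> 0"
      using that by (auto simp: fps_nth_power_0)
    moreover have "fls_nth (q ^ 5 * fps_to_fls (- (H * dil 2 H ^ 2))) 0 = 0"
      unfolding fls_X_power_times_conv_shift by simp
    ultimately show False by simp
  qed
  have nz: "r \<noteq> 0" "s \<noteq> 0" using xr ys by auto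
  have "x = 1 / r" "y = 1 / s" using xr ys nz by (simp_all add: field_simps)
  then show ?thesis
    using that[OF gr gs nz] e1 e2 kn by simp
qed

section \<open>The quintic extension of the field of level 10 functions\<close>

text \<open>Multiplication table of the basis 1, \<open>e1\<close>, \<open>e2\<close>,
  \<open>f\<close>, \<open>g\<close> over the rational functions of \<open>t\<close>. In the
  application \<open>f = e1^2 / e2\<close> and \<open>g = e2^2 / e1\<close>, which accounts for
  \<open>e1_g\<close>, \<open>e2_f\<close> and \<open>f_g\<close>; the remaining entries carry the
  arithmetic.\<close>

locale quintic_basis =
  fixes t e1 e2 f g :: "'a :: field_char_0"
  assumes t: "t \<noteq> 0"
    and e1_e1: "e1 * e1 = (- 2 - 2 / t) - 2 * e1 + e2 + 2 / t * g"
    and e1_e2: "e1 * e2 = - 5 - 2 * e1 - 2 * e2 + f + g"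
    and e2_e2: "e2 * e2 = (t / 2 - 2) + e1 - 2 * e2 - t / 2 * f"
    and e1_f: "e1 * f = (- 1 - 6 / t) + e1 - f + 2 / t * g"
    and e1_g: "e1 * g = e2 * e2"
    and e2_f: "e2 * f = e1 * e1"
    and e2_g: "e2 * g = (3 * t / 2 - 1) + e2 - t / 2 * f - g"
    and f_f: "f * f = (- 1 - 16 / t) - 4 / t * e2 + 2 * f + 4 / t * g"
    and f_g: "f * g = e1 * e2"
    and g_g: "g * g = (4 * t - 1) + t * e1 - t * f + 2 * g"
begin

definition lin :: "'a \<Rightarrow> 'a \<Rightarrow> 'a \<Rightarrow> 'a \<Rightarrow> 'a \<Rightarrow> 'a" where
  "lin a0 a1 a2 a3 a4 = a0 + a1 * e1 + a2 * e2 + a3 * f + a4 * g"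

lemma lin_mult:
  "lin a0 a1 a2 a3 a4 * lin b0 b1 b2 b3 b4 = lin
    (a0 * b0 + a1 * b1 * (- 2 - 2 / t) - 5 * (a1 * b2 + a2 * b1) + a2 * b2 * (t / 2 - 2)
      + (a1 * b3 + a3 * b1) * (- 1 - 6 / t) + (a1 * b4 + a4 * b1) * (t / 2 - 2) + (a2 * b3 + a3 * b2) * (- 2 - 2 / t)
      + (a2 * b4 + a4 * b2) * (3 * t / 2 - 1) + a3 * b3 * (- 1 - 16 / t) - 5 * (a3 * b4 + a4 * b3) + a4 * b4 * (4 * t - 1))
    (a0 * b1 + a1 * b0 - 2 * (a1 * b1) - 2 * (a1 * b2 + a2 * b1) + a2 * b2 + (a1 * b3 + a3 * b1) + (a1 * b4 + a4 * b1)
      - 2 * (a2 * b3 + a3 * b2) - 2 * (a3 * b4 + a4 * b3) + t * (a4 * b4))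
    (a0 * b2 + a2 * b0 + a1 * b1 - 2 * (a1 * b2 + a2 * b1) - 2 * (a2 * b2) - 2 * (a1 * b4 + a4 * b1) + (a2 * b3 + a3 * b2)
      + (a2 * b4 + a4 * b2) - 4 / t * (a3 * b3) - 2 * (a3 * b4 + a4 * b3))
    (a0 * b3 + a3 * b0 + (a1 * b2 + a2 * b1) - t / 2 * (a2 * b2) - (a1 * b3 + a3 * b1) - t / 2 * (a1 * b4 + a4 * b1)
      - t / 2 * (a2 * b4 + a4 * b2) + 2 * (a3 * b3) + (a3 * b4 + a4 * b3) - t * (a4 * b4))
    (a0 * b4 + a4 * b0 + 2 / t * (a1 * b1) + (a1 * b2 + a2 * b1) + 2 / t * (a1 * b3 + a3 * b1) + 2 / t * (a2 * b3 + a3 * b2)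
      - (a2 * b4 + a4 * b2) + 4 / t * (a3 * b3) + (a3 * b4 + a4 * b3) + 2 * (a4 * b4))"
  (is "_ = ?rhs")
proof -
  have "lin a0 a1 a2 a3 a4 * lin b0 b1 b2 b3 b4
    = a0 * b0 + (a0 * b1 + a1 * b0) * e1 + (a0 * b2 + a2 * b0) * e2 + (a0 * b3 + a3 * b0) * f + (a0 * b4 + a4 * b0) * g
      + a1 * b1 * (e1 * e1) + (a1 * b2 + a2 * b1) * (e1 * e2) + a2 * b2 * (e2 * e2)
      + (a1 * b3 + a3 * b1) * (e1 * f) + (a1 * b4 + a4 * b1) * (e1 * g) + (a2 * b3 + a3 * b2) * (e2 * f)
      + (a2 * b4 + a4 * b2) * (e2 * g) + a3 * b3 * (f * f) + (a3 * b4 + a4 * b3) * (f * g) + a4 * b4 * (g * g)"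
    unfolding lin_def by (simp add: algebra_simps)
  also have "\<dots> = ?rhs"
    unfolding e1_g e2_f f_g unfolding e1_e1 e1_e2 e2_e2 e1_f e2_g f_f g_g lin_def
    by (simp add: algebra_simps add_divide_distrib)
  finally show ?thesis .
qed

lemma lin_eqI: "a0 = b0 \<Longrightarrow> a1 = b1 \<Longrightarrow> a2 = b2 \<Longrightarrow> a3 = b3 \<Longrightarrow> a4 = b4 \<Longrightarrow> lin a0 a1 a2 a3 a4 = lin b0 b1 b2 b3 b4"
  by simp

text \<open>Up to scalar factors, \<open>inv_e1\<close>, \<open>inv_f\<close>, \<open>inv_f2\<close> and \<open>inv_f2_e1\<close> are \<open>1 / e1\<close>, \<open>1 / f\<close>, \<open>1 / f\<^sup>2\<close>
  and \<open>1 / (f\<^sup>2 e1)\<close>.\<close>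

definition inv_e1 :: 'a where
  "inv_e1 = lin (t * (t^2 + 22 * t - 4)) (t * (8 * (t + 1))) (t * (2 * (t - 4))) (- t * (t^2 + 4 * t + 8)) (t * (2 * (t + 6)))"

definition inv_f :: 'a where
  "inv_f = lin (t * (2 * t^2 + 44 * t - 8)) (t * (16 * (t + 1))) (t * (4 * (t - 4))) (- t * (t * (t + 16))) (t * (4 * (t + 6)))"

definition inv_f2 :: 'a where
  "inv_f2 = lin (t * (- 512 + 1280 * t + 2240 * t^2 + 2720 * t^3 + 400 * t^4 + 3 * t^5)) (t^2 * (t + 1) * (1280 + 960 * t + 80 * t^2))
       (t^2 * (t - 4) * (320 + 240 * t + 20 * t^2)) (t^2 * (- 512 - 1088 * t - 992 * t^2 - 168 * t^3 - 2 * t^4))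
       (t * (512 + 2048 * t + 1472 * t^2 + 448 * t^3 + 12 * t^4))"

definition inv_f2_e1 :: 'a where
  "inv_f2_e1 = lin (t^2 * (- 16384 + 54272 * t + 170496 * t^2 + 160960 * t^3 + 97760 * t^4 + 21836 * t^5 + 822 * t^6 + t^7))
       (2 * t^2 * (t + 1) * (4096 + 35840 * t + 32000 * t^2 + 17920 * t^3 + 2720 * t^4 + 56 * t^5))
       (2 * t^2 * (t - 4) * (2048 + 7680 * t + 8640 * t^2 + 4320 * t^3 + 700 * t^4 + 13 * t^5))
       (- (t^3 * (34816 + 70656 * t + 67840 * t^2 + 37120 * t^3 + 8640 * t^4 + 396 * t^5 + t^6)))
       (2 * t^2 * (20480 + 58880 * t + 57600 * t^2 + 31200 * t^3 + 9600 * t^4 + 730 * t^5 + 5 * t^6))"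

text \<open>The coordinates of \<open>inv_e1\<close> solve the linear system for the inverse of
  \<open>e1\<close> with denominators cleared, and are checked coordinatewise through
  \<open>lin_mult\<close>. The scalar has only the factors \<open>t - 4\<close> and
  \<open>t + 1\<close>, which become eta quotients.\<close>

lemma inv_e1: "inv_e1 * e1 = 2 * (t - 4)^2 * (t + 1)"
proof -
  have 1: "e1 = lin 0 1 0 0 0" and 2: "2 * (t - 4)^2 * (t + 1) = lin (2 * (t - 4)^2 * (t + 1)) 0 0 0 0"
    by (simp_all add: lin_def)
  show ?thesis
    using t unfolding inv_e1_def
    by (subst 1, subst 2, simp only: lin_mult) (rule lin_eqI; simp add: field_simps power2_eq_square)
qed

lemma inv_f: "inv_f * f = (t - 4)^3"
proof -
  have 1: "f = lin 0 0 0 1 0" and 2: "(t - 4)^3 = lin ((t - 4)^3) 0 0 0 0"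
    by (simp_all add: lin_def)
  show ?thesis
    using t unfolding inv_f_def
    by (subst 1, subst 2, simp only: lin_mult) (rule lin_eqI; simp add: field_simps power2_eq_square power3_eq_cube)
qed

lemma inv_f_square: "inv_f * inv_f = inv_f2"
  unfolding inv_f_def inv_f2_def
  using t by (simp only: lin_mult) (rule lin_eqI; simp add: field_simps power_numeral_reduce)

lemma inv_f2_mult_e1: "inv_f2 * inv_e1 = inv_f2_e1"
  unfolding inv_e1_def inv_f2_def inv_f2_e1_def
  using t by (simp only: lin_mult) (rule lin_eqI; simp add: field_simps power_numeral_reduce)

lemma g_power4:
  "g ^ 4 = lin (17 * t^2 + 14 * t - 3) (4 * t^2 + 14 * t) (t^2 - 4 * t) (- 6 * t^2 - 6 * t) (14 * t + 4)"
proof -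
  have "g ^ 4 = (g * g) * (g * g)" by (simp add: power_numeral_reduce)
  also have "g * g = lin (4 * t - 1) t 0 (- t) 2"
    unfolding g_g lin_def by simp
  also have "lin (4 * t - 1) t 0 (- t) 2 * lin (4 * t - 1) t 0 (- t) 2
    = lin (17 * t^2 + 14 * t - 3) (4 * t^2 + 14 * t) (t^2 - 4 * t) (- 6 * t^2 - 6 * t) (14 * t + 4)"
    using t by (simp only: lin_mult) (rule lin_eqI; simp add: field_simps power2_eq_square)
  finally show ?thesis .
qed

end

text \<open>Each table entry is a polynomial identity modulo the three relations on
  \<open>r\<close>, \<open>R\<close>, \<open>s\<close>, \<open>S\<close>, once denominators
  \<open>t\<close> and 2 are multiplied out. The assumption \<open>rel\<close> is the classical
  relation between the Rogers-Ramanujan continued fraction at q and at q^2.\<close>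

lemma quintic_basis_param:
  fixes r R s S t e1 e2 f g :: "'a :: field_char_0"
  assumes rR: "r * R = 1" and sS: "s * S = 1" and rel: "s - r^2 = r * s^2 * (r^2 + s)"
    and t: "t = R * S^2 - r * s^2" and e1: "e1 = R - 1 - r" and e2: "e2 = S - 1 - s"
    and f: "f = 1 + S^2 - S * R^2 + s * r^2 + s^2" and g: "g = 1 + r * S^2 + r^2 + R^2 - R * s^2"
    and t0: "t \<noteq> 0"
  shows "quintic_basis t e1 e2 f g"
proof
  show "t \<noteq> 0" by (rule t0)
  have "t * (e1 * e1) = - 2 * (t + 1) - 2 * t * e1 + t * e2 + 2 * g"
    unfolding t e1 e2 f g using rR sS rel by algebra
  then show "e1 * e1 = (- 2 - 2 / t) - 2 * e1 + e2 + 2 / t * g"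
    using t0 by (simp add: field_simps)
  show "e1 * e2 = - 5 - 2 * e1 - 2 * e2 + f + g"
    unfolding t e1 e2 f g using rR sS rel by algebra
  have "2 * (e2 * e2) = (t - 4) + 2 * e1 - 4 * e2 - t * f"
    unfolding t e1 e2 f g using rR sS rel by algebra
  then have "e2 * e2 = ((t - 4) + 2 * e1 - 4 * e2 - t * f) / 2"
    by (simp add: eq_divide_eq mult.commute)
  then show "e2 * e2 = (t / 2 - 2) + e1 - 2 * e2 - t / 2 * f"
    by (simp add: add_divide_distrib diff_divide_distrib)
  have "t * (e1 * f) = - (6 + t) + t * e1 - t * f + 2 * g"
    unfolding t e1 e2 f g using rR sS rel by algebra
  then show "e1 * f = (- 1 - 6 / t) + e1 - f + 2 / t * g"
    using t0 by (simp add: field_simps)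
  show "e1 * g = e2 * e2"
    unfolding t e1 e2 f g using rR sS rel by algebra
  show "e2 * f = e1 * e1"
    unfolding t e1 e2 f g using rR sS rel by algebra
  have "2 * (e2 * g) = 3 * t - 2 + 2 * e2 - t * f - 2 * g"
    unfolding t e1 e2 f g using rR sS rel by algebra
  then have "e2 * g = (3 * t - 2 + 2 * e2 - t * f - 2 * g) / 2"
    by (simp add: eq_divide_eq mult.commute)
  then show "e2 * g = (3 * t / 2 - 1) + e2 - t / 2 * f - g"
    by (simp add: add_divide_distrib diff_divide_distrib)
  have "t * (f * f) = - (16 + t) - 4 * e2 + 2 * t * f + 4 * g"
    unfolding t e1 e2 f g using rR sS rel by algebra
  then have "f * f = (- (16 + t) - 4 * e2 + 2 * t * f + 4 * g) / t"
    using t0 by (simp add: eq_divide_eq mult.commute)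
  then show "f * f = (- 1 - 16 / t) - 4 / t * e2 + 2 * f + 4 / t * g"
    using t0 by (simp add: add_divide_distrib diff_divide_distrib)
  show "f * g = e1 * e2"
    unfolding t e1 e2 f g using rR sS rel by algebra
  show "g * g = (4 * t - 1) + t * e1 - t * f + 2 * g"
    unfolding t e1 e2 f g using rR sS rel by algebra
qed

section \<open>The quintic basis realised by eta quotients\<close>

definition ff :: "rat fls" where "ff = e1 ^ 2 / e2"
definition gg :: "rat fls" where "gg = e2 ^ 2 / e1"
definition ww :: "rat fls" where "ww = EL 5 ^ 3 * EL 25 / (q ^ 5 * EL 10 * EL 50 ^ 3)"

lemma level10_relations:
  "quintic_basis tt e1 e2 ff gg"
  "proj 0 e1 = - 1" "proj 0 e2 = - 1" "proj 0 ff = 1" "proj 0 gg = 1"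
  "tt = ww + 4" "tt + 1 = EL 10 ^ 4 * EL 25 ^ 2 / (q ^ 5 * EL 5 ^ 2 * EL 50 ^ 4)"
proof -
  obtain r s where rs: "graded 1 r" "graded 2 s" "r \<noteq> 0" "s \<noteq> 0" "e1 = 1 / r - 1 - r" "e2 = 1 / s - 1 - s"
    "r * s ^ 2 \<noteq> 1" "r * s ^ 2 \<noteq> - 1"
    by (rule e1_e2_dissection)
  obtain a b where ab: "graded 1 a" "graded 4 b" "e1 ^ 2 = e2 * (1 + a + b)" "a * b = - 4 / tt"
    "1 + 2 * a * b = 2 * (EL 5 ^ 4 * EL 50 ^ 2 / (EL 10 ^ 2 * EL 25 ^ 4)) - 1"
    by (rule phi_normalized)
  obtain c d where cd: "graded 2 c" "graded 3 d" "e2 ^ 2 = e1 * (1 + c + d)"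
    "1 + 2 * c * d = 2 * (EL 10 ^ 4 * EL 25 ^ 2 / (q ^ 5 * EL 5 ^ 2 * EL 50 ^ 4)) - 1"
    by (rule psi_normalized)
  define R S where "R = 1 / r" and "S = 1 / s"
  have rR: "r * R = 1" and sS: "s * S = 1" and e1: "e1 = R - 1 - r" and e2: "e2 = S - 1 - s"
    using rs by (simp_all add: R_def S_def)
  have gR: "graded 4 R"
    unfolding R_def by (rule graded_cong[OF graded_divide[OF graded_1 rs(1)]]) simp
  have gS: "graded 3 S"
    unfolding S_def by (rule graded_cong[OF graded_divide[OF graded_1 rs(2)]]) simp
  have g1: "graded 0 (- 1)" by (intro graded_uminus graded_1)
  have cong: "graded i x \<Longrightarrow> i mod 5 = j mod 5 \<Longrightarrow> graded j x" for i j x by (rule graded_cong)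
  have phi_rel: "2 * r = - a - s * b" "r * r = S * b - s" "R * R = S - s * a"
  proof -
    have eq: "- 1 + 2 * r + r * r + R * R + - (2 * R) = - 1 + (- a - s * b) + (S * b - s) + (S - s * a) + (S * a - b)"
    proof -
      have "e1 ^ 2 = - 1 + 2 * r + r * r + R * R + - (2 * R)"
        unfolding e1 using rR by (simp add: power2_eq_square algebra_simps)
      moreover have "e2 * (1 + a + b) = - 1 + (- a - s * b) + (S * b - s) + (S - s * a) + (S * a - b)"
        unfolding e2 by (simp add: algebra_simps)
      ultimately show ?thesis using ab(3) by simp
    qed
    have m: "graded (0 + 1) (2 * r)" "graded (1 + 1) (r * r)" "graded (4 + 4) (R * R)" "graded (0 + 4) (2 * R)"
      "graded (2 + 4) (s * b)" "graded (3 + 4) (S * b)" "graded (2 + 1) (s * a)" "graded (3 + 1) (S * a)"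
      by (intro graded_mult graded_numeral rs gR gS ab)+
    have m': "graded 1 (2 * r)" "graded 2 (r * r)" "graded 3 (R * R)" "graded 4 (- (2 * R))"
      "graded 1 (- a - s * b)" "graded 2 (S * b - s)" "graded 3 (S - s * a)" "graded 4 (S * a - b)"
      using m rs(2) gS ab by (auto intro!: graded_diff graded_uminus elim: graded_cong)
    show "2 * r = - a - s * b" "r * r = S * b - s" "R * R = S - s * a"
      by (rule graded_unique5[OF eq g1 m'(1-4) g1 m'(5-8)])+
  qed
  have psi_rel: "S * S = R * c - r" "s * s = R - r * d"
  proof -
    have eq: "- 1 + S * S + 2 * s + - (2 * S) + s * s = - 1 + (R * c - r) + (R * d - c) + (- d - r * c) + (R - r * d)"
    proof -
      have "e2 ^ 2 = - 1 + S * S + 2 * s + - (2 * S) + s * s"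
        unfolding e2 using sS by (simp add: power2_eq_square algebra_simps)
      moreover have "e1 * (1 + c + d) = - 1 + (R * c - r) + (R * d - c) + (- d - r * c) + (R - r * d)"
        unfolding e1 by (simp add: algebra_simps)
      ultimately show ?thesis using cd(3) by simp
    qed
    have m: "graded (3 + 3) (S * S)" "graded (0 + 2) (2 * s)" "graded (0 + 3) (2 * S)" "graded (2 + 2) (s * s)"
      "graded (4 + 2) (R * c)" "graded (4 + 3) (R * d)" "graded (1 + 2) (r * c)" "graded (1 + 3) (r * d)"
      by (intro graded_mult graded_numeral rs gR gS cd)+
    have m': "graded 1 (S * S)" "graded 2 (2 * s)" "graded 3 (- (2 * S))" "graded 4 (s * s)"
      "graded 1 (R * c - r)" "graded 2 (R * d - c)" "graded 3 (- d - r * c)" "graded 4 (R - r * d)"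
      using m rs(1) gR cd by (auto intro!: graded_diff graded_uminus elim: graded_cong)
    show "S * S = R * c - r" "s * s = R - r * d"
      by (rule graded_unique5[OF eq g1 m'(1-4) g1 m'(5-8)])+
  qed
  \<comment> \<open>Grades 3 and 2 of the phi equation determine \<open>a\<close> and
    \<open>b\<close>; grades 1 and 4 of the psi equation determine \<open>c\<close> and
    \<open>d\<close>.\<close>
  have a: "a = (S - R ^ 2) * S" and b: "b = s * (r ^ 2 + s)"
    using phi_rel sS by algebra+
  have c: "c = r * (S ^ 2 + r)" and d: "d = (R - s ^ 2) * R"
    using psi_rel rR by algebra+
  \<comment> \<open>What is left of the phi equation is its grade 1 part. With \<open>a\<close> and
    \<open>b\<close> inserted it factors, and the factor \<open>1 + r * s ^ 2\<close> is
    nonzero.\<close>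
  have rel: "s - r ^ 2 = r * s ^ 2 * (r ^ 2 + s)"
  proof -
    have "(1 + r * s ^ 2) * (s - r ^ 2 - r * s ^ 2 * (r ^ 2 + s)) = 0"
      using phi_rel(1) rR sS unfolding a b by algebra
    moreover have "1 + r * s ^ 2 \<noteq> 0"
      using rs(8) by (metis add.commute add_eq_0_iff2)
    ultimately show ?thesis by simp
  qed
  \<comment> \<open>The eta quotient \<open>tt\<close> and the expression in \<open>r\<close> and
    \<open>s\<close> both have product -4 with \<open>a * b\<close>, so they coincide.\<close>
  have tt: "tt = R * S ^ 2 - r * s ^ 2"
  proof -
    have "a * b * tt = - 4"
      using ab(4) e_nz(3) by simp
    moreover have "a * b * (R * S ^ 2 - r * s ^ 2) = - 4"
      unfolding a b using rR sS rel by algebra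
    ultimately have "a * b * tt = a * b * (R * S ^ 2 - r * s ^ 2)" by simp
    moreover have "a * b \<noteq> 0" using \<open>a * b * tt = - 4\<close> by auto
    ultimately show ?thesis by simp
  qed
  have ff: "ff = 1 + a + b" and gg: "gg = 1 + c + d"
    using ab(3) cd(3) e_nz by (simp_all add: ff_def gg_def)
  show "quintic_basis tt e1 e2 ff gg"
  proof (rule quintic_basis_param[OF rR sS rel tt e1 e2 _ _ e_nz(3)])
    show "ff = 1 + S^2 - S * R^2 + s * r^2 + s^2"
      unfolding ff a b by (simp add: power2_eq_square algebra_simps)
    show "gg = 1 + r * S^2 + r^2 + R^2 - R * s^2"
      unfolding gg c d by (simp add: power2_eq_square algebra_simps)
  qed
  have p1: "proj 0 1 = 1" by (rule proj_same[OF graded_1]) simp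
  show "proj 0 e1 = - 1" "proj 0 e2 = - 1" "proj 0 ff = 1" "proj 0 gg = 1"
    unfolding e1 e2 ff gg proj_add proj_diff p1
    by (simp_all add: proj_other[OF gR] proj_other[OF rs(1)] proj_other[OF gS] proj_other[OF rs(2)]
        proj_other[OF ab(1)] proj_other[OF ab(2)] proj_other[OF cd(1)] proj_other[OF cd(2)])
  \<comment> \<open>The two Hecke relations enter here: \<open>1 + a * b\<close> with
    \<open>a * b = - 4 / tt\<close> identifies \<open>tt - 4\<close>, and \<open>1 + c * d\<close>
    with \<open>c * d = tt\<close> identifies \<open>tt + 1\<close>.\<close>
  have Z: "1 - 4 / tt = EL 5 ^ 4 * EL 50 ^ 2 / (EL 10 ^ 2 * EL 25 ^ 4)"
  proof -
    define Z where "Z = EL 5 ^ 4 * EL 50 ^ 2 / (EL 10 ^ 2 * EL 25 ^ 4)"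
    have "2 * (1 + a * b) = 2 * Z"
      using ab(5) unfolding Z_def[symmetric] by (simp add: algebra_simps)
    then have "1 + a * b = Z" by (simp only: mult_left_cancel[OF zero_neq_numeral[symmetric]])
    then show ?thesis using ab(4) by (simp add: Z_def)
  qed
  have "tt - 4 = tt * (1 - 4 / tt)"
    using e_nz(3) by (simp add: algebra_simps)
  also have "\<dots> = ww"
    unfolding Z by (simp add: tt_def ww_def field_simps power_numeral_reduce)
  finally show "tt = ww + 4" by (simp add: algebra_simps)
  have "c * d = tt"
    unfolding c d tt using rR sS by algebra
  define Z' where "Z' = EL 10 ^ 4 * EL 25 ^ 2 / (q ^ 5 * EL 5 ^ 2 * EL 50 ^ 4)"
  have "2 * (1 + c * d) = 2 * Z'"
    using cd(4) unfolding Z'_def[symmetric] by (simp add: algebra_simps)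
  then have "1 + c * d = Z'" by (simp only: mult_left_cancel[OF zero_neq_numeral[symmetric]])
  then show "tt + 1 = EL 10 ^ 4 * EL 25 ^ 2 / (q ^ 5 * EL 5 ^ 2 * EL 50 ^ 4)"
    using \<open>c * d = tt\<close> by (simp add: Z'_def add.commute)
qed

interpretation Q: quintic_basis tt e1 e2 ff gg
  by (rule level10_relations(1))

section \<open>Traces in the quintic basis\<close>

lemma proj_mult0: "graded 0 f \<Longrightarrow> proj 0 (f * g) = f * proj 0 g"
  using proj_mult[of 0 f 0 g] by simp

lemma graded0_mult: "graded 0 f \<Longrightarrow> graded 0 g \<Longrightarrow> graded 0 (f * g)"
  using graded_mult[of 0 f 0 g] by simp

lemma graded0_power: "graded 0 f \<Longrightarrow> graded 0 (f ^ n)"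
  using graded_power[of 0 f n] by simp

lemma graded0_divide: "graded 0 f \<Longrightarrow> graded 0 g \<Longrightarrow> graded 0 (f / g)"
  using graded_divide[of 0 f 0 g] by simp

lemmas graded0_intros = graded_add graded_diff graded_uminus graded0_mult graded0_power graded0_divide
  graded_0 graded_1 graded_numeral graded_tt

text \<open>\<open>proj 0\<close> is linear over series of grade 0. It is the average over the
  substitutions of zeta q for q with zeta^5 = 1, a fifth of the trace, and takes the values 1, -1,
  -1, 1, 1 on the basis.\<close>

lemma proj_lin:
  assumes "graded 0 a0" "graded 0 a1" "graded 0 a2" "graded 0 a3" "graded 0 a4"
  shows "proj 0 (Q.lin a0 a1 a2 a3 a4) = a0 - a1 - a2 + a3 + a4"
  unfolding Q.lin_def proj_add
  by (simp add: proj_mult0 assms level10_relations proj_same[OF assms(1)])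

text \<open>The trace form in the basis. It gives the trace of a product directly, so the large
  products below need not be expanded into five coordinates.\<close>

lemma proj_lin_mult:
  assumes a: "graded 0 a0" "graded 0 a1" "graded 0 a2" "graded 0 a3" "graded 0 a4"
    and b: "graded 0 b0" "graded 0 b1" "graded 0 b2" "graded 0 b3" "graded 0 b4"
  shows "proj 0 (Q.lin a0 a1 a2 a3 a4 * Q.lin b0 b1 b2 b3 b4)
    = a0 * (b0 - b1 - b2 + b3 + b4) + a1 * (- b0 - b1 + b2 - b4) + a2 * (- b0 + b1 - b2 - b3 + (tt - 3) * b4)
      + a3 * (b0 - b2 + b3 + b4) + a4 * (b0 - b1 + (tt - 3) * b2 + b3 + (2 * tt + 1) * b4)
      - (3 + 4 / tt) * (a1 * b3 + a3 * b1) - 8 / tt * (a3 * b3)"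
  unfolding Q.lin_mult
  by (subst proj_lin, (intro graded0_intros a b)+) (simp add: algebra_simps add_divide_distrib diff_divide_distrib)

lemma proj_scaled:
  assumes "D * F = G" "graded 0 D" "D \<noteq> 0"
  shows "proj 0 F = proj 0 G / D"
proof -
  have "proj 0 G = D * proj 0 F"
    unfolding assms(1)[symmetric] by (rule proj_mult0[OF assms(2)])
  with assms(3) show ?thesis by simp
qed

lemma ww_nz: "ww \<noteq> 0"
  by (simp add: ww_def)

lemma tt1_nz: "tt + 1 \<noteq> 0"
  unfolding level10_relations(7) by simp

lemma tt4: "tt - 4 = ww"
  using level10_relations(6) by (metis add_diff_cancel_right')

lemma graded_ww: "graded 0 ww"
  unfolding tt4[symmetric] by (intro graded0_intros)

text \<open>This and the next three projections treat \<open>e1 ^ 2 * (e2 / e1 ^ 3) ^ k\<close> for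
  k = 1, 2, 3, 4, the shapes of the terms of \<open>rhs1\<close>; for k > 1 they are written with
  \<open>ff = e1 ^ 2 / e2\<close>, whose inverse is tabulated.\<close>

lemma proj_e2_e1: "proj 0 (e2 / e1) = tt / ww"
proof -
  have "proj 0 (e2 / e1) = proj 0 (Q.lin 0 0 1 0 0 * Q.inv_e1) / (2 * ww^2 * (tt + 1))"
  proof (rule proj_scaled)
    have "e2 = Q.lin 0 0 1 0 0" by (simp add: Q.lin_def)
    moreover have "Q.inv_e1 = (2 * ww^2 * (tt + 1)) / e1"
      using Q.inv_e1 e_nz(1) by (simp add: tt4 field_simps)
    ultimately show "2 * ww^2 * (tt + 1) * (e2 / e1) = Q.lin 0 0 1 0 0 * Q.inv_e1" by simp
  qed (use ww_nz tt1_nz in \<open>auto intro!: graded0_intros graded_ww\<close>)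
  also have "proj 0 (Q.lin 0 0 1 0 0 * Q.inv_e1) = 2 * tt * (tt - 4) * (tt + 1)"
    unfolding Q.inv_e1_def
    by (subst proj_lin_mult, (intro graded0_intros)+) (simp add: algebra_simps power2_eq_square)
  also have "\<dots> / (2 * ww^2 * (tt + 1)) = tt / ww"
    unfolding tt4 by (subst frac_eq_eq) (use ww_nz tt1_nz in \<open>auto simp: power2_eq_square\<close>)
  finally show ?thesis .
qed

lemma ff_nz: "ff \<noteq> 0"
  using e_nz by (simp add: ff_def)

lemma inv_f_eq: "Q.inv_f = ww ^ 3 / ff"
  using Q.inv_f ff_nz by (simp add: tt4 field_simps)

lemma inv_e1_eq: "Q.inv_e1 = 2 * ww ^ 2 * (tt + 1) / e1"
  using Q.inv_e1 e_nz(1) by (simp add: tt4 field_simps)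

lemma inv_f2_eq: "Q.inv_f2 = ww ^ 6 / ff ^ 2"
  unfolding Q.inv_f_square[symmetric] inv_f_eq by (simp add: power2_eq_square flip: power_add)

lemma inv_f2_e1_eq: "Q.inv_f2_e1 = 2 * ww ^ 8 * (tt + 1) / (ff ^ 2 * e1)"
  unfolding Q.inv_f2_mult_e1[symmetric] inv_f2_eq inv_e1_eq by (simp flip: power_add)

lemma proj_f_minus2:
  "proj 0 (1 / ff ^ 2) = tt^2 * (2816 + 1024 * tt + 976 * tt^2 + 144 * tt^3 + tt^4) / ww^6"
proof -
  have "proj 0 (1 / ff ^ 2) = proj 0 Q.inv_f2 / ww ^ 6"
    by (rule proj_scaled) (use ww_nz in \<open>auto simp: inv_f2_eq intro!: graded0_intros graded_ww\<close>)
  also have "proj 0 Q.inv_f2 = tt^2 * (2816 + 1024 * tt + 976 * tt^2 + 144 * tt^3 + tt^4)"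
    unfolding Q.inv_f2_def
    by (subst proj_lin, (intro graded0_intros)+) (simp add: algebra_simps power_numeral_reduce)
  finally show ?thesis .
qed

lemma proj_f_minus3_e1:
  "proj 0 (1 / (ff ^ 3 * e1)) = tt^3 * (2293760 + 6881280 * tt + 9236480 * tt^2 + 7234560 * tt^3
    + 3827200 * tt^4 + 1498560 * tt^5 + 362480 * tt^6 + 27780 * tt^7 + 385 * tt^8) / (ww^11 * (tt + 1))"
  (is "_ = tt^3 * ?P / _")
proof -
  have "proj 0 (1 / (ff ^ 3 * e1)) = proj 0 (Q.inv_f2_e1 * Q.inv_f) / (2 * (ww ^ 11 * (tt + 1)))"
  proof (rule proj_scaled)
    have 1: "ff ^ 2 * e1 * ff = ff ^ 3 * e1" and 2: "2 * ww ^ 8 * (tt + 1) * ww ^ 3 = 2 * (ww ^ 11 * (tt + 1))"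
      by (simp_all add: power_numeral_reduce mult_ac)
    show "2 * (ww ^ 11 * (tt + 1)) * (1 / (ff ^ 3 * e1)) = Q.inv_f2_e1 * Q.inv_f"
      unfolding inv_f2_e1_eq inv_f_eq times_divide_times_eq 1 2 by simp
  qed (use ww_nz tt1_nz in \<open>auto intro!: graded0_intros graded_ww\<close>)
  also have "proj 0 (Q.inv_f2_e1 * Q.inv_f) = 2 * (tt^3 * ?P)"
    unfolding Q.inv_f2_e1_def Q.inv_f_def
    by (subst proj_lin_mult, (intro graded0_intros)+)
       (use e_nz(3) in \<open>simp add: field_simps power_numeral_reduce\<close>)
  finally show ?thesis by simp
qed

text \<open>The argument is the square of \<open>1 / (ff ^ 2 * e1)\<close>, so the trace form
  applied twice to the same tabulated inverse suffices.\<close>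

lemma proj_f_minus4_e1_minus2:
  "proj 0 (1 / (ff ^ 4 * e1 ^ 2)) = tt^4 * (1342177280 + 9646899200 * tt + 27535605760 * tt^2 + 43767562240 * tt^3
    + 45983334400 * tt^4 + 35288514560 * tt^5 + 20633600000 * tt^6 + 9188024320 * tt^7 + 3097057280 * tt^8
    + 748518400 * tt^9 + 102353280 * tt^10 + 5884800 * tt^11 + 103935 * tt^12 + 290 * tt^13) / (ww^16 * (tt + 1)^2)"
  (is "_ = tt^4 * ?P / _")
proof -
  have "proj 0 (1 / (ff ^ 4 * e1 ^ 2)) = proj 0 (Q.inv_f2_e1 * Q.inv_f2_e1) / (4 * (ww ^ 16 * (tt + 1)^2))"
  proof (rule proj_scaled)
    have 1: "ff ^ 2 * e1 * (ff ^ 2 * e1) = ff ^ 4 * e1 ^ 2"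
      and 2: "2 * ww ^ 8 * (tt + 1) * (2 * ww ^ 8 * (tt + 1)) = 4 * (ww ^ 16 * (tt + 1)^2)"
      by (simp_all add: power_numeral_reduce algebra_simps)
    show "4 * (ww ^ 16 * (tt + 1)^2) * (1 / (ff ^ 4 * e1 ^ 2)) = Q.inv_f2_e1 * Q.inv_f2_e1"
      unfolding inv_f2_e1_eq times_divide_times_eq 1 2 by simp
  qed (use ww_nz tt1_nz in \<open>auto intro!: graded0_intros graded_ww\<close>)
  also have "proj 0 (Q.inv_f2_e1 * Q.inv_f2_e1) = 4 * (tt^4 * ?P)"
    unfolding Q.inv_f2_e1_def
    by (subst proj_lin_mult, (intro graded0_intros)+)
       (use e_nz(3) in \<open>simp add: field_simps power_numeral_reduce\<close>)
  finally show ?thesis by simp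
qed

text \<open>\<open>gg ^ 4 / ff\<close> equals \<open>e2 ^ 9 / e1 ^ 6\<close>, the normalised
  generating function of the values at odd arguments.\<close>

lemma proj_g4_f:
  "proj 0 (gg ^ 4 / ff) = tt * (528 + 1452 * tt + 713 * tt^2 + 432 * tt^3 + 18 * tt^4) / ww ^ 3"
proof -
  have "proj 0 (gg ^ 4 / ff) = proj 0 (gg ^ 4 * Q.inv_f) / ww ^ 3"
    by (rule proj_scaled) (use ww_nz in \<open>auto simp: inv_f_eq intro!: graded0_intros graded_ww\<close>)
  also have "proj 0 (gg ^ 4 * Q.inv_f) = tt * (528 + 1452 * tt + 713 * tt^2 + 432 * tt^3 + 18 * tt^4)"
    unfolding Q.g_power4 Q.inv_f_def
    by (subst proj_lin_mult, (intro graded0_intros)+)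
       (use e_nz(3) in \<open>simp add: field_simps power_numeral_reduce\<close>)
  finally show ?thesis .
qed

section \<open>The two generating functions\<close>

lemma divide_fps_mult:
  fixes F G :: "rat fps"
  assumes "fps_nth G 0 \<noteq> 0"
  shows "F / G * G = F"
  by (simp only: fps_divide_unit[OF assms] mult.assoc inverse_mult_eq_1[OF assms] mult_1_right)

lemma fls_divide_fps:
  fixes F G :: "rat fps"
  assumes "fps_nth G 0 \<noteq> 0"
  shows "fps_to_fls (F / G) = fps_to_fls F / fps_to_fls G"
proof -
  have "fps_to_fls (F / G) * fps_to_fls G = fps_to_fls F"
    by (metis divide_fps_mult[OF assms] fls_times_fps_to_fls)
  moreover have "fps_to_fls G \<noteq> 0" using assms by auto
  ultimately show ?thesis by (simp add: eq_divide_eq)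
qed

abbreviation LD :: "rat fps \<Rightarrow> rat fls" where "LD F \<equiv> fps_to_fls (dil 5 F)"

lemma LD_divide:
  assumes "fps_nth G 0 \<noteq> 0"
  shows "LD (F / G) = LD F / LD G"
proof -
  have "LD (F / G) * LD G = LD F"
    by (metis divide_fps_mult[OF assms] dil_mult fls_times_fps_to_fls zero_less_numeral)
  moreover have "fps_nth (dil 5 G) 0 \<noteq> 0" using assms by (simp add: dil_nth)
  then have "LD G \<noteq> 0" by auto
  ultimately show ?thesis by (simp add: eq_divide_eq)
qed

lemma LD_eqD: "LD F = LD G \<Longrightarrow> F = G"
proof (rule fps_ext)
  fix n assume "LD F = LD G"
  then have "fps_nth (dil 5 F) (5 * n) = fps_nth (dil 5 G) (5 * n)" by simp
  then show "fps_nth F n = fps_nth G n" by (simp add: dil_nth)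
qed

lemma E_power_nth_0: "m > 0 \<Longrightarrow> fps_nth (E m ^ k) 0 = 1"
  by (simp add: fps_nth_power_0)

lemmas fls_hom = fls_times_fps_to_fls fps_to_fls_plus fps_to_fls_power fps_to_fls_numeral fps_X_to_fls

lemma proj_mult_shift: "graded i f \<Longrightarrow> i mod 5 = j mod 5 \<Longrightarrow> proj j (f * g) = f * proj 0 g"
  using proj_mult[of i f 0 g] by (simp add: proj_def)

lemma proj_e1_square: "proj 0 (e1 ^ 2) = - 1"
proof -
  have "e1 ^ 2 = Q.lin 0 1 0 0 0 * Q.lin 0 1 0 0 0"
    by (simp add: Q.lin_def power2_eq_square)
  also have "proj 0 \<dots> = - 1"
    by (subst proj_lin_mult, (intro graded0_intros)+) simp
  finally show ?thesis .
qed

text \<open>\<open>xx\<close> is the Hauptmodul \<open>q E\<^sub>2 E\<^sub>1\<^sub>0\<^sup>3 / (E\<^sub>1\<^sup>3 E\<^sub>5)\<close> at \<open>q\<^sup>5\<close>.\<close>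

definition xx :: "rat fls" where "xx = q ^ 5 * EL 10 * EL 50 ^ 3 / (EL 5 ^ 3 * EL 25)"

lemma xx_ww: "xx = 1 / ww"
  by (simp add: xx_def ww_def)

section \<open>The right-hand sides as polynomials in the Hauptmodul\<close>

definition rhs1 :: "rat fps" where
  "rhs1 = 18 * E 1 ^ 2 * E 10
        + 720 * fps_X * ((E 2 * E 10 ^ 4) / (E 1 * E 5))
        + 7625 * fps_X ^ 2 * ((E 2 ^ 2 * E 10 ^ 7) / (E 1 ^ 4 * E 5 ^ 2))
        + 32500 * fps_X ^ 3 * ((E 2 ^ 3 * E 10 ^ 10) / (E 1 ^ 7 * E 5 ^ 3))
        + 50000 * fps_X ^ 4 * ((E 2 ^ 4 * E 10 ^ 13) / (E 1 ^ 10 * E 5 ^ 4))"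

definition rhs2 :: "rat fps" where
  "rhs2 = 8327 * E 2 * E 5 ^ 2
        + 28312350 * fps_X * ((E 2 ^ 2 * E 5 * E 10 ^ 3) / E 1 ^ 3)
        + 7557865625 * fps_X ^ 2 * ((E 2 ^ 3 * E 10 ^ 6) / E 1 ^ 6)
        + 678027312500 * fps_X ^ 3 * ((E 2 ^ 4 * E 10 ^ 9) / (E 1 ^ 9 * E 5))
        + 3072484775 * 10 ^ 4 * fps_X ^ 4 * ((E 2 ^ 5 * E 10 ^ 12) / (E 1 ^ 12 * E 5 ^ 2))
        + 84314744 * 10 ^ 7 * fps_X ^ 5 * ((E 2 ^ 6 * E 10 ^ 15) / (E 1 ^ 15 * E 5 ^ 3))
        + 154486601 * 10 ^ 8 * fps_X ^ 6 * ((E 2 ^ 7 * E 10 ^ 18) / (E 1 ^ 18 * E 5 ^ 4))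
        + 20019467 * 10 ^ 10 * fps_X ^ 7 * ((E 2 ^ 8 * E 10 ^ 21) / (E 1 ^ 21 * E 5 ^ 5))
        + 18998414 * 10 ^ 11 * fps_X ^ 8 * ((E 2 ^ 9 * E 10 ^ 24) / (E 1 ^ 24 * E 5 ^ 6))
        + 134691824 * 10 ^ 11 * fps_X ^ 9 * ((E 2 ^ 10 * E 10 ^ 27) / (E 1 ^ 27 * E 5 ^ 7))
        + 71952464 * 10 ^ 12 * fps_X ^ 10 * ((E 2 ^ 11 * E 10 ^ 30) / (E 1 ^ 30 * E 5 ^ 8))
        + 28911776 * 10 ^ 13 * fps_X ^ 11 * ((E 2 ^ 12 * E 10 ^ 33) / (E 1 ^ 33 * E 5 ^ 9))
        + 862432 * 10 ^ 15 * fps_X ^ 12 * ((E 2 ^ 13 * E 10 ^ 36) / (E 1 ^ 36 * E 5 ^ 10))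
        + 1856 * 10 ^ 18 * fps_X ^ 13 * ((E 2 ^ 14 * E 10 ^ 39) / (E 1 ^ 39 * E 5 ^ 11))
        + 272896 * 10 ^ 16 * fps_X ^ 14 * ((E 2 ^ 15 * E 10 ^ 42) / (E 1 ^ 42 * E 5 ^ 12))
        + 24576 * 10 ^ 17 * fps_X ^ 15 * ((E 2 ^ 16 * E 10 ^ 45) / (E 1 ^ 45 * E 5 ^ 13))
        + 1024 * 10 ^ 18 * fps_X ^ 16 * ((E 2 ^ 17 * E 10 ^ 48) / (E 1 ^ 48 * E 5 ^ 14))"

lemma poly1_distrib:
  fixes a x :: "rat fls"
  shows "a * (18 + 720 * x + 7625 * x ^ 2 + 32500 * x ^ 3 + 50000 * x ^ 4)
    = 18 * a + 720 * (a * x) + 7625 * (a * x ^ 2) + 32500 * (a * x ^ 3) + 50000 * (a * x ^ 4)"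
  by (simp add: algebra_simps)

text \<open>The form at q^5 in which the first trace delivers \<open>rhs1\<close>;
  \<open>L_rhs1\<close> is the same factorisation at q, the input of the second trace.\<close>

lemma LD_rhs1:
  "LD rhs1 = EL 5 ^ 2 * EL 50 * (18 + 720 * xx + 7625 * xx ^ 2 + 32500 * xx ^ 3 + 50000 * xx ^ 4)"
proof -
  have x: "EL 5 ^ 2 * EL 50 * xx = q ^ 5 * ((EL 10 * EL 50 ^ 4) / (EL 5 * EL 25))"
    "EL 5 ^ 2 * EL 50 * xx ^ 2 = (q ^ 5) ^ 2 * ((EL 10 ^ 2 * EL 50 ^ 7) / (EL 5 ^ 4 * EL 25 ^ 2))"
    "EL 5 ^ 2 * EL 50 * xx ^ 3 = (q ^ 5) ^ 3 * ((EL 10 ^ 3 * EL 50 ^ 10) / (EL 5 ^ 7 * EL 25 ^ 3))"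
    "EL 5 ^ 2 * EL 50 * xx ^ 4 = (q ^ 5) ^ 4 * ((EL 10 ^ 4 * EL 50 ^ 13) / (EL 5 ^ 10 * EL 25 ^ 4))"
    by (simp_all add: xx_def field_simps power_numeral_reduce)
  show ?thesis
    unfolding poly1_distrib x rhs1_def
    by (simp add: dil_mult dil_power dil_X LD_divide E_power_nth_0 dil_E fls_hom mult.assoc)
qed

lemma L_rhs1:
  defines "y \<equiv> q * EL 2 * EL 10 ^ 3 / (EL 1 ^ 3 * EL 5)"
  shows "fps_to_fls rhs1 = EL 1 ^ 2 * EL 10 * (18 + 720 * y + 7625 * y ^ 2 + 32500 * y ^ 3 + 50000 * y ^ 4)"
proof -
  have y: "EL 1 ^ 2 * EL 10 * y = q * ((EL 2 * EL 10 ^ 4) / (EL 1 * EL 5))"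
    "EL 1 ^ 2 * EL 10 * y ^ 2 = q ^ 2 * ((EL 2 ^ 2 * EL 10 ^ 7) / (EL 1 ^ 4 * EL 5 ^ 2))"
    "EL 1 ^ 2 * EL 10 * y ^ 3 = q ^ 3 * ((EL 2 ^ 3 * EL 10 ^ 10) / (EL 1 ^ 7 * EL 5 ^ 3))"
    "EL 1 ^ 2 * EL 10 * y ^ 4 = q ^ 4 * ((EL 2 ^ 4 * EL 10 ^ 13) / (EL 1 ^ 10 * EL 5 ^ 4))"
    by (simp_all add: y_def field_simps power_numeral_reduce)
  show ?thesis
    unfolding poly1_distrib y rhs1_def
    by (simp add: fls_divide_fps E_power_nth_0 fls_hom mult.assoc)
qed

definition poly2 :: "rat fls \<Rightarrow> rat fls" where
  "poly2 x = 8327 + 28312350 * x + 7557865625 * x ^ 2 + 678027312500 * x ^ 3 + 3072484775 * 10 ^ 4 * x ^ 4 + 84314744 * 10 ^ 7 * x ^ 5 + 154486601 * 10 ^ 8 * x ^ 6 + 20019467 * 10 ^ 10 * x ^ 7 + 18998414 * 10 ^ 11 * x ^ 8 + 134691824 * 10 ^ 11 * x ^ 9 + 71952464 * 10 ^ 12 * x ^ 10 + 28911776 * 10 ^ 13 * x ^ 11 + 862432 * 10 ^ 15 * x ^ 12 + 1856 * 10 ^ 18 * x ^ 13 + 272896 * 10 ^ 16 * x ^ 14 + 24576 * 10 ^ 17 * x ^ 15 + 1024 * 10 ^ 18 * x ^ 16"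

lemma poly2_distrib:
  "a * poly2 x = 8327 * a + 28312350 * (a * x) + 7557865625 * (a * x ^ 2) + 678027312500 * (a * x ^ 3) + 3072484775 * 10 ^ 4 * (a * x ^ 4) + 84314744 * 10 ^ 7 * (a * x ^ 5) + 154486601 * 10 ^ 8 * (a * x ^ 6) + 20019467 * 10 ^ 10 * (a * x ^ 7) + 18998414 * 10 ^ 11 * (a * x ^ 8) + 134691824 * 10 ^ 11 * (a * x ^ 9) + 71952464 * 10 ^ 12 * (a * x ^ 10) + 28911776 * 10 ^ 13 * (a * x ^ 11) + 862432 * 10 ^ 15 * (a * x ^ 12) + 1856 * 10 ^ 18 * (a * x ^ 13) + 272896 * 10 ^ 16 * (a * x ^ 14) + 24576 * 10 ^ 17 * (a * x ^ 15) + 1024 * 10 ^ 18 * (a * x ^ 16)"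
  unfolding poly2_def by (simp add: algebra_simps)

lemma LD_rhs2: "LD rhs2 = EL 10 * EL 25 ^ 2 * poly2 xx"
proof -
  have x0: "EL 10 * EL 25 ^ 2 * xx = q ^ 5 * ((EL 10 ^ 2 * EL 25 * EL 50 ^ 3) / EL 5 ^ 3)"
    by (simp add: xx_def field_simps power_numeral_reduce)
  \<comment> \<open>From the second power on \<open>EL 25\<close> no longer stands in the numerator,
    so one formula covers these powers.\<close>
  have xs: "EL 10 * EL 25 ^ 2 * xx ^ (m + 2)
      = (q ^ 5) ^ (m + 2) * ((EL 10 ^ (m + 3) * EL 50 ^ (3 * m + 6)) / (EL 5 ^ (3 * m + 6) * EL 25 ^ m))" for m
    by (simp add: xx_def field_simps power_numeral_reduce power_mult power_add power_mult_distrib)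
  have x1: "EL 10 * EL 25 ^ 2 * xx ^ 2 = (q ^ 5) ^ 2 * ((EL 10 ^ 3 * EL 50 ^ 6) / EL 5 ^ 6)"
    "EL 10 * EL 25 ^ 2 * xx ^ 3 = (q ^ 5) ^ 3 * ((EL 10 ^ 4 * EL 50 ^ 9) / (EL 5 ^ 9 * EL 25))"
    using xs[of 0] xs[of 1] by (simp_all add: eval_nat_numeral)
  note x = x0 x1 xs[of 2, simplified] xs[of 3, simplified] xs[of 4, simplified]
    xs[of 5, simplified] xs[of 6, simplified] xs[of 7, simplified] xs[of 8, simplified] xs[of 9, simplified]
    xs[of 10, simplified] xs[of 11, simplified] xs[of 12, simplified] xs[of 13, simplified] xs[of 14, simplified]
  show ?thesis
    unfolding poly2_distrib x rhs2_def
    by (simp add: dil_mult dil_power dil_X LD_divide E_power_nth_0 dil_E fls_hom mult.assoc)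
qed

text \<open>Origin of the seventeen coefficients: the left side collects the five traces of the
  terms of \<open>rhs1\<close> over the common denominator \<open>w ^ 16\<close>, and the right side
  is its expansion in \<open>w = t - 4\<close>.\<close>

lemma poly2_identity:
  fixes w t :: "rat fls"
  assumes "t = w + 4"
  shows "- 18 * w ^ 16 + 720 * (t + 1) * w ^ 15 + 7625 * (t + 1)^2 * (2816 + 1024 * t + 976 * t^2 + 144 * t^3 + t^4) * w ^ 10
   + 32500 * (t + 1)^2 * (2293760 + 6881280 * t + 9236480 * t^2 + 7234560 * t^3
    + 3827200 * t^4 + 1498560 * t^5 + 362480 * t^6 + 27780 * t^7 + 385 * t^8) * w ^ 5
   + 50000 * (t + 1)^2 * (1342177280 + 9646899200 * t + 27535605760 * t^2 + 43767562240 * t^3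
    + 45983334400 * t^4 + 35288514560 * t^5 + 20633600000 * t^6 + 9188024320 * t^7 + 3097057280 * t^8
    + 748518400 * t^9 + 102353280 * t^10 + 5884800 * t^11 + 103935 * t^12 + 290 * t^13)
   = 8327 * w ^ 16
    + 28312350 * w ^ 15
    + 7557865625 * w ^ 14
    + 678027312500 * w ^ 13
    + 3072484775 * 10 ^ 4 * w ^ 12
    + 84314744 * 10 ^ 7 * w ^ 11
    + 154486601 * 10 ^ 8 * w ^ 10
    + 20019467 * 10 ^ 10 * w ^ 9
    + 18998414 * 10 ^ 11 * w ^ 8
    + 134691824 * 10 ^ 11 * w ^ 7
    + 71952464 * 10 ^ 12 * w ^ 6
    + 28911776 * 10 ^ 13 * w ^ 5
    + 862432 * 10 ^ 15 * w ^ 4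
    + 1856 * 10 ^ 18 * w ^ 3
    + 272896 * 10 ^ 16 * w ^ 2
    + 24576 * 10 ^ 17 * w ^ 1
    + 1024 * 10 ^ 18 * w ^ 0"
  unfolding assms by (simp add: algebra_simps power_numeral_reduce)

lemma spt_section_10: "sec 5 2 (sec 2 1 spt_gf) = rhs1"
proof (rule LD_eqD)
  \<comment> \<open>The normalising factor \<open>(q^2 E_50)^9 / (q E_25)^6\<close> of
    \<open>e2 ^ 9 / e1 ^ 6\<close>. Its grade 12 is 2 modulo 5, so the section wanted is
    \<open>K\<close> times a projection to grade 0.\<close>
  define K where "K = q ^ 12 * EL 50 ^ 9 / EL 25 ^ 6"
  have gK: "graded 12 K"
  proof -
    have "graded (int 12 * 1 + int 9 * 0 - int 6 * 0) K"
      unfolding K_def by (intro graded_divide graded_mult graded_power graded_X graded_EL) auto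
    then show ?thesis by simp
  qed
  have "fps_to_fls (sec 2 1 spt_gf) * EL 1 ^ 6 = EL 2 ^ 9"
    using spt_odd_gf by (metis fls_times_fps_to_fls fps_to_fls_power)
  then have "fps_to_fls (sec 2 1 spt_gf) = EL 2 ^ 9 / EL 1 ^ 6"
    by (simp add: eq_divide_eq)
  also have "\<dots> = K * (gg ^ 4 / ff)"
    by (simp add: K_def gg_def ff_def e1_def e2_def field_simps power_numeral_reduce)
  finally have L: "fps_to_fls (sec 2 1 spt_gf) = K * (gg ^ 4 / ff)" .
  have "proj 2 (fps_to_fls (sec 2 1 spt_gf)) = K * proj 0 (gg ^ 4 / ff)"
    unfolding L by (rule proj_mult_shift[OF gK]) simp
  also have "\<dots> = K * (tt * (528 + 1452 * tt + 713 * tt^2 + 432 * tt^3 + 18 * tt^4) / ww ^ 3)"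
    unfolding proj_g4_f ..
  also have "\<dots> = K * tt * ww * (18 + 720 * xx + 7625 * xx ^ 2 + 32500 * xx ^ 3 + 50000 * xx ^ 4)"
  proof -
    \<comment> \<open>The Taylor expansion at \<open>tt = 4\<close> produces the coefficients of the
      first series.\<close>
    have "528 + 1452 * tt + 713 * tt^2 + 432 * tt^3 + 18 * tt^4 = 18 * ww ^ 4 + 720 * ww ^ 3 + 7625 * ww ^ 2 + 32500 * ww + 50000"
      unfolding level10_relations(6) by (simp add: algebra_simps power_numeral_reduce)
    then show ?thesis
      unfolding xx_ww using ww_nz by (simp add: field_simps power_numeral_reduce)
  qed
  also have "K * tt * ww = q ^ 2 * (EL 5 ^ 2 * EL 50)"
    by (simp add: K_def tt_def ww_def field_simps power_numeral_reduce)
  finally have "q ^ 2 * LD (sec 5 2 (sec 2 1 spt_gf)) = q ^ 2 * LD rhs1"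
    using proj_fps[of 2 "sec 2 1 spt_gf"] by (simp add: LD_rhs1 mult.assoc)
  then show "LD (sec 5 2 (sec 2 1 spt_gf)) = LD rhs1" by simp
qed

lemma spt_section_50: "sec 5 2 rhs1 = rhs2"
proof (rule LD_eqD)
  \<comment> \<open>\<open>K\<close> is chosen with \<open>E_1^2 E_10 = K * e1 ^ 2\<close>, and
    \<open>Y\<close> is the grade 0 factor in \<open>y = Y * (e2 / e1 ^ 3)\<close>; the eta
    quotients for \<open>tt\<close> and \<open>tt + 1\<close> show that it is
    \<open>(tt + 1) / tt\<close>.\<close>
  define K Y where "K = q ^ 2 * (EL 10 * EL 25 ^ 2)" and "Y = (tt + 1) / tt"
  define y where "y = q * EL 2 * EL 10 ^ 3 / (EL 1 ^ 3 * EL 5)"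
  have gK: "graded 2 K"
  proof -
    have "graded (int 2 * 1 + (0 + int 2 * 0)) K"
      unfolding K_def by (intro graded_mult graded_power graded_X graded_EL) auto
    then show ?thesis by simp
  qed
  have gY: "graded 0 Y" unfolding Y_def by (intro graded0_intros)
  have Y: "Y = EL 10 ^ 3 * EL 50 / (EL 5 * EL 25 ^ 3)"
    unfolding Y_def level10_relations(7) unfolding tt_def by (simp add: field_simps power_numeral_reduce)
  have y: "EL 1 ^ 2 * EL 10 = K * e1 ^ 2" "EL 1 ^ 2 * EL 10 * y = K * (Y * (e2 / e1))"
    "EL 1 ^ 2 * EL 10 * y ^ 2 = K * (Y ^ 2 * (1 / ff ^ 2))"
    "EL 1 ^ 2 * EL 10 * y ^ 3 = K * (Y ^ 3 * (1 / (ff ^ 3 * e1)))"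
    "EL 1 ^ 2 * EL 10 * y ^ 4 = K * (Y ^ 4 * (1 / (ff ^ 4 * e1 ^ 2)))"
    by (simp_all add: K_def Y y_def ff_def e1_def e2_def field_simps power_numeral_reduce)
  define T where "T = 18 * e1 ^ 2 + 720 * (Y * (e2 / e1)) + 7625 * (Y ^ 2 * (1 / ff ^ 2))
      + 32500 * (Y ^ 3 * (1 / (ff ^ 3 * e1))) + 50000 * (Y ^ 4 * (1 / (ff ^ 4 * e1 ^ 2)))"
  have "fps_to_fls rhs1 = K * T"
  proof -
    have "fps_to_fls rhs1 = 18 * (EL 1 ^ 2 * EL 10) + 720 * (EL 1 ^ 2 * EL 10 * y) + 7625 * (EL 1 ^ 2 * EL 10 * y ^ 2)
        + 32500 * (EL 1 ^ 2 * EL 10 * y ^ 3) + 50000 * (EL 1 ^ 2 * EL 10 * y ^ 4)"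
      unfolding L_rhs1 y_def[symmetric] by (rule poly1_distrib)
    then show ?thesis
      unfolding y(2-5) unfolding y(1) T_def by (simp only: distrib_left mult.left_commute[of K "numeral _"])
  qed
  then have "proj 2 (fps_to_fls rhs1) = K * proj 0 T"
    using proj_mult_shift[OF gK, of 2] by simp
  also have "proj 0 T = 18 * (- 1) + 720 * (Y * proj 0 (e2 / e1)) + 7625 * (Y ^ 2 * proj 0 (1 / ff ^ 2))
      + 32500 * (Y ^ 3 * proj 0 (1 / (ff ^ 3 * e1))) + 50000 * (Y ^ 4 * proj 0 (1 / (ff ^ 4 * e1 ^ 2)))"
    unfolding T_def proj_add
    by (simp only: proj_mult0[OF graded_numeral] proj_mult0[OF graded0_power[OF gY]] proj_mult0[OF gY] proj_e1_square)
  also have "\<dots> = poly2 xx"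
  proof -
    define w t where "w = ww" and "t = tt"
    have nz: "w \<noteq> 0" "t \<noteq> 0" "t + 1 \<noteq> 0"
      using ww_nz e_nz(3) tt1_nz by (simp_all add: w_def t_def)
    have t: "t = w + 4" using level10_relations(6) by (simp add: w_def t_def)
    define P2 P3 P4 where "P2 = 2816 + 1024 * t + 976 * t^2 + 144 * t^3 + t^4"
      and "P3 = 2293760 + 6881280 * t + 9236480 * t^2 + 7234560 * t^3
    + 3827200 * t^4 + 1498560 * t^5 + 362480 * t^6 + 27780 * t^7 + 385 * t^8"
      and "P4 = 1342177280 + 9646899200 * t + 27535605760 * t^2 + 43767562240 * t^3
    + 45983334400 * t^4 + 35288514560 * t^5 + 20633600000 * t^6 + 9188024320 * t^7 + 3097057280 * t^8
    + 748518400 * t^9 + 102353280 * t^10 + 5884800 * t^11 + 103935 * t^12 + 290 * t^13"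
    have Yt: "Y = (t + 1) / t" by (simp add: Y_def t_def)
    \<comment> \<open>The k-th power of \<open>Y\<close> cancels \<open>t ^ k\<close> from the trace
      and all powers of \<open>t + 1\<close> in its denominator. Only powers of \<open>w\<close>
      remain below, at most the sixteenth.\<close>
    have terms: "Y * (t / w) = (t + 1) * w ^ 15 / w ^ 16"
      "Y ^ 2 * (t^2 * P2 / w^6) = (t + 1)^2 * P2 * w ^ 10 / w ^ 16"
      "Y ^ 3 * (t^3 * P3 / (w^11 * (t + 1))) = (t + 1)^2 * P3 * w ^ 5 / w ^ 16"
      "Y ^ 4 * (t^4 * P4 / (w^16 * (t + 1)^2)) = (t + 1)^2 * P4 / w ^ 16"
      using nz unfolding Yt power_divide by (simp_all add: frac_eq_eq) (simp_all add: power_numeral_reduce mult_ac)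
    have "18 * (- 1) + 720 * (Y * (t / w)) + 7625 * (Y ^ 2 * (t^2 * P2 / w^6))
        + 32500 * (Y ^ 3 * (t^3 * P3 / (w^11 * (t + 1)))) + 50000 * (Y ^ 4 * (t^4 * P4 / (w^16 * (t + 1)^2)))
      = (- 18 * w ^ 16 + 720 * (t + 1) * w ^ 15 + 7625 * (t + 1)^2 * P2 * w ^ 10
         + 32500 * (t + 1)^2 * P3 * w ^ 5 + 50000 * (t + 1)^2 * P4) / w ^ 16"
      unfolding terms using nz by (simp add: add_divide_distrib diff_divide_distrib mult.assoc)
    also have "\<dots> = poly2 (1 / w)"
    proof -
      have p: "w ^ 16 * (1 / w) ^ k = w ^ (16 - k)" if "k \<le> 16" for k
        using nz that by (simp add: power_diff power_one_over)
      have ps: "w ^ 16 * (1 / w) = w ^ 15"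
        "w ^ 16 * (1 / w) ^ 2 = w ^ 14"
        "w ^ 16 * (1 / w) ^ 3 = w ^ 13"
        "w ^ 16 * (1 / w) ^ 4 = w ^ 12"
        "w ^ 16 * (1 / w) ^ 5 = w ^ 11"
        "w ^ 16 * (1 / w) ^ 6 = w ^ 10"
        "w ^ 16 * (1 / w) ^ 7 = w ^ 9"
        "w ^ 16 * (1 / w) ^ 8 = w ^ 8"
        "w ^ 16 * (1 / w) ^ 9 = w ^ 7"
        "w ^ 16 * (1 / w) ^ 10 = w ^ 6"
        "w ^ 16 * (1 / w) ^ 11 = w ^ 5"
        "w ^ 16 * (1 / w) ^ 12 = w ^ 4"
        "w ^ 16 * (1 / w) ^ 13 = w ^ 3"
        "w ^ 16 * (1 / w) ^ 14 = w ^ 2"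
        "w ^ 16 * (1 / w) ^ 15 = w"
        "w ^ 16 * (1 / w) ^ 16 = 1"
        using p[of 1] p[of 2] p[of 3] p[of 4] p[of 5] p[of 6] p[of 7] p[of 8] p[of 9] p[of 10] p[of 11] p[of 12] p[of 13] p[of 14] p[of 15] p[of 16]
        by simp_all
      have "w ^ 16 * poly2 (1 / w) = - 18 * w ^ 16 + 720 * (t + 1) * w ^ 15 + 7625 * (t + 1)^2 * P2 * w ^ 10
         + 32500 * (t + 1)^2 * P3 * w ^ 5 + 50000 * (t + 1)^2 * P4"
        unfolding poly2_distrib ps P2_def P3_def P4_def poly2_identity[OF t] by simp
      then show ?thesis
        using nz by (simp add: divide_eq_eq mult.commute)
    qed
    finally show ?thesis
      unfolding proj_e2_e1 proj_f_minus2 proj_f_minus3_e1 proj_f_minus4_e1_minus2 xx_ww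
        w_def t_def P2_def P3_def P4_def .
  qed
  finally have "q ^ 2 * LD (sec 5 2 rhs1) = q ^ 2 * LD rhs2"
    using proj_fps[of 2 rhs1] by (simp add: LD_rhs2 K_def mult.assoc)
  then show "LD (sec 5 2 rhs1) = LD rhs2" by simp
qed

theorem theorem1p8:
  shows "(Abs_fps (\<lambda>n. of_nat (spt_omega_bar (10 * n + 5))) =
          18 * E 1 ^ 2 * E 10
        + 720 * fps_X * ((E 2 * E 10 ^ 4) / (E 1 * E 5))
        + 7625 * fps_X ^ 2 * ((E 2 ^ 2 * E 10 ^ 7) / (E 1 ^ 4 * E 5 ^ 2))
        + 32500 * fps_X ^ 3 * ((E 2 ^ 3 * E 10 ^ 10) / (E 1 ^ 7 * E 5 ^ 3))
        + 50000 * fps_X ^ 4 * ((E 2 ^ 4 * E 10 ^ 13) / (E 1 ^ 10 * E 5 ^ 4)))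
       \<and> (Abs_fps (\<lambda>n. of_nat (spt_omega_bar (50 * n + 25))) =
          8327 * E 2 * E 5 ^ 2
        + 28312350 * fps_X * ((E 2 ^ 2 * E 5 * E 10 ^ 3) / E 1 ^ 3)
        + 7557865625 * fps_X ^ 2 * ((E 2 ^ 3 * E 10 ^ 6) / E 1 ^ 6)
        + 678027312500 * fps_X ^ 3 * ((E 2 ^ 4 * E 10 ^ 9) / (E 1 ^ 9 * E 5))
        + 3072484775 * 10 ^ 4 * fps_X ^ 4 * ((E 2 ^ 5 * E 10 ^ 12) / (E 1 ^ 12 * E 5 ^ 2))
        + 84314744 * 10 ^ 7 * fps_X ^ 5 * ((E 2 ^ 6 * E 10 ^ 15) / (E 1 ^ 15 * E 5 ^ 3))
        + 154486601 * 10 ^ 8 * fps_X ^ 6 * ((E 2 ^ 7 * E 10 ^ 18) / (E 1 ^ 18 * E 5 ^ 4))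
        + 20019467 * 10 ^ 10 * fps_X ^ 7 * ((E 2 ^ 8 * E 10 ^ 21) / (E 1 ^ 21 * E 5 ^ 5))
        + 18998414 * 10 ^ 11 * fps_X ^ 8 * ((E 2 ^ 9 * E 10 ^ 24) / (E 1 ^ 24 * E 5 ^ 6))
        + 134691824 * 10 ^ 11 * fps_X ^ 9 * ((E 2 ^ 10 * E 10 ^ 27) / (E 1 ^ 27 * E 5 ^ 7))
        + 71952464 * 10 ^ 12 * fps_X ^ 10 * ((E 2 ^ 11 * E 10 ^ 30) / (E 1 ^ 30 * E 5 ^ 8))
        + 28911776 * 10 ^ 13 * fps_X ^ 11 * ((E 2 ^ 12 * E 10 ^ 33) / (E 1 ^ 33 * E 5 ^ 9))
        + 862432 * 10 ^ 15 * fps_X ^ 12 * ((E 2 ^ 13 * E 10 ^ 36) / (E 1 ^ 36 * E 5 ^ 10))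
        + 1856 * 10 ^ 18 * fps_X ^ 13 * ((E 2 ^ 14 * E 10 ^ 39) / (E 1 ^ 39 * E 5 ^ 11))
        + 272896 * 10 ^ 16 * fps_X ^ 14 * ((E 2 ^ 15 * E 10 ^ 42) / (E 1 ^ 42 * E 5 ^ 12))
        + 24576 * 10 ^ 17 * fps_X ^ 15 * ((E 2 ^ 16 * E 10 ^ 45) / (E 1 ^ 45 * E 5 ^ 13))
        + 1024 * 10 ^ 18 * fps_X ^ 16 * ((E 2 ^ 17 * E 10 ^ 48) / (E 1 ^ 48 * E 5 ^ 14)))"
proof -
  have 1: "Abs_fps (\<lambda>n. of_nat (spt_omega_bar (10 * n + 5))) = rhs1"
  proof (rule fps_ext)
    fix n :: nat
    have "2 * (5 * n + 2) + 1 = 10 * n + 5" by simp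
    then show "fps_nth (Abs_fps (\<lambda>n. of_nat (spt_omega_bar (10 * n + 5)))) n = fps_nth rhs1 n"
      by (simp only: spt_section_10[symmetric] sec_nth spt_gf_def fps_nth_Abs_fps)
  qed
  have 2: "Abs_fps (\<lambda>n. of_nat (spt_omega_bar (50 * n + 25))) = rhs2"
  proof (rule fps_ext)
    fix n :: nat
    have "2 * (5 * (5 * n + 2) + 2) + 1 = 50 * n + 25" by simp
    then show "fps_nth (Abs_fps (\<lambda>n. of_nat (spt_omega_bar (50 * n + 25)))) n = fps_nth rhs2 n"
      by (simp only: spt_section_50[symmetric] spt_section_10[symmetric] sec_nth spt_gf_def fps_nth_Abs_fps)
  qed
  show ?thesis
    unfolding 1 2 rhs1_def rhs2_def by (intro conjI refl)
qed

end
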